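(* Let $d\ge 1$, let $(g_n)_{n\ge 1}$ be i.i.d. random $d\times d$ real matrices with common law $\mu$, and let $G_n=g_n\cdots g_1$. Assume that there exist $s_0\in I_\mu^\circ$ and $\alpha\in(0,1)$ with $\mathbb E\big[\|g_1\|^{s_0+\alpha}\iota(g_1)^{-\alpha}\big]<+\infty$, and that one of the following holds: (a) (invertible matrices) $\mu$ is supported on $GL(d,\mathbb R)$, no finite union of proper nonzero subspaces of $\mathbb R^d$ is $\Gamma_\mu$-invariant, and $\Gamma_\mu$ contains at least one proximal matrix; (b) (positive matrices) every $g\in\Gamma_\mu$ is an allowable positive matrix, $\Gamma_\mu$ contains at least one matrix all of whose entries are strictly positive, and $\mu$ is non-arithmetic. Let $s\in I_\mu^\circ$ and $q=\Lambda'(s)$. Then, for any positive sequence $(l_n)_{n\ge1}$ with $l_n\to0$ as $n\to\infty$, we have, uniformly in $|l|\le l_n$, $$\lim_{n\to\infty}\frac1n\log\mathbb P\big(\log\|G_n\|\ge n(q+l)\big)=-\Lambda^*(q).$$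
   Context: Notation. $|\cdot|$ is the Euclidean norm on $\mathbb R^d$, $\mathbb S^{d-1}$ the unit sphere, $\|g\|=\sup_{x\in\mathbb S^{d-1}}|gx|$. A matrix is called positive if all its entries are $\ge 0$; a positive matrix is allowable if every row and every column has a strictly positive entry. A matrix is proximal if it has an algebraically simple dominant eigenvalue (of modulus strictly larger than that of all other eigenvalues). $M(d,\mathbb R)$ is the set of $d\times d$ real matrices, and $\Gamma_\mu$ is the smallest closed subsemigroup of $M(d,\mathbb R)$ generated by $\operatorname{supp}\mu$. $\mathcal S=\mathbb S^{d-1}$ in the invertible case (a), and $\mathcal S=\mathbb S^{d-1}_+=\{x\ge0:|x|=1\}$ in the positive case (b). For $x\in\mathcal S$, $g\cdot x=gx/|gx|$, and $\iota(g)=\inf_{x\in\mathcal S}|gx|$. In the positive case, $V(\Gamma_\mu)$ is the closure of $\{v_g\in\mathbb S^{d-1}_+: g\in\Gamma_\mu \text{ with all entries strictly positive}\}$, where $v_g$ is the unit Perron–Frobenius eigenvector of $g$. $\mu$ is arithmetic if there exist $t>0$, $\beta\in[0,2\pi)$ and a function $\vartheta:\mathcal S\to\mathbb R$ such that $\exp[it\log|gx|-i\beta+i\vartheta(g\cdot x)-i\vartheta(x)]=1$ for all $g\in\Gamma_\mu$ and $x\in V(\Gamma_\mu)$; otherwise it is non-arithmetic. $I_\mu=\{s\ge0:\mathbb E(\|g_1\|^s)<+\infty\}$ (an interval), with interior $I_\mu^\circ$. For $s\in I_\mu$, $\kappa(s)=\lim_{n\to\infty}(\mathbb E\|G_n\|^s)^{1/n}$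 and $\Lambda(s)=\log\kappa(s)$; $\Lambda$ is convex on $I_\mu$ and analytic on $I_\mu^\circ$. $\Lambda^*(q')=\sup_{s\in I_\mu}\{sq'-\Lambda(s)\}$.
   Formalization: The logarithm of a zero probability is read as 0; this matters only for d=1 in case (a) with |g_1| almost surely constant (e.g. g_n=2), where the probability vanishes for l>0 and the stated limit fails with log 0 = -∞. *)

theory Defs
  imports "HOL-Probability.Probability" "HOL-Computational_Algebra.Polynomial"
begin

section \<open>Matrices\<close>

definition mnorm :: "real^'n^'n \<Rightarrow> real" where
  "mnorm A = onorm (\<lambda>x. A *v x)"

definition pos_sphere :: "(real^'n) set" where
  "pos_sphere = {x. norm x = 1 \<and> (\<forall>i. 0 \<le> x $ i)}"

text \<open>The parameter \<open>S\<close> is \<open>sphere 0 1\<close> in the invertible case and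
  \<^const>\<open>pos_sphere\<close> in the positive case.\<close>

definition iota :: "(real^'n) set \<Rightarrow> real^'n^'n \<Rightarrow> real" where
  "iota S A = (INF x\<in>S. norm (A *v x))"

definition proj_act :: "real^'n^'n \<Rightarrow> real^'n \<Rightarrow> real^'n" where
  "proj_act A x = (A *v x) /\<^sub>R norm (A *v x)"

definition positive_matrix :: "real^'n^'n \<Rightarrow> bool" where
  "positive_matrix A \<longleftrightarrow> (\<forall>i j. 0 \<le> A $ i $ j)"

definition allowable :: "real^'n^'n \<Rightarrow> bool" where
  "allowable A \<longleftrightarrow> positive_matrix A \<and> (\<forall>i. \<exists>j. 0 < A $ i $ j) \<and> (\<forall>j. \<exists>i. 0 < A $ i $ j)"

definition strictly_positive_matrix :: "real^'n^'n \<Rightarrow> bool" where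
  "strictly_positive_matrix A \<longleftrightarrow> (\<forall>i j. 0 < A $ i $ j)"

text \<open>Eigenvalues are complex, also those of a real matrix.\<close>

definition complexify :: "real^'n^'n \<Rightarrow> complex^'n^'n" where
  "complexify A = (\<chi> i j. complex_of_real (A $ i $ j))"

definition is_eigenvalue :: "real^'n^'n \<Rightarrow> complex \<Rightarrow> bool" where
  "is_eigenvalue A z \<longleftrightarrow> (\<exists>v. v \<noteq> 0 \<and> complexify A *v v = z *s v)"

definition charpoly :: "real^'n^'n \<Rightarrow> complex poly" where
  "charpoly A = det (\<chi> i j. (if i = j then [:0, 1:] else 0) - [:complexify A $ i $ j:])"

definition dominant_eigenvalue :: "real^'n^'n \<Rightarrow> complex \<Rightarrow> bool" where
  "dominant_eigenvalue A z \<longleftrightarrow>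
     is_eigenvalue A z \<and> (\<forall>w. is_eigenvalue A w \<and> w \<noteq> z \<longrightarrow> cmod w < cmod z)"

definition proximal :: "real^'n^'n \<Rightarrow> bool" where
  "proximal A \<longleftrightarrow> (\<exists>z. dominant_eigenvalue A z \<and> order z (charpoly A) = 1)"

text \<open>For a strictly positive matrix the Perron--Frobenius theorem says that exactly one
  vector \<open>v\<close> satisfies this predicate.\<close>

definition perron_frobenius_vector :: "real^'n^'n \<Rightarrow> real^'n \<Rightarrow> bool" where
  "perron_frobenius_vector A v \<longleftrightarrow>
     v \<in> pos_sphere \<and> (\<exists>r. dominant_eigenvalue A (complex_of_real r) \<and> A *v v = r *\<^sub>R v)"

section \<open>The law of one matrix and its semigroup\<close>

definition measure_support :: "'a::topological_space measure \<Rightarrow> 'a set" where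
  "measure_support \<mu> = {x. \<forall>U. open U \<and> x \<in> U \<longrightarrow> 0 < emeasure \<mu> U}"

text \<open>The closure is taken in the space of all matrices, so in the invertible case
  \<open>Gamma \<mu>\<close> may contain singular matrices.\<close>

definition Gamma :: "(real^'n^'n) measure \<Rightarrow> (real^'n^'n) set" where
  "Gamma \<mu> = \<Inter> {T. closed T \<and> measure_support \<mu> \<subseteq> T \<and> (\<forall>A\<in>T. \<forall>B\<in>T. A ** B \<in> T)}"

definition strongly_irreducible :: "(real^'n^'n) set \<Rightarrow> bool" where
  "strongly_irreducible G \<longleftrightarrow>
     \<not> (\<exists>F. finite F \<and> F \<noteq> {} \<and>
           (\<forall>W\<in>F. subspace W \<and> W \<noteq> {0} \<and> W \<noteq> UNIV) \<and>
           (\<forall>A\<in>G. (\<lambda>x. A *v x) ` (\<Union>F) \<subseteq> \<Union>F))"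

definition V_set :: "(real^'n^'n) set \<Rightarrow> (real^'n) set" where
  "V_set G = closure {v. \<exists>A\<in>G. strictly_positive_matrix A \<and> perron_frobenius_vector A v}"

text \<open>For the positive case only. The function \<open>\<theta>\<close> is only evaluated on
  \<^const>\<open>pos_sphere\<close> when all elements of \<open>Gamma \<mu>\<close> are allowable.\<close>

definition arithmetic :: "(real^'n^'n) measure \<Rightarrow> bool" where
  "arithmetic \<mu> \<longleftrightarrow>
     (\<exists>t>0. \<exists>\<beta>\<in>{0..<2*pi}. \<exists>\<theta>::real^'n \<Rightarrow> real.
        \<forall>A\<in>Gamma \<mu>. \<forall>x\<in>V_set (Gamma \<mu>).
          exp (\<i> * complex_of_real
                 (t * ln (norm (A *v x)) - \<beta> + \<theta> (proj_act A x) - \<theta> x)) = 1)"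

definition invertible_case :: "(real^'n^'n) measure \<Rightarrow> bool" where
  "invertible_case \<mu> \<longleftrightarrow>
     (AE A in \<mu>. invertible A) \<and> strongly_irreducible (Gamma \<mu>) \<and> (\<exists>A\<in>Gamma \<mu>. proximal A)"

definition positive_case :: "(real^'n^'n) measure \<Rightarrow> bool" where
  "positive_case \<mu> \<longleftrightarrow>
     (\<forall>A\<in>Gamma \<mu>. allowable A) \<and> (\<exists>A\<in>Gamma \<mu>. strictly_positive_matrix A) \<and> \<not> arithmetic \<mu>"

definition I_set :: "(real^'n^'n) measure \<Rightarrow> real set" where
  "I_set \<mu> = {s. 0 \<le> s \<and> (\<integral>\<^sup>+A. ennreal (mnorm A powr s) \<partial>\<mu>) < \<infinity>}"

text \<open>The negative power of \<^const>\<open>iota\<close> is written as a quotient in \<^typ>\<open>ennreal\<close>, so that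
  a nonzero matrix with \<open>iota S A = 0\<close> contributes the value \<open>\<infinity>\<close> and not \<open>0\<close>.\<close>

definition moment_condition :: "(real^'n) set \<Rightarrow> (real^'n^'n) measure \<Rightarrow> bool" where
  "moment_condition S \<mu> \<longleftrightarrow>
     (\<exists>s0\<in>interior (I_set \<mu>). \<exists>\<alpha>\<in>{0<..<1}.
        (\<integral>\<^sup>+A. ennreal (mnorm A powr (s0 + \<alpha>)) / ennreal (iota S A powr \<alpha>) \<partial>\<mu>) < \<infinity>)"

section \<open>Random products\<close>

primrec G_prod :: "(nat \<Rightarrow> 'w \<Rightarrow> real^'n^'n) \<Rightarrow> nat \<Rightarrow> 'w \<Rightarrow> real^'n^'n" where
  "G_prod g 0 \<omega> = mat 1"
| "G_prod g (Suc n) \<omega> = g (Suc n) \<omega> ** G_prod g n \<omega>"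

definition kappa :: "'w measure \<Rightarrow> (nat \<Rightarrow> 'w \<Rightarrow> real^'n^'n) \<Rightarrow> real \<Rightarrow> real" where
  "kappa M g s = lim (\<lambda>n. (\<integral>\<omega>. mnorm (G_prod g n \<omega>) powr s \<partial>M) powr (1 / real n))"

definition Lambda :: "'w measure \<Rightarrow> (nat \<Rightarrow> 'w \<Rightarrow> real^'n^'n) \<Rightarrow> real \<Rightarrow> real" where
  "Lambda M g s = ln (kappa M g s)"

text \<open>A real supremum: it is used only at \<open>q = \<Lambda>'(s)\<close> with \<open>s\<close> interior, where by convexity
  the set is bounded above and the supremum is attained at \<open>s\<close>.\<close>

definition Lambda_star ::
  "(real^'n^'n) measure \<Rightarrow> 'w measure \<Rightarrow> (nat \<Rightarrow> 'w \<Rightarrow> real^'n^'n) \<Rightarrow> real \<Rightarrow> real" where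
  "Lambda_star \<mu> M g q = (SUP s\<in>I_set \<mu>. s * q - Lambda M g s)"

text \<open>On the singular matrices \<^const>\<open>ln\<close> takes the value \<open>ln 0 = 0\<close> at \<open>mnorm A = 0\<close>; in both
  cases of interest the product is almost surely nonzero, so the event is the intended one. If the logarithm of the probability
  of this event converges after division by \<open>n\<close> to a nonzero limit, then the probabilities are
  eventually positive, so \<open>ln 0 = 0\<close> can matter there only when \<open>\<Lambda>\<^sup>*(q) = 0\<close>; this happens only for
  one-dimensional matrices in the invertible case, with \<open>mnorm (g n)\<close> almost surely constant.\<close>

definition deviation_event ::
  "'w measure \<Rightarrow> (nat \<Rightarrow> 'w \<Rightarrow> real^'n^'n) \<Rightarrow> nat \<Rightarrow> real \<Rightarrow> 'w set" where
  "deviation_event M g n a = {\<omega>\<in>space M. ln (mnorm (G_prod g n \<omega>)) \<ge> a}"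

end

theory Submission
  imports Defs "HOL-Computational_Algebra.Fundamental_Theorem_Algebra"
begin

text \<open>The upper bound is Chebyshev's inequality with the exponent \<open>s\<close>. For the lower bound, the law of
  \<open>G\<^sub>n\<close> tilted by \<open>\<parallel>G\<^sub>n\<parallel>\<^sup>s\<close> concentrates \<open>log \<parallel>G\<^sub>n\<parallel> / n\<close> at \<open>q = \<Lambda>'(s)\<close>, which gives the rate for thresholds
  slightly below \<open>q\<close>. Irreducibility (or positivity) and compactness provide connecting products \<open>H\<close> of bounded
  length with \<open>\<parallel>A H B\<parallel> \<ge> c \<parallel>A\<parallel> \<parallel>B\<parallel>\<close>. If some block satisfies \<open>\<parallel>G\<^sub>m\<parallel> > C exp (m q)\<close> with positive
  probability, where \<open>C\<close> depends only on the connecting products, then splicing in a few such blocks lifts the threshold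
  above \<open>q\<close> at small cost. Otherwise the semigroup normalised by \<open>exp (- n q)\<close> is bounded, hence also
  bounded away from \<open>0\<close>, because contractions would make \<open>\<Lambda>\<close> fall below its tangent to the right
  of \<open>s\<close>. A limit of powers of a proximal or strictly positive element is then a rank-one
  matrix \<open>u f\<^sup>T\<close> of the closure, and \<open>\<bar>f (g u)\<bar> = 1\<close> for all \<open>g\<close> in it. In the positive case \<open>log f\<close>
  exhibits \<open>\<mu>\<close> as arithmetic. In the invertible case the orbit of \<open>u\<close> is finite, so it spans a finite
  invariant union of lines, which forces dimension one.\<close>

section \<open>The operator norm\<close>

text \<open>The thresholds \<open>q + l\<close> may exceed \<open>q\<close> by an amount that tends
  to 0 arbitrarily slowly, whereas tilting controls the logarithm of the norm only up to an error
  \<open>n * \<delta>\<close>, and neither a central limit theorem nor strict convexity of \<Lambda>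
  is at hand to pass \<open>q\<close>. The dichotomy on a single fast block replaces them: a block
  that gains a fixed amount over \<open>q\<close> after paying for its connection can be inserted
  with density proportional to \<delta>, so that its gain and its cost are both of order
  \<open>n * \<delta>\<close>. The constant \<open>C\<close> is, up to a factor,
  \<open>exp (K * q) / c\<close>, the loss of one connection of length \<open>K\<close>. In the
  bounded alternative the tangent at \<open>s\<close> enters through moments: after normalisation
  those of orders \<open>s\<close> and \<open>s + \<tau>\<close> are comparable, so a fixed share of
  the moment of order \<open>s\<close> sits at norms of order one. This is what contractions would
  contradict. All estimates concern the law of the product, a convolution power of
  \<open>\<mu>\<close>. The two cases enter them through a closed cone of matrices, stable under
  products, on which random products connect any two nonzero elements.\<close>

lemma norm_matrix_vector_le: "norm (A *v x) \<le> mnorm A * norm x"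
  unfolding mnorm_def by (rule onorm[OF matrix_vector_mul_bounded_linear])

lemma mnorm_nonneg [simp]: "0 \<le> mnorm A"
  unfolding mnorm_def by (rule onorm_pos_le[OF matrix_vector_mul_bounded_linear])

lemma mnorm_mult_le: "mnorm (A ** B) \<le> mnorm A * mnorm B"
  unfolding mnorm_def
  using onorm_compose[OF matrix_vector_mul_bounded_linear[of A] matrix_vector_mul_bounded_linear[of B]]
  by (simp add: o_def matrix_vector_mul_assoc)

lemma mnorm_mult3_le: "mnorm (A ** B ** C) \<le> mnorm A * mnorm B * mnorm C"
  by (rule order_trans[OF mnorm_mult_le mult_right_mono[OF mnorm_mult_le mnorm_nonneg]])

lemma mnorm_eq_0 [simp]: "mnorm A = 0 \<longleftrightarrow> A = 0"
proof
  assume "mnorm A = 0"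
  then have "\<bar>A $ i $ j\<bar> \<le> 0" for i j
    using matrix_component_le_onorm[of A i j] by (simp add: mnorm_def)
  then show "A = 0" by (simp add: vec_eq_iff)
next
  assume "A = 0"
  then show "mnorm A = 0" by (simp add: mnorm_def onorm_zero)
qed

lemma mnorm_0 [simp]: "mnorm 0 = 0"
  by simp

lemma mnorm_pos [simp]: "0 < mnorm A \<longleftrightarrow> A \<noteq> 0"
  using mnorm_nonneg[of A] mnorm_eq_0[of A] by linarith

lemma mnorm_mat_1 [simp]: "mnorm (mat 1 :: real^'n^'n) = 1"
proof -
  have "(*v) (mat 1 :: real^'n^'n) = (\<lambda>x. x)" by (simp add: fun_eq_iff)
  then show ?thesis unfolding mnorm_def using onorm_id[where 'a="real^'n"] by simp
qed

lemma mnorm_scaleR: "mnorm (c *\<^sub>R A) = \<bar>c\<bar> * mnorm A"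
proof -
  have "mnorm (c *\<^sub>R A) = onorm (\<lambda>x. c *\<^sub>R (A *v x))"
    unfolding mnorm_def by (simp add: scaleR_matrix_vector_assoc)
  then show ?thesis
    unfolding mnorm_def using onorm_scaleR[OF matrix_vector_mul_bounded_linear] by metis
qed

lemma mnorm_triangle: "mnorm (A + B) \<le> mnorm A + mnorm B"
  using onorm_triangle[OF matrix_vector_mul_bounded_linear[of A] matrix_vector_mul_bounded_linear[of B]]
  unfolding mnorm_def matrix_vector_mult_add_rdistrib[symmetric] .

text \<open>Only the equivalence of the two norms matters: it makes \<open>mnorm\<close> continuous,
  and closed sets bounded in \<open>mnorm\<close> compact. The factor comes from summing all
  entries, each of which is at most the operator norm.\<close>

lemma norm_le_mnorm: "norm A \<le> real CARD('n) * real CARD('n) * mnorm A" for A :: "real^'n^'n"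
proof -
  have row: "norm (A $ i) \<le> real CARD('n) * mnorm A" for i
  proof -
    have "norm (A $ i) \<le> (\<Sum>j\<in>UNIV. \<bar>A $ i $ j\<bar>)" by (rule norm_le_l1_cart)
    also have "\<dots> \<le> (\<Sum>j\<in>(UNIV::'n set). mnorm A)"
      unfolding mnorm_def by (intro sum_mono matrix_component_le_onorm)
    finally show ?thesis by simp
  qed
  have "norm A \<le> (\<Sum>i\<in>UNIV. norm (A $ i))"
    unfolding norm_vec_def by (rule L2_set_le_sum) simp
  also have "\<dots> \<le> (\<Sum>i\<in>(UNIV::'n set). real CARD('n) * mnorm A)"
    by (intro sum_mono row)
  finally show ?thesis by simp
qed

lemma mnorm_le_norm: "mnorm A \<le> real CARD('n) * real CARD('n) * norm A" for A :: "real^'n^'n"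
  unfolding mnorm_def
  by (rule onorm_le_matrix_component)
     (rule order_trans[OF component_le_norm_cart Finite_Cartesian_Product.norm_nth_le])

lemma bounded_linear_entry: "bounded_linear (\<lambda>A::real^'n^'m. A $ i $ j)"
  by (rule bounded_linear_compose[OF bounded_linear_vec_nth bounded_linear_vec_nth])

lemma continuous_on_mnorm [continuous_intros]:
  assumes "continuous_on S f"
  shows "continuous_on S (\<lambda>x. mnorm (f x :: real^'n^'n))"
proof -
  have "\<bar>mnorm A - mnorm B\<bar> \<le> real CARD('n) * real CARD('n) * norm (A - B)" for A B :: "real^'n^'n"
    using mnorm_triangle[of "A - B" B] mnorm_triangle[of "B - A" A] mnorm_le_norm[of "A - B"]
      mnorm_le_norm[of "B - A"] by (simp add: norm_minus_commute)
  then have "(real CARD('n) * real CARD('n))-lipschitz_on UNIV (mnorm :: real^'n^'n \<Rightarrow> real)"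
    by (intro lipschitz_onI) (auto simp: dist_norm)
  then have "continuous_on UNIV (mnorm :: real^'n^'n \<Rightarrow> real)"
    by (rule lipschitz_on_continuous_on)
  from continuous_on_compose2[OF this assms] show ?thesis by simp
qed

lemma continuous_on_matrix_mult [continuous_intros]:
  fixes f :: "'a::topological_space \<Rightarrow> real^'n^'m" and g :: "'a \<Rightarrow> real^'k^'n"
  assumes "continuous_on S f" "continuous_on S g"
  shows "continuous_on S (\<lambda>x. f x ** g x)"
  unfolding matrix_matrix_mult_def
  by (intro continuous_on_vec_lambda continuous_intros
        bounded_linear.continuous_on[OF bounded_linear_entry] assms)

lemma continuous_on_matrix_vector_mult [continuous_intros]:
  fixes f :: "'a::topological_space \<Rightarrow> real^'n^'m" and g :: "'a \<Rightarrow> real^'n"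
  assumes "continuous_on S f" "continuous_on S g"
  shows "continuous_on S (\<lambda>x. f x *v g x)"
  unfolding matrix_vector_mult_def
  by (intro continuous_on_vec_lambda continuous_intros
        bounded_linear.continuous_on[OF bounded_linear_entry] bounded_linear.continuous_on[OF bounded_linear_vec_nth] assms)

lemma borel_measurable_matrix_mult [measurable]:
  "f \<in> borel_measurable N \<Longrightarrow> g \<in> borel_measurable N \<Longrightarrow>
    (\<lambda>x. (f x :: real^'n^'m) ** (g x :: real^'k^'n)) \<in> borel_measurable N"
  by (rule borel_measurable_continuous_Pair[where H="\<lambda>A B. A ** B"]) (simp_all add: continuous_on_matrix_mult continuous_on_fst continuous_on_snd continuous_on_id)

lemma borel_measurable_mnorm [measurable]: "mnorm \<in> borel_measurable borel"
  by (intro borel_measurable_continuous_onI continuous_intros)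

lemma mult_left_scaleR_matrix: "(c *\<^sub>R A) ** B = c *\<^sub>R (A ** B)" for A :: "real^'n^'m" and B :: "real^'k^'n"
  by (simp add: matrix_matrix_mult_def vec_eq_iff sum_distrib_left mult.assoc)

lemma mult_right_scaleR_matrix: "A ** (c *\<^sub>R B) = c *\<^sub>R (A ** B)" for A :: "real^'n^'m" and B :: "real^'k^'n"
  by (simp add: matrix_matrix_mult_def vec_eq_iff sum_distrib_left mult.left_commute)

section \<open>Convolution powers\<close>

text \<open>The law of a product of \<open>n\<close> factors, with the new factor on the left as in
  \<open>G_prod\<close>; the empty product is the identity. The estimates use only these laws, so
  that splitting a product is an instance of Fubini's theorem.\<close>

primrec cpow :: "(real^'n^'n) measure \<Rightarrow> nat \<Rightarrow> (real^'n^'n) measure" where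
  "cpow \<mu> 0 = return borel (mat 1)"
| "cpow \<mu> (Suc n) = distr (\<mu> \<Otimes>\<^sub>M cpow \<mu> n) borel (\<lambda>(A, B). A ** B)"

lemma sets_cpow [simp, measurable_cong]: "sets (cpow \<mu> n) = sets borel"
  by (cases n) auto

lemma space_cpow [simp]: "space (cpow \<mu> n) = UNIV"
  using sets_eq_imp_space_eq[OF sets_cpow] by simp

locale matrix_law = prob_space \<mu> for \<mu> :: "(real^'n^'n) measure" +
  assumes sets_law [simp, measurable_cong]: "sets \<mu> = sets borel"
begin

lemma space_law [simp]: "space \<mu> = UNIV"
  using sets_eq_imp_space_eq[OF sets_law] by simp

lemma prob_space_cpow: "prob_space (cpow \<mu> n)"
proof (induction n)
  case 0
  show ?case by (simp add: prob_space_return)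
next
  case (Suc n)
  then interpret C: prob_space "cpow \<mu> n" .
  interpret P: pair_prob_space \<mu> "cpow \<mu> n" ..
  show ?case by (simp, intro P.prob_space_distr) measurable
qed

sublocale C: prob_space "cpow \<mu> n" for n
  by (rule prob_space_cpow)

lemma pair_cpow: "pair_sigma_finite (cpow \<mu> m) (cpow \<mu> n)"
  by (intro pair_sigma_finite.intro) (auto intro: C.sigma_finite_measure_axioms)

lemma nn_integral_cpow_Suc:
  assumes [measurable]: "f \<in> borel_measurable borel"
  shows "(\<integral>\<^sup>+H. f H \<partial>cpow \<mu> (Suc n)) = (\<integral>\<^sup>+A. \<integral>\<^sup>+B. f (A ** B) \<partial>cpow \<mu> n \<partial>\<mu>)"
proof -
  have "(\<integral>\<^sup>+H. f H \<partial>cpow \<mu> (Suc n)) = (\<integral>\<^sup>+x. f (fst x ** snd x) \<partial>(\<mu> \<Otimes>\<^sub>M cpow \<mu> n))"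
    by (simp, subst nn_integral_distr) (auto simp: case_prod_beta)
  also have "\<dots> = (\<integral>\<^sup>+A. \<integral>\<^sup>+B. f (A ** B) \<partial>cpow \<mu> n \<partial>\<mu>)"
    by (subst C.nn_integral_fst[symmetric]) auto
  finally show ?thesis .
qed

lemma nn_integral_cpow_0:
  assumes "f \<in> borel_measurable borel"
  shows "(\<integral>\<^sup>+H. f H \<partial>cpow \<mu> 0) = f (mat 1)"
  using assms by (simp add: nn_integral_return)

lemma nn_integral_cpow_add:
  assumes [measurable]: "f \<in> borel_measurable borel"
  shows "(\<integral>\<^sup>+H. f H \<partial>cpow \<mu> (m + n)) = (\<integral>\<^sup>+A. \<integral>\<^sup>+B. f (A ** B) \<partial>cpow \<mu> n \<partial>cpow \<mu> m)"
  using assms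
proof (induction m arbitrary: f)
  case 0
  note [measurable] = \<open>f \<in> borel_measurable borel\<close>
  show ?case by (subst nn_integral_cpow_0) auto
next
  case (Suc m)
  note [measurable] = \<open>f \<in> borel_measurable borel\<close>
  have "(\<integral>\<^sup>+H. f H \<partial>cpow \<mu> (Suc m + n)) = (\<integral>\<^sup>+A. \<integral>\<^sup>+B. f (A ** B) \<partial>cpow \<mu> (m + n) \<partial>\<mu>)"
    using nn_integral_cpow_Suc[OF Suc.prems, of "m + n"] by simp
  also have "\<dots> = (\<integral>\<^sup>+A. \<integral>\<^sup>+A'. \<integral>\<^sup>+B. f (A ** A' ** B) \<partial>cpow \<mu> n \<partial>cpow \<mu> m \<partial>\<mu>)"
    by (subst Suc.IH) (auto simp: matrix_mul_assoc)
  also have "\<dots> = (\<integral>\<^sup>+A. \<integral>\<^sup>+B. f (A ** B) \<partial>cpow \<mu> n \<partial>cpow \<mu> (Suc m))"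
    by (subst nn_integral_cpow_Suc) auto
  finally show ?case .
qed

lemma nn_integral_cpow_swap:
  assumes [measurable]: "case_prod f \<in> borel_measurable (borel \<Otimes>\<^sub>M borel)"
  shows "(\<integral>\<^sup>+A. \<integral>\<^sup>+B. f A B \<partial>cpow \<mu> n \<partial>cpow \<mu> m) = (\<integral>\<^sup>+B. \<integral>\<^sup>+A. f A B \<partial>cpow \<mu> m \<partial>cpow \<mu> n)"
proof -
  interpret pair_sigma_finite "cpow \<mu> m" "cpow \<mu> n" by (rule pair_cpow)
  have [measurable]: "(\<lambda>(A, B). f A B) \<in> borel_measurable (cpow \<mu> m \<Otimes>\<^sub>M cpow \<mu> n)"
    using assms by measurable
  show ?thesis by (rule Fubini'[symmetric]) simp
qed

text \<open>The outer integral runs over the right factor, the earlier part of the product. This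
  order allows freezing the past \<open>B\<close> and estimating the future \<open>A\<close> for
  fixed \<open>B\<close>.\<close>

lemma nn_integral_cpow_add':
  assumes [measurable]: "f \<in> borel_measurable borel"
  shows "(\<integral>\<^sup>+H. f H \<partial>cpow \<mu> (m + n)) = (\<integral>\<^sup>+B. \<integral>\<^sup>+A. f (A ** B) \<partial>cpow \<mu> m \<partial>cpow \<mu> n)"
  by (subst nn_integral_cpow_add, simp, rule nn_integral_cpow_swap) measurable

lemma nn_integral_cpow_1:
  assumes [measurable]: "f \<in> borel_measurable borel"
  shows "(\<integral>\<^sup>+H. f H \<partial>cpow \<mu> 1) = (\<integral>\<^sup>+H. f H \<partial>\<mu>)"
  unfolding One_nat_def by (subst nn_integral_cpow_Suc, simp, subst nn_integral_cpow_0) auto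

text \<open>Rewriting an almost sure statement as a vanishing integral lets the integral formulas
  for products serve for null sets too.\<close>

lemma AE_cpow_iff_nn_integral:
  assumes [measurable]: "Measurable.pred borel P"
  shows "(AE H in cpow \<mu> n. P H) \<longleftrightarrow> (\<integral>\<^sup>+H. indicator {H. \<not> P H} H \<partial>cpow \<mu> n) = 0"
  by (subst nn_integral_indicator, measurable) (simp add: AE_iff_measurable[OF _ refl])

lemma AE_cpow_add:
  assumes [measurable]: "Measurable.pred borel R"
  shows "(AE H in cpow \<mu> (m + n). R H) \<longleftrightarrow> (AE A in cpow \<mu> m. AE B in cpow \<mu> n. R (A ** B))"
proof -
  have "(AE H in cpow \<mu> (m + n). R H) \<longleftrightarrow>
      (\<integral>\<^sup>+A. \<integral>\<^sup>+B. indicator {H. \<not> R H} (A ** B) \<partial>cpow \<mu> n \<partial>cpow \<mu> m) = 0"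
    by (subst AE_cpow_iff_nn_integral, simp, subst nn_integral_cpow_add) auto
  also have "\<dots> \<longleftrightarrow> (AE A in cpow \<mu> m. (\<integral>\<^sup>+B. indicator {H. \<not> R H} (A ** B) \<partial>cpow \<mu> n) = 0)"
    by (subst nn_integral_0_iff_AE) measurable
  also have "(\<lambda>A. (\<integral>\<^sup>+B. indicator {H. \<not> R H} (A ** B) \<partial>cpow \<mu> n) = 0) = (\<lambda>A. AE B in cpow \<mu> n. R (A ** B))"
    by (rule ext, subst AE_cpow_iff_nn_integral) (simp_all only: indicator_def[abs_def] mem_Collect_eq, measurable)
  finally show ?thesis .
qed

lemma AE_cpow_add':
  assumes [measurable]: "Measurable.pred borel R"
  shows "(AE H in cpow \<mu> (m + n). R H) \<longleftrightarrow> (AE B in cpow \<mu> n. AE A in cpow \<mu> m. R (A ** B))"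
proof -
  have "(AE H in cpow \<mu> (m + n). R H) \<longleftrightarrow>
      (\<integral>\<^sup>+B. \<integral>\<^sup>+A. indicator {H. \<not> R H} (A ** B) \<partial>cpow \<mu> m \<partial>cpow \<mu> n) = 0"
    by (subst AE_cpow_iff_nn_integral, simp, subst nn_integral_cpow_add') auto
  also have "\<dots> \<longleftrightarrow> (AE B in cpow \<mu> n. (\<integral>\<^sup>+A. indicator {H. \<not> R H} (A ** B) \<partial>cpow \<mu> m) = 0)"
    by (subst nn_integral_0_iff_AE) measurable
  also have "(\<lambda>B. (\<integral>\<^sup>+A. indicator {H. \<not> R H} (A ** B) \<partial>cpow \<mu> m) = 0) = (\<lambda>B. AE A in cpow \<mu> m. R (A ** B))"
    by (rule ext, subst AE_cpow_iff_nn_integral) (simp_all only: indicator_def[abs_def] mem_Collect_eq, measurable)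
  finally show ?thesis .
qed

lemma AE_cpow_mult:
  assumes P: "AE A in cpow \<mu> m. P A" "AE B in cpow \<mu> n. Q B"
    and "Measurable.pred borel R"
    and R: "\<And>A B. P A \<Longrightarrow> Q B \<Longrightarrow> R (A ** B)"
  shows "AE H in cpow \<mu> (m + n). R H"
  unfolding AE_cpow_add[OF assms(3)]
proof (use P(1) in eventually_elim)
  case (elim A)
  from P(2) show ?case by eventually_elim (rule R[OF elim])
qed

lemma AE_cpow_1: "Measurable.pred borel P \<Longrightarrow> (AE H in cpow \<mu> 1. P H) \<longleftrightarrow> (AE H in \<mu>. P H)"
proof -
  assume [measurable]: "Measurable.pred borel P"
  have "(AE H in cpow \<mu> 1. P H) \<longleftrightarrow> (\<integral>\<^sup>+H. indicator {H. \<not> P H} H \<partial>\<mu>) = 0"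
    by (subst AE_cpow_iff_nn_integral, simp, subst nn_integral_cpow_1) auto
  also have "\<dots> \<longleftrightarrow> (AE H in \<mu>. P H)"
    by (subst nn_integral_indicator, measurable) (simp add: AE_iff_measurable[OF _ refl])
  finally show ?thesis .
qed

end

section \<open>Supports\<close>

lemma closed_measure_support: "closed (measure_support N)"
proof -
  have "- measure_support N = \<Union>{U. open U \<and> emeasure N U = 0}"
    unfolding measure_support_def by (auto simp: zero_less_iff_neq_zero)
  moreover have "open (\<Union>{U. open U \<and> emeasure N U = 0})" by (rule open_Union) auto
  ultimately show ?thesis by (simp add: closed_def)
qed

text \<open>The complement of the support is covered by the null sets of a countable base, so it is
  null; this is where second countability enters.\<close>

lemma AE_measure_support:
  fixes N :: "'a::second_countable_topology measure"
  assumes [simp]: "sets N = sets borel"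
  shows "AE x in N. x \<in> measure_support N"
proof -
  obtain B :: "'a set set" where B: "countable B" "topological_basis B"
    using ex_countable_basis by blast
  define B0 where "B0 = {U\<in>B. emeasure N U = 0}"
  have "- measure_support N \<subseteq> \<Union>B0"
  proof
    fix x assume "x \<in> - measure_support N"
    then have "\<exists>U. open U \<and> x \<in> U \<and> emeasure N U = 0"
      by (simp add: measure_support_def zero_less_iff_neq_zero)
    then obtain U where U: "open U" "x \<in> U" "emeasure N U = 0" by auto
    obtain V where V: "V \<in> B" "x \<in> V" "V \<subseteq> U"
      using topological_basisE[OF B(2) U(1,2)] by blast
    have "emeasure N V \<le> emeasure N U"
      by (rule emeasure_mono) (use V U in auto)
    then show "x \<in> \<Union>B0" using U V by (auto simp: B0_def)
  qed
  moreover have "\<Union>B0 \<in> null_sets N"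
  proof (rule null_sets_UN'[of B0 "\<lambda>x. x", simplified])
    show "countable B0" using B(1) by (auto simp: B0_def)
    fix U assume "U \<in> B0"
    then show "U \<in> null_sets N"
      using topological_basis_open[OF B(2)] by (auto simp: B0_def null_sets_def)
  qed
  ultimately show ?thesis
    by (intro AE_I'[of "\<Union>B0"]) auto
qed

lemma measure_support_subset:
  assumes [simp]: "sets N = sets borel" and "closed T" "AE x in N. x \<in> T"
  shows "measure_support N \<subseteq> T"
proof
  fix x assume x: "x \<in> measure_support N"
  have space: "space N = UNIV" using sets_eq_imp_space_eq[OF assms(1)] by simp
  show "x \<in> T"
  proof (rule ccontr)
    assume "x \<notin> T"
    moreover have "emeasure N (- T) = 0"
      using assms(2,3) by (subst (asm) AE_iff_measurable[OF _ refl]) (auto simp: space Compl_eq borel_closed intro!: borel_open open_Compl[unfolded Compl_eq])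
    ultimately show False
      using x assms(2) by (auto simp: measure_support_def open_Compl)
  qed
qed

text \<open>A closed set of full measure contains the support. This is applied once in each
  variable: for almost every \<open>A\<close> the closed set of \<open>B\<close> with
  \<open>A ** B\<close> in the target support has full measure, and hence, for each fixed
  \<open>B\<close> in the support, so does the closed set of \<open>A\<close>.\<close>

lemma (in matrix_law) measure_support_cpow_mult:
  assumes "A \<in> measure_support (cpow \<mu> m)" "B \<in> measure_support (cpow \<mu> n)"
  shows "A ** B \<in> measure_support (cpow \<mu> (m + n))"
proof -
  let ?S = "measure_support (cpow \<mu> (m + n))"
  have cl: "closed ?S" by (rule closed_measure_support)
  have P: "Measurable.pred borel (\<lambda>H. H \<in> ?S)"
    by (rule pred_sets2[OF borel_closed[OF cl] measurable_ident_sets[OF refl]])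
  have "AE H in cpow \<mu> (m + n). H \<in> ?S"
    by (rule AE_measure_support) simp
  then have 1: "AE A in cpow \<mu> m. AE B in cpow \<mu> n. A ** B \<in> ?S"
    by (simp only: AE_cpow_add[OF P])
  have "AE A in cpow \<mu> m. A \<in> {A. A ** B \<in> ?S}" if B: "B \<in> measure_support (cpow \<mu> n)" for B
    using 1
  proof eventually_elim
    case (elim A)
    have "closed {B. A ** B \<in> ?S}"
      using closed_vimage[OF cl, of "\<lambda>B. A ** B"]
      by (simp add: vimage_def continuous_on_matrix_mult continuous_on_id continuous_on_const)
    then have "measure_support (cpow \<mu> n) \<subseteq> {B. A ** B \<in> ?S}"
      using elim by (intro measure_support_subset[OF sets_cpow]) simp_all
    with B show ?case by blast
  qed
  moreover have "closed {A. A ** B \<in> ?S}" for B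
      using closed_vimage[OF cl, of "\<lambda>A. A ** B"]
      by (simp add: vimage_def continuous_on_matrix_mult continuous_on_id continuous_on_const)
  ultimately have "measure_support (cpow \<mu> m) \<subseteq> {A. A ** B \<in> ?S}" using assms(2)
    by (intro measure_support_subset[OF sets_cpow]) simp_all
  with assms show ?thesis by blast
qed

lemma (in matrix_law) measure_support_cpow_1: "measure_support (cpow \<mu> 1) = measure_support \<mu>"
proof -
  have "emeasure (cpow \<mu> 1) U = emeasure \<mu> U" if "open U" for U
    using nn_integral_cpow_1[of "indicator U"] that by simp
  then show ?thesis by (auto simp: measure_support_def)
qed

lemma (in matrix_law) Gamma_subset:
  assumes "closed T" "AE A in \<mu>. A \<in> T" "\<And>A B. A \<in> T \<Longrightarrow> B \<in> T \<Longrightarrow> A ** B \<in> T"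
  shows "Gamma \<mu> \<subseteq> T"
  unfolding Gamma_def by (rule Inter_lower) (use measure_support_subset[OF sets_law assms(1,2)] assms in auto)

lemma measure_support_subset_Gamma: "measure_support \<mu> \<subseteq> Gamma \<mu>"
  unfolding Gamma_def by (rule Inter_greatest) auto

lemma closure_closed_under_mult:
  fixes T :: "(real^'n^'n) set"
  assumes "\<And>A B. A \<in> T \<Longrightarrow> B \<in> T \<Longrightarrow> A ** B \<in> T" "A \<in> closure T" "B \<in> closure T"
  shows "A ** B \<in> closure T"
proof -
  have 1: "A ** B \<in> closure T" if "A \<in> T" "B \<in> closure T" for A B
  proof -
    have "(\<lambda>B. A ** B) ` T \<subseteq> closure T"
      using assms(1)[OF that(1)] closure_subset[of T] by auto
    then have "(\<lambda>B. A ** B) ` closure T \<subseteq> closure T"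
      by (intro image_closure_subset continuous_on_matrix_mult continuous_on_id continuous_on_const closed_closure)
    with that show ?thesis by auto
  qed
  have "(\<lambda>A. A ** B) ` T \<subseteq> closure T"
    using 1[OF _ assms(3)] by auto
  then have "(\<lambda>A. A ** B) ` closure T \<subseteq> closure T"
    by (intro image_closure_subset continuous_on_matrix_mult continuous_on_id continuous_on_const closed_closure)
  with assms show ?thesis by auto
qed

text \<open>By minimality of \<open>Gamma\<close>: the supports of the convolution powers form a
  semigroup, so their closure is a closed semigroup containing the support of \<open>\<mu>\<close>.
  Elements of \<open>Gamma\<close> thereby become limits of products of known lengths.\<close>

lemma (in matrix_law) Gamma_subset_closure:
  "Gamma \<mu> \<subseteq> closure (\<Union>n\<in>{1..}. measure_support (cpow \<mu> n))" (is "_ \<subseteq> closure ?S")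
proof (rule Gamma_subset)
  show "AE A in \<mu>. A \<in> closure ?S"
    using AE_measure_support[OF sets_law]
  proof eventually_elim
    case (elim A)
    then have "A \<in> measure_support (cpow \<mu> 1)" by (simp only: measure_support_cpow_1)
    then have "A \<in> ?S" by (rule UN_I[rotated]) simp
    then show ?case by (rule subsetD[OF closure_subset])
  qed
  have "A ** B \<in> ?S" if AB: "A \<in> ?S" "B \<in> ?S" for A B
  proof -
    obtain m where m: "m \<ge> 1" "A \<in> measure_support (cpow \<mu> m)" using AB(1) by auto
    obtain n where n: "n \<ge> 1" "B \<in> measure_support (cpow \<mu> n)" using AB(2) by auto
    show ?thesis
      by (rule UN_I[of "m + n"]) (use m n measure_support_cpow_mult in auto)
  qed
  then show "A ** B \<in> closure ?S" if "A \<in> closure ?S" "B \<in> closure ?S" for A B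
    using that by (rule closure_closed_under_mult)
qed (rule closed_closure)

section \<open>Laws on a cone of matrices\<close>

lemma continuous_on_integral_bounded:
  fixes F :: "'a::metric_space \<Rightarrow> 'b \<Rightarrow> real"
  assumes "prob_space N" and m: "\<And>a. F a \<in> borel_measurable N"
    and c: "\<And>b. continuous_on UNIV (\<lambda>a. F a b)" and b: "\<And>a b. \<bar>F a b\<bar> \<le> 1"
  shows "continuous_on UNIV (\<lambda>a. \<integral>b. F a b \<partial>N)"
proof -
  interpret prob_space N by fact
  show ?thesis
    unfolding continuous_on_sequentially
  proof (intro allI ballI impI, elim conjE)
    fix x :: "nat \<Rightarrow> 'a" and a assume "x \<longlonglongrightarrow> a"
    then have "(\<lambda>n. F (x n) b) \<longlonglongrightarrow> F a b" for b
      using c[of b] unfolding continuous_on_sequentially by (auto simp: o_def)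
    then have "(\<lambda>n. \<integral>b. F (x n) b \<partial>N) \<longlonglongrightarrow> (\<integral>b. F a b \<partial>N)"
      by (intro integral_dominated_convergence[where w = "\<lambda>_. 1"]) (auto simp: m b)
    then show "((\<lambda>a. \<integral>b. F a b \<partial>N) \<circ> x) \<longlonglongrightarrow> (\<integral>b. F a b \<partial>N)"
      by (simp add: o_def)
  qed
qed

lemma compact_mnorm_sphere:
  fixes CA :: "(real^'n^'n) set"
  assumes "closed CA"
  shows "compact {A\<in>CA. mnorm A = 1}"
proof -
  have "{A\<in>CA. mnorm A = 1} = CA \<inter> mnorm -` {1}" by auto
  moreover have "closed (CA \<inter> mnorm -` {1})"
    by (intro closed_Int assms closed_vimage continuous_on_mnorm continuous_on_id closed_singleton)
  moreover have "bounded {A\<in>CA. mnorm A = 1}"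
  proof (rule boundedI)
    fix A assume "A \<in> {A\<in>CA. mnorm A = 1}"
    then show "norm A \<le> real CARD('n) * real CARD('n)"
      using norm_le_mnorm[of A] by simp
  qed
  ultimately show ?thesis by (simp add: compact_eq_bounded_closed)
qed

text \<open>What the two cases share: \<open>CA\<close> is the set of all matrices in the invertible
  case and the cone of positive matrices in the positive case. \<open>transitive\<close> is
  irreducibility in the form used below. \<open>AE_law_nonzero\<close> concerns multiplication on
  the left, the side on which products are extended.\<close>

locale cone_law = matrix_law \<mu> for \<mu> :: "(real^'n^'n) measure" +
  fixes CA :: "(real^'n^'n) set"
  assumes closed_CA: "closed CA"
    and CA_scaleR: "\<And>c A. 0 \<le> c \<Longrightarrow> A \<in> CA \<Longrightarrow> c *\<^sub>R A \<in> CA"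
    and CA_mult: "\<And>A B. A \<in> CA \<Longrightarrow> B \<in> CA \<Longrightarrow> A ** B \<in> CA"
    and CA_one: "mat 1 \<in> CA"
    and AE_law_CA: "AE A in \<mu>. A \<in> CA"
    and AE_law_nonzero: "\<And>A. A \<in> CA \<Longrightarrow> A \<noteq> 0 \<Longrightarrow> AE H in \<mu>. H ** A \<noteq> 0"
    and transitive: "\<And>A B. A \<in> CA \<Longrightarrow> B \<in> CA \<Longrightarrow> A \<noteq> 0 \<Longrightarrow> B \<noteq> 0 \<Longrightarrow>
        \<exists>k. \<not> (AE H in cpow \<mu> k. A ** H ** B = 0)"
begin

lemma pred_CA [measurable]: "Measurable.pred borel (\<lambda>A. A \<in> CA)"
  by (rule pred_sets2[OF borel_closed[OF closed_CA] measurable_ident_sets[OF refl]])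

lemma AE_cpow_CA: "AE H in cpow \<mu> n. H \<in> CA"
proof (induction n)
  case 0
  show ?case unfolding cpow.simps(1) by (subst AE_return) (simp_all add: CA_one pred_CA)
next
  case (Suc n)
  have "AE H in cpow \<mu> (1 + n). H \<in> CA"
    by (rule AE_cpow_mult[OF iffD2[OF AE_cpow_1[OF pred_CA] AE_law_CA] Suc pred_CA CA_mult])
  then show ?case unfolding plus_1_eq_Suc .
qed

lemma AE_cpow_mult_nonzero:
  assumes "A \<in> CA" "A \<noteq> 0"
  shows "AE H in cpow \<mu> n. H ** A \<noteq> 0"
proof (induction n)
  case 0
  have P: "Measurable.pred borel (\<lambda>H. H ** A \<noteq> 0)" by measurable
  show ?case unfolding cpow.simps(1) by (subst AE_return[OF _ P]) (simp_all add: assms)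
next
  case (Suc n)
  have P: "Measurable.pred borel (\<lambda>H. H ** B \<noteq> 0)" for B :: "real^'n^'n" by measurable
  have "AE H in cpow \<mu> (1 + n). H ** A \<noteq> 0"
    unfolding AE_cpow_add'[OF P] using Suc AE_cpow_CA[of n]
  proof eventually_elim
    case (elim H)
    then have "AE G in \<mu>. G ** (H ** A) \<noteq> 0"
      using AE_law_nonzero[of "H ** A"] CA_mult assms by auto
    then have "AE G in cpow \<mu> 1. G ** (H ** A) \<noteq> 0"
      by (simp only: AE_cpow_1[OF P])
    then show ?case by (simp only: matrix_mul_assoc)
  qed
  then show ?case unfolding plus_1_eq_Suc .
qed

lemma AE_cpow_nonzero: "AE H in cpow \<mu> n. H \<noteq> 0"
  using AE_cpow_mult_nonzero[OF CA_one, of n] mnorm_mat_1[where 'n='n] by (auto simp flip: mnorm_eq_0)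

text \<open>Compactness is used twice on pairs of norm one. Each \<open>f k\<close> is continuous
  and at every pair some \<open>f k\<close> is positive, so finitely many lengths
  \<open>k \<le> K\<close> suffice. Padding by a factor of length \<open>K - k\<close> on the left
  preserves positivity, because almost no left factor annihilates a given nonzero element of
  \<open>CA\<close>; the continuous sum therefore has a positive minimum.\<close>

lemma transition_positive_on_compact:
  defines "S \<equiv> {A\<in>CA. mnorm A = 1}"
  obtains K m where "0 < m"
    "\<And>A B. A \<in> S \<Longrightarrow> B \<in> S \<Longrightarrow>
      m \<le> (\<Sum>k\<le>K. \<integral>x. min 1 (mnorm (snd x ** A ** fst x ** B)) \<partial>(cpow \<mu> k \<Otimes>\<^sub>M cpow \<mu> (K - k)))"
proof -
  have S: "compact S" unfolding S_def by (rule compact_mnorm_sphere[OF closed_CA])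
  have nz: "A \<in> CA" "A \<noteq> 0" if "A \<in> S" for A
    using that by (auto simp: S_def simp flip: mnorm_eq_0)
  \<comment> \<open>Truncation by \<open>min 1\<close> makes the integrand bounded, so that
    continuity in the pair follows by dominated convergence.\<close>
  define f where "f k x = (\<integral>H. min 1 (mnorm (fst x ** H ** snd x)) \<partial>cpow \<mu> k)" for k and x :: "(real^'n^'n) \<times> (real^'n^'n)"
  have f_cont: "continuous_on UNIV (f k)" for k
  proof -
    have "continuous_on UNIV (\<lambda>x::(real^'n^'n) \<times> (real^'n^'n). \<integral>H. min 1 (mnorm (fst x ** H ** snd x)) \<partial>cpow \<mu> k)"
    proof (rule continuous_on_integral_bounded[OF prob_space_cpow])
      show "continuous_on UNIV (\<lambda>x. min 1 (mnorm (fst x ** H ** snd x)))" for H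
        by (intro continuous_on_min continuous_on_mnorm continuous_on_matrix_mult
          continuous_on_fst continuous_on_snd continuous_on_id continuous_on_const)
      have "(\<lambda>H. min 1 (mnorm (A ** H ** B))) \<in> borel_measurable (cpow \<mu> k)" for A B :: "real^'n^'n"
        by measurable
      then show "(\<lambda>H. min 1 (mnorm (fst x ** H ** snd x))) \<in> borel_measurable (cpow \<mu> k)" for x :: "(real^'n^'n) \<times> (real^'n^'n)" .
    qed simp
    then show ?thesis unfolding f_def .
  qed
  have f_nonneg: "0 \<le> f k x" for k x
    unfolding f_def by (intro integral_nonneg_AE) simp
  have "\<exists>k. x \<in> {x. 0 < f k x}" if "x \<in> S \<times> S" for x
  proof -
    have "fst x \<in> S" "snd x \<in> S" using that by (auto simp: mem_Times_iff)
    from transitive[OF nz(1)[OF this(1)] nz(1)[OF this(2)] nz(2)[OF this(1)] nz(2)[OF this(2)]]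
    obtain k where k: "\<not> (AE H in cpow \<mu> k. fst x ** H ** snd x = 0)" by (rule exE)
    have "f k x \<noteq> 0"
    proof
      assume "f k x = 0"
      then have "AE H in cpow \<mu> k. min 1 (mnorm (fst x ** H ** snd x)) = 0"
        unfolding f_def
        by (subst (asm) integral_nonneg_eq_0_iff_AE)
           (auto intro!: C.integrable_const_bound[where B = 1])
      then have "AE H in cpow \<mu> k. fst x ** H ** snd x = 0"
        by eventually_elim (auto simp: min_def split: if_splits)
      with k show False by simp
    qed
    with f_nonneg[of k x] show ?thesis by (intro exI[of _ k]) simp
  qed
  then have cov: "S \<times> S \<subseteq> (\<Union>k\<in>UNIV. {x. 0 < f k x})" by blast
  have op: "open {x. 0 < f k x}" for k
    by (intro open_Collect_less continuous_on_const f_cont)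
  obtain C where "C \<subseteq> UNIV" and C: "finite C" "S \<times> S \<subseteq> (\<Union>k\<in>C. {x. 0 < f k x})"
    by (rule compactE_image[OF compact_Times[OF S S] op cov])
  obtain K where K: "C \<subseteq> {..K}"
    using C(1) finite_nat_set_iff_bounded_le by auto
  define F where "F k x = (\<integral>y. min 1 (mnorm (snd y ** fst x ** fst y ** snd x)) \<partial>(cpow \<mu> k \<Otimes>\<^sub>M cpow \<mu> (K - k)))"
    for k and x :: "(real^'n^'n) \<times> (real^'n^'n)"
  have pp: "prob_space (cpow \<mu> k \<Otimes>\<^sub>M cpow \<mu> (K - k))" for k
    by (intro prob_space_pair prob_space_cpow)
  have F_cont: "continuous_on UNIV (F k)" for k
  proof -
    have "continuous_on UNIV (\<lambda>x::(real^'n^'n) \<times> (real^'n^'n). \<integral>y. min 1 (mnorm (snd y ** fst x ** fst y ** snd x)) \<partial>(cpow \<mu> k \<Otimes>\<^sub>M cpow \<mu> (K - k)))"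
    proof (rule continuous_on_integral_bounded[OF pp])
      show "continuous_on UNIV (\<lambda>x. min 1 (mnorm (snd y ** fst x ** fst y ** snd x)))" for y
        by (intro continuous_on_min continuous_on_mnorm continuous_on_matrix_mult
          continuous_on_fst continuous_on_snd continuous_on_id continuous_on_const)
      have "(\<lambda>y. min 1 (mnorm (snd y ** A ** fst y ** B))) \<in> borel_measurable ((cpow \<mu> k \<Otimes>\<^sub>M cpow \<mu> (K - k)))" for A B :: "real^'n^'n"
        by measurable
      then show "(\<lambda>y. min 1 (mnorm (snd y ** fst x ** fst y ** snd x))) \<in> borel_measurable ((cpow \<mu> k \<Otimes>\<^sub>M cpow \<mu> (K - k)))" for x :: "(real^'n^'n) \<times> (real^'n^'n)" .
    qed simp
    then show ?thesis unfolding F_def .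
  qed
  have F_nonneg: "0 \<le> F k x" for k x
    unfolding F_def by (intro integral_nonneg_AE) simp
  have pos: "0 < (\<Sum>k\<le>K. F k x)" if x: "x \<in> S \<times> S" for x
  proof -
    obtain k where k: "k \<in> C" "0 < f k x" using C(2) x by auto
    interpret P: prob_space "cpow \<mu> k \<Otimes>\<^sub>M cpow \<mu> (K - k)" by (rule pp)
    have "F k x \<noteq> 0"
    proof
      assume "F k x = 0"
      then have "AE y in cpow \<mu> k \<Otimes>\<^sub>M cpow \<mu> (K - k). min 1 (mnorm (snd y ** fst x ** fst y ** snd x)) = 0"
        unfolding F_def
        by (subst (asm) integral_nonneg_eq_0_iff_AE)
           (auto intro!: P.integrable_const_bound[where B = 1])
      then have "AE y in cpow \<mu> k \<Otimes>\<^sub>M cpow \<mu> (K - k). (\<lambda>(H, J). J ** (fst x ** H ** snd x) = 0) y"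
        by eventually_elim (auto simp: min_def matrix_mul_assoc split: if_splits)
      from pair_sigma_finite.AE_pair[OF pair_cpow this]
      have 1: "AE H in cpow \<mu> k. AE J in cpow \<mu> (K - k). J ** (fst x ** H ** snd x) = 0"
        by simp
      have "AE H in cpow \<mu> k. fst x ** H ** snd x = 0"
        using 1 AE_cpow_CA
      proof eventually_elim
        case (elim H)
        show ?case
        proof (rule ccontr)
          assume ne: "fst x ** H ** snd x \<noteq> 0"
          have "fst x ** H ** snd x \<in> CA"
            using elim(2) x nz by (intro CA_mult) (auto simp: mem_Times_iff)
          from AE_cpow_mult_nonzero[OF this ne] elim(1)
          have "AE J in cpow \<mu> (K - k). False" by eventually_elim simp
          then show False by simp
        qed
      qed
      then have "f k x = (\<integral>H. 0 \<partial>cpow \<mu> k)"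
        unfolding f_def by (intro integral_cong_AE) (auto elim!: eventually_mono)
      with k show False by simp
    qed
    then have "0 < F k x" using F_nonneg[of k x] by simp
    also have "F k x \<le> (\<Sum>k\<le>K. F k x)"
      using k K by (intro member_le_sum F_nonneg) auto
    finally show ?thesis .
  qed
  have "mat 1 \<in> S" by (simp add: S_def CA_one)
  then have "S \<times> S \<noteq> {}" by auto
  moreover have "continuous_on (S \<times> S) (\<lambda>x. \<Sum>k\<le>K. F k x)"
    by (intro continuous_on_sum continuous_on_subset[OF F_cont]) auto
  ultimately have "\<exists>x0\<in>S \<times> S. \<forall>x\<in>S \<times> S. (\<Sum>k\<le>K. F k x0) \<le> (\<Sum>k\<le>K. F k x)"
    by (intro continuous_attains_inf compact_Times S)
  then obtain x0 where x0: "x0 \<in> S \<times> S" "\<And>x. x \<in> S \<times> S \<Longrightarrow> (\<Sum>k\<le>K. F k x0) \<le> (\<Sum>k\<le>K. F k x)"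
    by blast
  show ?thesis
  proof (rule that[OF pos[OF x0(1)]])
    fix A B assume "A \<in> S" "B \<in> S"
    then show "(\<Sum>k\<le>K. F k x0) \<le> (\<Sum>k\<le>K. \<integral>x. min 1 (mnorm (snd x ** A ** fst x ** B)) \<partial>(cpow \<mu> k \<Otimes>\<^sub>M cpow \<mu> (K - k)))"
      using x0(2)[of "(A, B)"] by (simp add: F_def)
  qed
qed

text \<open>The lengths \<open>k\<close> of the connecting products have to vary, since a law may have a periodic
  part; the padding by \<open>J\<close> makes the total length equal to \<open>K\<close>.\<close>

definition connecting :: "nat \<Rightarrow> real \<Rightarrow> real \<Rightarrow> bool" where
  "connecting K c p \<longleftrightarrow> 0 < c \<and> 0 < p \<and> (\<forall>A\<in>CA. \<forall>B\<in>CA. A \<noteq> 0 \<longrightarrow> B \<noteq> 0 \<longrightarrow>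
     ennreal p \<le> (\<Sum>k\<le>K. \<integral>\<^sup>+H. \<integral>\<^sup>+J. indicator {X. c * mnorm A * mnorm B \<le> mnorm X} (J ** A ** H ** B)
       \<partial>cpow \<mu> (K - k) \<partial>cpow \<mu> k))"

text \<open>By homogeneity it suffices to treat norm one, where \<open>min 1 x\<close> is at most
  the indicator of \<open>c \<le> x\<close> plus \<open>c\<close>. A lower bound for expectations
  thus becomes one for probabilities.\<close>

lemma connecting_exists: obtains K c p where "connecting K c p"
proof -
  obtain K m where m: "0 < m" and K: "\<And>A B. A \<in> CA \<Longrightarrow> mnorm A = 1 \<Longrightarrow> B \<in> CA \<Longrightarrow> mnorm B = 1 \<Longrightarrow>
      m \<le> (\<Sum>k\<le>K. \<integral>x. min 1 (mnorm (snd x ** A ** fst x ** B)) \<partial>(cpow \<mu> k \<Otimes>\<^sub>M cpow \<mu> (K - k)))"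
    by (rule transition_positive_on_compact) (simp, blast)
  \<comment> \<open>Over the \<open>K + 1\<close> lengths the error \<open>c\<close> adds up to
    \<open>m / 2\<close>, which leaves \<open>m / 2\<close> for the sum of the
    probabilities.\<close>
  define c where "c = m / (2 * (real K + 1))"
  have c: "0 < c" "(real K + 1) * c = m / 2" using m by (auto simp: c_def field_simps)
  have "connecting K c (m / 2)"
    unfolding connecting_def
  proof (intro conjI ballI impI)
    fix A B assume A: "A \<in> CA" "A \<noteq> 0" and B: "B \<in> CA" "B \<noteq> 0"
    define A1 where "A1 = (1 / mnorm A) *\<^sub>R A"
    define B1 where "B1 = (1 / mnorm B) *\<^sub>R B"
    have AB: "A1 \<in> CA" "mnorm A1 = 1" "B1 \<in> CA" "mnorm B1 = 1" "A = mnorm A *\<^sub>R A1" "B = mnorm B *\<^sub>R B1"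
      using A B by (auto simp: A1_def B1_def CA_scaleR mnorm_scaleR)
    have mn: "mnorm (J ** A ** H ** B) = mnorm A * mnorm B * mnorm (J ** A1 ** H ** B1)" for J H
      using A B by (subst AB(5), subst AB(6)) (simp add: mult_left_scaleR_matrix mult_right_scaleR_matrix mnorm_scaleR)
    let ?I = "\<lambda>k. \<integral>\<^sup>+H. \<integral>\<^sup>+J. indicator {X. c * mnorm A * mnorm B \<le> mnorm X} (J ** A ** H ** B) \<partial>cpow \<mu> (K - k) \<partial>cpow \<mu> k"
    let ?F = "\<lambda>k. \<integral>x. min 1 (mnorm (snd x ** A1 ** fst x ** B1)) \<partial>(cpow \<mu> k \<Otimes>\<^sub>M cpow \<mu> (K - k))"
    have F: "ennreal (?F k) \<le> ?I k + ennreal c" for k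
    proof -
      interpret P: prob_space "cpow \<mu> k \<Otimes>\<^sub>M cpow \<mu> (K - k)"
        by (intro prob_space_pair prob_space_cpow)
      have "ennreal (?F k) = (\<integral>\<^sup>+x. ennreal (min 1 (mnorm (snd x ** A1 ** fst x ** B1))) \<partial>(cpow \<mu> k \<Otimes>\<^sub>M cpow \<mu> (K - k)))"
        by (subst nn_integral_eq_integral) (auto intro!: P.integrable_const_bound[where B = 1])
      also have "\<dots> \<le> (\<integral>\<^sup>+x. indicator {X. c * mnorm A * mnorm B \<le> mnorm X} (snd x ** A ** fst x ** B) + ennreal c
          \<partial>(cpow \<mu> k \<Otimes>\<^sub>M cpow \<mu> (K - k)))"
      proof (rule nn_integral_mono)
        fix x :: "(real^'n^'n) \<times> (real^'n^'n)"
        let ?m = "mnorm (snd x ** A1 ** fst x ** B1)"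
        have "c \<le> ?m \<Longrightarrow> c * mnorm A * mnorm B \<le> mnorm A * mnorm B * ?m"
          using mult_left_mono[of c ?m "mnorm A * mnorm B"] by (simp add: mult.commute mult.left_commute)
        moreover have "ennreal (min 1 ?m) \<le> ennreal 1" by (intro ennreal_leI) simp
        then have "ennreal (min 1 ?m) \<le> 1 + ennreal c" by (metis add_increasing2 ennreal_1 zero_le)
        moreover have "?m < c \<Longrightarrow> ennreal (min 1 ?m) \<le> ennreal c" by (intro ennreal_leI) simp
        ultimately show "ennreal (min 1 ?m) \<le> indicator {X. c * mnorm A * mnorm B \<le> mnorm X} (snd x ** A ** fst x ** B) + ennreal c"
          by (cases "c \<le> ?m") (auto simp: mn split: split_indicator)
      qed
      also have "\<dots> = (\<integral>\<^sup>+x. indicator {X. c * mnorm A * mnorm B \<le> mnorm X} (snd x ** A ** fst x ** B)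
          \<partial>(cpow \<mu> k \<Otimes>\<^sub>M cpow \<mu> (K - k))) + ennreal c"
        by (subst nn_integral_add) (auto simp: P.emeasure_space_1)
      also have "(\<integral>\<^sup>+x. indicator {X. c * mnorm A * mnorm B \<le> mnorm X} (snd x ** A ** fst x ** B)
          \<partial>(cpow \<mu> k \<Otimes>\<^sub>M cpow \<mu> (K - k))) = ?I k"
        by (subst C.nn_integral_fst[symmetric]) auto
      finally show ?thesis .
    qed
    have "ennreal m \<le> ennreal (\<Sum>k\<le>K. ?F k)" using K AB by (intro ennreal_leI) auto
    also have "\<dots> = (\<Sum>k\<le>K. ennreal (?F k))"
      by (intro sum_ennreal[symmetric] integral_nonneg_AE) simp
    also have "\<dots> \<le> (\<Sum>k\<le>K. ?I k + ennreal c)" by (intro sum_mono F)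
    also have "\<dots> = (\<Sum>k\<le>K. ?I k) + ennreal (m / 2)"
    proof -
      have "(\<Sum>k\<le>K. ennreal c) = ennreal (\<Sum>k\<le>K. c)" using c by (intro sum_ennreal) simp
      also have "(\<Sum>k\<le>K. c) = m / 2" using c(2) by (simp add: algebra_simps)
      finally show ?thesis by (simp only: sum.distrib)
    qed
    finally have *: "ennreal m \<le> (\<Sum>k\<le>K. ?I k) + ennreal (m / 2)" .
    have "ennreal m = ennreal (m / 2) + ennreal (m / 2)"
      using m by (subst ennreal_plus[symmetric]) auto
    with * show "ennreal (m / 2) \<le> (\<Sum>k\<le>K. ?I k)"
      by (simp add: ennreal_add_left_cancel_le add.commute)
  qed (use m c in auto)
  then show ?thesis by (rule that)
qed

text \<open>Transfers a lower bound through a connection: \<open>v\<close> and \<open>\<psi>\<close>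
  will be indicators for tails, powers of the norm for moments, and truncated powers for small
  steps. The factor \<open>Suc K\<close> counts the lengths \<open>k\<close>, each of which
  contributes the same integral.\<close>

lemma connecting_nn_integral_le:
  assumes K: "connecting K c p" and Z: "Z \<in> CA" "Z \<noteq> 0"
    and [measurable]: "\<psi> \<in> borel_measurable borel" "v \<in> borel_measurable borel"
    and v: "\<And>A k. A \<in> CA \<Longrightarrow> A \<noteq> 0 \<Longrightarrow> k \<le> K \<Longrightarrow> AE H in cpow \<mu> k. AE J in cpow \<mu> (K - k).
       c * mnorm A * mnorm Z \<le> mnorm (J ** A ** H ** Z) \<longrightarrow> v A \<le> \<psi> (J ** A ** H ** Z)"
  shows "ennreal p * (\<integral>\<^sup>+A. v A \<partial>cpow \<mu> n) \<le> of_nat (Suc K) * (\<integral>\<^sup>+G. \<psi> (G ** Z) \<partial>cpow \<mu> (K + n))"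
proof -
  \<comment> \<open>The padding makes the total length \<open>(K - k) + n + k\<close> independent of
    \<open>k\<close>.\<close>
  have eq: "(\<integral>\<^sup>+G. \<psi> (G ** Z) \<partial>cpow \<mu> (K + n)) =
      (\<integral>\<^sup>+A. \<integral>\<^sup>+H. \<integral>\<^sup>+J. \<psi> (J ** A ** H ** Z) \<partial>cpow \<mu> (K - k) \<partial>cpow \<mu> k \<partial>cpow \<mu> n)" if "k \<le> K" for k
  proof -
    have "K + n = (K - k) + (n + k)" using that by simp
    then have "(\<integral>\<^sup>+G. \<psi> (G ** Z) \<partial>cpow \<mu> (K + n)) = (\<integral>\<^sup>+G. \<psi> (G ** Z) \<partial>cpow \<mu> ((K - k) + (n + k)))"
      by simp
    also have "\<dots> = (\<integral>\<^sup>+X. \<integral>\<^sup>+J. \<psi> (J ** X ** Z) \<partial>cpow \<mu> (K - k) \<partial>cpow \<mu> (n + k))"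
      by (rule nn_integral_cpow_add') measurable
    also have "\<dots> = (\<integral>\<^sup>+A. \<integral>\<^sup>+H. \<integral>\<^sup>+J. \<psi> (J ** (A ** H) ** Z) \<partial>cpow \<mu> (K - k) \<partial>cpow \<mu> k \<partial>cpow \<mu> n)"
      by (rule nn_integral_cpow_add) measurable
    finally show ?thesis by (simp add: matrix_mul_assoc)
  qed
  have "ennreal p * (\<integral>\<^sup>+A. v A \<partial>cpow \<mu> n) = (\<integral>\<^sup>+A. ennreal p * v A \<partial>cpow \<mu> n)"
    by (rule nn_integral_cmult[symmetric]) measurable
  also have "\<dots> \<le> (\<integral>\<^sup>+A. (\<Sum>k\<le>K. \<integral>\<^sup>+H. \<integral>\<^sup>+J. \<psi> (J ** A ** H ** Z) \<partial>cpow \<mu> (K - k) \<partial>cpow \<mu> k) \<partial>cpow \<mu> n)"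
  proof (rule nn_integral_mono_AE, use AE_cpow_CA AE_cpow_nonzero in eventually_elim)
    case (elim A)
    let ?i = "indicator {X. c * mnorm A * mnorm Z \<le> mnorm X} :: _ \<Rightarrow> ennreal"
    have "ennreal p * v A \<le> (\<Sum>k\<le>K. \<integral>\<^sup>+H. \<integral>\<^sup>+J. ?i (J ** A ** H ** Z) \<partial>cpow \<mu> (K - k) \<partial>cpow \<mu> k) * v A"
      using K elim Z by (intro mult_right_mono) (auto simp: connecting_def)
    also have "\<dots> = (\<Sum>k\<le>K. \<integral>\<^sup>+H. \<integral>\<^sup>+J. ?i (J ** A ** H ** Z) * v A \<partial>cpow \<mu> (K - k) \<partial>cpow \<mu> k)"
      by (simp add: sum_distrib_right nn_integral_multc)
    also have "\<dots> \<le> (\<Sum>k\<le>K. \<integral>\<^sup>+H. \<integral>\<^sup>+J. \<psi> (J ** A ** H ** Z) \<partial>cpow \<mu> (K - k) \<partial>cpow \<mu> k)"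
    proof (rule sum_mono)
      fix k assume "k \<in> {..K}"
      then have k: "k \<le> K" by simp
      show "(\<integral>\<^sup>+H. \<integral>\<^sup>+J. ?i (J ** A ** H ** Z) * v A \<partial>cpow \<mu> (K - k) \<partial>cpow \<mu> k)
          \<le> (\<integral>\<^sup>+H. \<integral>\<^sup>+J. \<psi> (J ** A ** H ** Z) \<partial>cpow \<mu> (K - k) \<partial>cpow \<mu> k)"
      proof (rule nn_integral_mono_AE, use v[OF elim k] in eventually_elim)
        case (elim H)
        show ?case
          by (rule nn_integral_mono_AE, use elim in eventually_elim) (auto split: split_indicator)
      qed
    qed
    finally show ?case .
  qed
  also have "\<dots> = (\<Sum>k\<le>K. \<integral>\<^sup>+A. \<integral>\<^sup>+H. \<integral>\<^sup>+J. \<psi> (J ** A ** H ** Z) \<partial>cpow \<mu> (K - k) \<partial>cpow \<mu> k \<partial>cpow \<mu> n)"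
    by (rule nn_integral_sum) measurable
  also have "\<dots> = (\<Sum>k\<le>K. \<integral>\<^sup>+G. \<psi> (G ** Z) \<partial>cpow \<mu> (K + n))"
    by (intro sum.cong refl eq[symmetric]) simp
  also have "\<dots> = of_nat (Suc K) * (\<integral>\<^sup>+G. \<psi> (G ** Z) \<partial>cpow \<mu> (K + n))"
    by simp
  finally show ?thesis .
qed

end

section \<open>Moments and tails of the products\<close>

definition mom :: "(real^'n^'n) measure \<Rightarrow> real \<Rightarrow> nat \<Rightarrow> ennreal" where
  "mom \<mu> t n = (\<integral>\<^sup>+H. ennreal (mnorm H powr t) \<partial>cpow \<mu> n)"

definition tail :: "(real^'n^'n) measure \<Rightarrow> nat \<Rightarrow> real \<Rightarrow> real" where
  "tail \<mu> n x = measure (cpow \<mu> n) {H. exp x \<le> mnorm H}"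

text \<open>Both \<open>m * u n\<close> and \<open>n * u m\<close> approximate
  \<open>u (m * n)\<close>, so \<open>u n / n\<close> is Cauchy with error
  \<open>D / n + D / m\<close>. Letting \<open>m\<close> tend to infinity leaves the same
  \<open>D\<close> for every \<open>n\<close>: an error bounded in \<open>n\<close>, which is more
  than convergence of the averages.\<close>

lemma almost_additive_linear:
  fixes u :: "nat \<Rightarrow> real"
  assumes D: "\<And>m n. \<bar>u (m + n) - u m - u n\<bar> \<le> D"
  obtains l where "\<And>n. \<bar>u n - real n * l\<bar> \<le> D"
proof -
  have D0: "0 \<le> D" using D[of 0 0] by linarith
  have mult: "\<bar>u (m * n) - real m * u n\<bar> \<le> real m * D" if "1 \<le> m" for m n
    using that
  proof (induction m rule: dec_induct)
    case base
    then show ?case using D0 by simp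
  next
    case (step m)
    have "u (Suc m * n) - real (Suc m) * u n = (u (n + m * n) - u n - u (m * n)) + (u (m * n) - real m * u n)"
      by (simp add: algebra_simps)
    with D[of n "m * n"] step.IH show ?case by (simp add: algebra_simps)
  qed
  have *: "\<bar>u n / real n - u m / real m\<bar> \<le> D / real n + D / real m" if "1 \<le> m" "1 \<le> n" for m n
  proof -
    have "\<bar>real m * u n - real n * u m\<bar> \<le> real m * D + real n * D"
      using mult[OF that(1), of n] mult[OF that(2), of m] by (simp add: mult.commute)
    then have "\<bar>real m * u n - real n * u m\<bar> / (real m * real n) \<le> (real m * D + real n * D) / (real m * real n)"
      by (intro divide_right_mono) auto
    moreover have "u n / real n - u m / real m = (real m * u n - real n * u m) / (real m * real n)"
      "(real m * D + real n * D) / (real m * real n) = D / real n + D / real m"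
      using that by (auto simp: field_simps)
    ultimately show ?thesis by (simp add: abs_divide)
  qed
  have lim0: "(\<lambda>n. D / real n) \<longlonglongrightarrow> 0" by (rule lim_const_over_n)
  have "Cauchy (\<lambda>n. u n / real n)"
  proof (rule metric_CauchyI)
    fix e :: real assume "e > 0"
    then have "\<forall>\<^sub>F n in sequentially. D / real n < e / 2"
      using order_tendstoD(2)[OF lim0, of "e / 2"] by simp
    then obtain N where N: "\<And>n. n \<ge> N \<Longrightarrow> D / real n < e / 2" by (auto simp: eventually_sequentially)
    show "\<exists>M. \<forall>m\<ge>M. \<forall>n\<ge>M. dist (u m / real m) (u n / real n) < e"
    proof (intro exI[of _ "max 1 N"] allI impI)
      fix m n assume "m \<ge> max 1 N" "n \<ge> max 1 N"
      then have "1 \<le> m" "1 \<le> n" "N \<le> m" "N \<le> n" by auto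
      from *[OF this(2,1)] N[OF this(3)] N[OF this(4)]
      show "dist (u m / real m) (u n / real n) < e"
        unfolding dist_real_def by linarith
    qed
  qed
  then obtain l where l: "(\<lambda>n. u n / real n) \<longlonglongrightarrow> l"
    using Cauchy_convergent convergent_def by blast
  show ?thesis
  proof (rule that[of l])
    fix n
    show "\<bar>u n - real n * l\<bar> \<le> D"
    proof (cases "n = 0")
      case True
      then show ?thesis using D[of 0 0] by simp
    next
      case False
      have "(\<lambda>m. \<bar>u n / real n - u m / real m\<bar>) \<longlonglongrightarrow> \<bar>u n / real n - l\<bar>"
        by (intro tendsto_intros l)
      moreover have "(\<lambda>m. D / real n + D / real m) \<longlonglongrightarrow> D / real n + 0"
        by (intro tendsto_intros lim0)
      moreover have "\<forall>\<^sub>F m in sequentially. \<bar>u n / real n - u m / real m\<bar> \<le> D / real n + D / real m"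
        using eventually_ge_at_top[of 1] by eventually_elim (use * False in auto)
      ultimately have "\<bar>u n / real n - l\<bar> \<le> D / real n + 0"
        by (intro tendsto_le[OF sequentially_bot]) auto
      then have "real n * \<bar>u n / real n - l\<bar> \<le> real n * (D / real n)"
        by (intro mult_left_mono) auto
      moreover have "real n * \<bar>u n / real n - l\<bar> = \<bar>u n - real n * l\<bar>"
        using False by (subst abs_of_nat[symmetric, of n], subst abs_mult[symmetric]) (simp add: algebra_simps)
      ultimately show ?thesis using False by simp
    qed
  qed
qed

context matrix_law begin

lemma ennreal_mnorm_mult_powr_le:
  "0 \<le> t \<Longrightarrow> ennreal (mnorm (A ** B) powr t) \<le> ennreal (mnorm A powr t) * ennreal (mnorm B powr t)"
  using mnorm_mult_le[of A B]
  by (auto simp: ennreal_mult[symmetric] powr_mult[symmetric] intro!: ennreal_leI powr_mono2)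

lemma nn_integral_mult_powr_le:
  assumes "0 \<le> t"
  shows "(\<integral>\<^sup>+G. ennreal (mnorm (G ** Z) powr t) \<partial>cpow \<mu> (m + n)) \<le>
      mom \<mu> t m * (\<integral>\<^sup>+G. ennreal (mnorm (G ** Z) powr t) \<partial>cpow \<mu> n)"
proof -
  have "(\<integral>\<^sup>+G. ennreal (mnorm (G ** Z) powr t) \<partial>cpow \<mu> (m + n)) =
      (\<integral>\<^sup>+A. \<integral>\<^sup>+B. ennreal (mnorm (A ** B ** Z) powr t) \<partial>cpow \<mu> n \<partial>cpow \<mu> m)"
    by (rule nn_integral_cpow_add) measurable
  also have "\<dots> \<le> (\<integral>\<^sup>+A. \<integral>\<^sup>+B. ennreal (mnorm A powr t) * ennreal (mnorm (B ** Z) powr t) \<partial>cpow \<mu> n \<partial>cpow \<mu> m)"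
    unfolding matrix_mul_assoc[symmetric]
    by (intro nn_integral_mono ennreal_mnorm_mult_powr_le assms)
  also have "\<dots> = mom \<mu> t m * (\<integral>\<^sup>+G. ennreal (mnorm (G ** Z) powr t) \<partial>cpow \<mu> n)"
    unfolding mom_def by (simp add: nn_integral_cmult nn_integral_multc)
  finally show ?thesis .
qed

lemma mom_add_le: "0 \<le> t \<Longrightarrow> mom \<mu> t (m + n) \<le> mom \<mu> t m * mom \<mu> t n"
  using nn_integral_mult_powr_le[where Z = "mat 1"] by (simp add: mom_def)

lemma mom_0 [simp]: "mom \<mu> t 0 = 1"
  unfolding mom_def by (subst nn_integral_cpow_0) auto

lemma mom_1: "mom \<mu> t 1 = (\<integral>\<^sup>+A. ennreal (mnorm A powr t) \<partial>\<mu>)"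
  unfolding mom_def by (rule nn_integral_cpow_1) measurable

lemma mom_finite:
  assumes "t \<in> I_set \<mu>"
  shows "mom \<mu> t n < \<infinity>"
proof (induction n)
  case (Suc n)
  have "mom \<mu> t (1 + n) \<le> mom \<mu> t 1 * mom \<mu> t n"
    using assms by (intro mom_add_le) (auto simp: I_set_def)
  also have "\<dots> < \<infinity>"
    using Suc assms unfolding mom_1 by (auto simp: I_set_def ennreal_mult_less_top)
  finally show ?case by simp
qed simp

lemma tail_nonneg: "0 \<le> tail \<mu> n x" unfolding tail_def by simp

lemma tail_antimono: "x \<le> y \<Longrightarrow> tail \<mu> n y \<le> tail \<mu> n x"
  unfolding tail_def by (intro C.finite_measure_mono) (auto intro: order_trans)

lemma ennreal_tail: "ennreal (tail \<mu> n x) = (\<integral>\<^sup>+H. indicator {H. exp x \<le> mnorm H} H \<partial>cpow \<mu> n)"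
  unfolding tail_def by (subst nn_integral_indicator) (auto simp: C.emeasure_eq_measure)

end

section \<open>Almost multiplicativity of tails and moments\<close>

context cone_law begin

lemma mom_pos: "0 < mom \<mu> t n"
proof -
  have "mom \<mu> t n \<noteq> 0"
  proof
    assume "mom \<mu> t n = 0"
    then have "AE H in cpow \<mu> n. ennreal (mnorm H powr t) = 0"
      unfolding mom_def by (subst (asm) nn_integral_0_iff_AE) auto
    with AE_cpow_nonzero have "AE H in cpow \<mu> n. False"
      by eventually_elim (auto simp: ennreal_eq_0_iff)
    then show False by simp
  qed
  then show ?thesis by (simp add: zero_less_iff_neq_zero)
qed

text \<open>With the right block \<open>Z\<close> frozen, the left block is connected to it. The
  norms multiply up to the factor \<open>c\<close>, hence the shift of the threshold by
  \<open>ln c\<close>.\<close>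

lemma tail_splice:
  assumes K: "connecting K c p"
  shows "p * (tail \<mu> n x * tail \<mu> m y) \<le> real (Suc K) * tail \<mu> (K + n + m) (x + y + ln c)"
proof -
  have c: "0 < c" "0 < p" using K by (auto simp: connecting_def)
  let ?\<psi> = "indicator {H. exp (x + y + ln c) \<le> mnorm H} :: real^'n^'n \<Rightarrow> ennreal"
  let ?v = "indicator {H. exp x \<le> mnorm H} :: real^'n^'n \<Rightarrow> ennreal"
  let ?w = "indicator {H. exp y \<le> mnorm H} :: real^'n^'n \<Rightarrow> ennreal"
  have "ennreal p * (ennreal (tail \<mu> n x) * ennreal (tail \<mu> m y)) =
      (\<integral>\<^sup>+Z. ennreal p * (\<integral>\<^sup>+A. ?v A \<partial>cpow \<mu> n) * ?w Z \<partial>cpow \<mu> m)"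
    by (subst nn_integral_cmult) (auto simp: ennreal_tail mult.assoc)
  also have "\<dots> \<le> (\<integral>\<^sup>+Z. of_nat (Suc K) * (\<integral>\<^sup>+G. ?\<psi> (G ** Z) \<partial>cpow \<mu> (K + n)) \<partial>cpow \<mu> m)"
  proof (rule nn_integral_mono_AE, use AE_cpow_CA AE_cpow_nonzero in eventually_elim)
    case (elim Z)
    show ?case
    proof (cases "exp y \<le> mnorm Z")
      case True
      have "ennreal p * (\<integral>\<^sup>+A. ?v A \<partial>cpow \<mu> n) \<le> of_nat (Suc K) * (\<integral>\<^sup>+G. ?\<psi> (G ** Z) \<partial>cpow \<mu> (K + n))"
      proof (rule connecting_nn_integral_le[OF K elim])
        fix A k
        have "?v A \<le> ?\<psi> X" if "c * mnorm A * mnorm Z \<le> mnorm X" for X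
        proof (cases "exp x \<le> mnorm A")
          case A: True
          have "exp (x + y + ln c) = c * (exp x * exp y)" using c by (simp add: exp_add)
          also have "\<dots> \<le> c * (mnorm A * mnorm Z)"
            using A True c by (intro mult_left_mono mult_mono) auto
          also have "\<dots> \<le> mnorm X" using that by (simp add: mult.assoc)
          finally show ?thesis by (simp add: A)
        qed simp
        then show "AE H in cpow \<mu> k. AE J in cpow \<mu> (K - k).
            c * mnorm A * mnorm Z \<le> mnorm (J ** A ** H ** Z) \<longrightarrow> ?v A \<le> ?\<psi> (J ** A ** H ** Z)"
          by blast
      qed measurable
      with True show ?thesis by simp
    qed simp
  qed
  also have "\<dots> = of_nat (Suc K) * (\<integral>\<^sup>+H. ?\<psi> H \<partial>cpow \<mu> (K + n + m))"
    by (subst nn_integral_cmult, measurable, subst nn_integral_cpow_add') auto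
  also have "\<dots> = ennreal (real (Suc K) * tail \<mu> (K + n + m) (x + y + ln c))"
    by (simp only: ennreal_tail[symmetric] ennreal_mult[OF of_nat_0_le_iff tail_nonneg] ennreal_of_nat_eq_real_of_nat)
  finally show ?thesis
    using c by (simp add: ennreal_mult[symmetric] tail_nonneg del: of_nat_Suc)
qed

text \<open>A reverse of submultiplicativity, even for a fixed right factor \<open>Z\<close>. The
  connection costs \<open>K\<close> additional factors; these are removed again by
  submultiplicativity, at the price of the finite moment \<open>mom \<mu> t K\<close>.\<close>

lemma nn_integral_mult_powr_ge:
  assumes t: "t \<in> I_set \<mu>"
  obtains c where "0 < c" "\<And>n Z. Z \<in> CA \<Longrightarrow>
    ennreal c * mom \<mu> t n * ennreal (mnorm Z powr t) \<le> (\<integral>\<^sup>+G. ennreal (mnorm (G ** Z) powr t) \<partial>cpow \<mu> n)"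
proof -
  obtain K c p where K: "connecting K c p" by (rule connecting_exists)
  then have c: "0 < c" "0 < p" by (auto simp: connecting_def)
  have t0: "0 \<le> t" using t by (simp add: I_set_def)
  obtain a where a: "mom \<mu> t K = ennreal a" "0 < a"
    using mom_finite[OF t, of K] mom_pos[of t K] by (cases "mom \<mu> t K") auto
  define b where "b = p * c powr t / (real (Suc K) * a)"
  have b: "0 < b" using c a by (simp add: b_def)
  show ?thesis
  proof (rule that[OF b])
    fix n and Z :: "real^'n^'n" assume Z: "Z \<in> CA"
    let ?I = "\<lambda>n. \<integral>\<^sup>+G. ennreal (mnorm (G ** Z) powr t) \<partial>cpow \<mu> n"
    show "ennreal b * mom \<mu> t n * ennreal (mnorm Z powr t) \<le> ?I n"
    proof (cases "Z = 0")
      case False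
      let ?v = "\<lambda>A::real^'n^'n. ennreal (c powr t * mnorm Z powr t) * ennreal (mnorm A powr t)"
      have "ennreal p * (\<integral>\<^sup>+A. ?v A \<partial>cpow \<mu> n) \<le> of_nat (Suc K) * ?I (K + n)"
      proof (rule connecting_nn_integral_le[OF K Z False])
        fix A k
        have "?v A \<le> ennreal (mnorm X powr t)" if "c * mnorm A * mnorm Z \<le> mnorm X" for X
        proof -
          have "(c * mnorm A * mnorm Z) powr t \<le> mnorm X powr t"
            using that c t0 by (intro powr_mono2) auto
          then show ?thesis using c
            by (subst ennreal_mult[symmetric]) (auto simp: powr_mult ac_simps intro!: ennreal_leI)
        qed
        then show "AE H in cpow \<mu> k. AE J in cpow \<mu> (K - k).
            c * mnorm A * mnorm Z \<le> mnorm (J ** A ** H ** Z) \<longrightarrow> ?v A \<le> ennreal (mnorm (J ** A ** H ** Z) powr t)"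
          by blast
      qed measurable
      also have "\<dots> \<le> of_nat (Suc K) * (ennreal a * ?I n)"
        unfolding a(1)[symmetric] by (intro mult_left_mono nn_integral_mult_powr_le t0) simp
      finally have "ennreal p * (\<integral>\<^sup>+A. ?v A \<partial>cpow \<mu> n) \<le> of_nat (Suc K) * (ennreal a * ?I n)" .
      moreover have "(\<integral>\<^sup>+A. ?v A \<partial>cpow \<mu> n) = ennreal (c powr t * mnorm Z powr t) * mom \<mu> t n"
        unfolding mom_def by (rule nn_integral_cmult) measurable
      ultimately have *: "ennreal (p * c powr t * mnorm Z powr t) * mom \<mu> t n \<le> ennreal (real (Suc K) * a) * ?I n"
        using c a by (simp add: ennreal_mult[symmetric] mult.assoc[symmetric]
            ennreal_of_nat_eq_real_of_nat del: of_nat_Suc)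
      have d: "0 < real (Suc K) * a" using a by simp
      have "ennreal b * mom \<mu> t n * ennreal (mnorm Z powr t) =
          ennreal (1 / (real (Suc K) * a)) * (ennreal (p * c powr t * mnorm Z powr t) * mom \<mu> t n)"
        using c a by (simp add: b_def ennreal_mult[symmetric] mult.assoc[symmetric] mult.commute[of _ "mom \<mu> t n"])
          (simp add: mult.assoc ennreal_mult[symmetric])
      also have "\<dots> \<le> ennreal (1 / (real (Suc K) * a)) * (ennreal (real (Suc K) * a) * ?I n)"
        by (intro mult_left_mono *) simp
      also have "\<dots> = ?I n"
        using d a by (simp add: mult.assoc[symmetric] ennreal_mult[symmetric] del: of_nat_Suc)
      finally show ?thesis .
    qed simp
  qed
qed

lemma mom_add_ge:
  assumes t: "t \<in> I_set \<mu>"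
  obtains c where "0 < c" "\<And>m n. ennreal c * (mom \<mu> t n * mom \<mu> t m) \<le> mom \<mu> t (n + m)"
proof -
  obtain c where c: "0 < c" "\<And>n Z. Z \<in> CA \<Longrightarrow>
    ennreal c * mom \<mu> t n * ennreal (mnorm Z powr t) \<le> (\<integral>\<^sup>+G. ennreal (mnorm (G ** Z) powr t) \<partial>cpow \<mu> n)"
    using nn_integral_mult_powr_ge[OF t] by metis
  show ?thesis
  proof (rule that[OF c(1)])
    fix m n
    have "ennreal c * (mom \<mu> t n * mom \<mu> t m) = (\<integral>\<^sup>+Z. ennreal c * mom \<mu> t n * ennreal (mnorm Z powr t) \<partial>cpow \<mu> m)"
      by (subst nn_integral_cmult) (auto simp: mom_def[symmetric] mult.assoc)
    also have "\<dots> \<le> (\<integral>\<^sup>+Z. \<integral>\<^sup>+G. ennreal (mnorm (G ** Z) powr t) \<partial>cpow \<mu> n \<partial>cpow \<mu> m)"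
      by (rule nn_integral_mono_AE, use AE_cpow_CA in eventually_elim) (rule c(2))
    also have "\<dots> = mom \<mu> t (n + m)"
      unfolding mom_def by (rule nn_integral_cpow_add'[symmetric]) measurable
    finally show "ennreal c * (mom \<mu> t n * mom \<mu> t m) \<le> mom \<mu> t (n + m)" .
  qed
qed

text \<open>Multiplicativity up to constants in both directions makes the logarithm of the moment
  almost additive, so it deviates from a linear function by a bounded amount.\<close>

lemma mom_growth:
  assumes t: "t \<in> I_set \<mu>"
  obtains u l D where "\<And>n. mom \<mu> t n = ennreal (exp (u n))" "\<And>n. \<bar>u n - real n * l\<bar> \<le> D"
proof -
  obtain c where c: "0 < c" "\<And>m n. ennreal c * (mom \<mu> t n * mom \<mu> t m) \<le> mom \<mu> t (n + m)"
    by (rule mom_add_ge[OF t]) blast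
  define u where "u n = ln (enn2real (mom \<mu> t n))" for n
  have u: "mom \<mu> t n = ennreal (exp (u n))" for n
  proof -
    have "0 < enn2real (mom \<mu> t n)"
      using mom_finite[OF t, of n] mom_pos[of t n] by (simp add: enn2real_positive_iff)
    then show ?thesis using mom_finite[OF t, of n] by (simp add: u_def)
  qed
  have "u (n + m) \<le> u n + u m" for m n
    using mom_add_le[of t n m] t unfolding u
    by (simp add: I_set_def ennreal_mult[symmetric] exp_add[symmetric])
  moreover have "u n + u m + ln c \<le> u (n + m)" for m n
  proof -
    have "c * (exp (u n) * exp (u m)) \<le> exp (u (n + m))"
      using c(2)[of n m] c(1) unfolding u by (simp add: ennreal_mult[symmetric])
    then have "exp (u n + u m + ln c) \<le> exp (u (n + m))"
      using c(1) by (simp add: exp_add mult.commute)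
    then show ?thesis by simp
  qed
  ultimately have "\<bar>u (m + n) - u m - u n\<bar> \<le> \<bar>ln c\<bar>" for m n
    by (smt (verit))
  then obtain l where "\<And>n. \<bar>u n - real n * l\<bar> \<le> \<bar>ln c\<bar>"
    using almost_additive_linear by metis
  with u show ?thesis by (rule that)
qed

end

section \<open>The exponential growth rate\<close>

text \<open>The function \<open>Lambda\<close> written in terms of the law alone; for a
  \<open>cone_law\<close> the two agree on \<open>I_set \<mu>\<close>, see
  \<open>Lambda_eq_Lam\<close>.\<close>

definition Lam :: "(real^'n^'n) measure \<Rightarrow> real \<Rightarrow> real" where
  "Lam \<mu> t = lim (\<lambda>n. ln (enn2real (mom \<mu> t n)) / real n)"

text \<open>All that is used of \<open>q = \<Lambda>'(s)\<close>.\<close>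

definition tangent :: "(real^'n^'n) measure \<Rightarrow> real \<Rightarrow> real \<Rightarrow> bool" where
  "tangent \<mu> s q \<longleftrightarrow> 0 < s \<and> s \<in> I_set \<mu> \<and> (\<forall>\<delta>>0. \<exists>\<tau>>0. s + \<tau> \<in> I_set \<mu> \<and> s - \<tau> \<in> I_set \<mu> \<and>
     Lam \<mu> (s + \<tau>) \<le> Lam \<mu> s + \<tau> * (q + \<delta>) \<and> Lam \<mu> (s - \<tau>) \<le> Lam \<mu> s - \<tau> * (q - \<delta>))"

lemma linear_lower_bound:
  assumes "\<forall>\<^sub>F n in sequentially. real n * a - D \<le> real n * b"
  shows "a \<le> b"
proof (rule tendsto_le[OF sequentially_bot])
  show "(\<lambda>n. b) \<longlonglongrightarrow> b" by simp
  have "(\<lambda>n. a - D / real n) \<longlonglongrightarrow> a - 0" by (intro tendsto_intros lim_const_over_n)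
  then show "(\<lambda>n. a - D / real n) \<longlonglongrightarrow> a" by simp
  show "\<forall>\<^sub>F n in sequentially. a - D / real n \<le> b"
    using assms eventually_gt_at_top[of 0] by eventually_elim (simp add: field_simps)
qed

context cone_law begin

lemma mom_Lam:
  assumes t: "t \<in> I_set \<mu>"
  obtains u D where "\<And>n. mom \<mu> t n = ennreal (exp (u n))" "\<And>n. \<bar>u n - real n * Lam \<mu> t\<bar> \<le> D"
    "(\<lambda>n. u n / real n) \<longlonglongrightarrow> Lam \<mu> t"
proof -
  obtain u l D where u: "\<And>n. mom \<mu> t n = ennreal (exp (u n))" and D: "\<And>n. \<bar>u n - real n * l\<bar> \<le> D"
    by (rule mom_growth[OF t], rule that)
  have "(\<lambda>n. u n / real n) \<longlonglongrightarrow> l"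
  proof (rule Lim_transform_bound[where f = "\<lambda>n. u n / real n - l" and g = "\<lambda>n. D / real n", THEN LIM_zero_cancel])
    show "\<forall>\<^sub>F n in sequentially. norm (u n / real n - l) \<le> norm (D / real n)"
      using eventually_gt_at_top[of 0]
    proof eventually_elim
      case (elim n)
      have "\<bar>u n / real n - l\<bar> = \<bar>u n - real n * l\<bar> / real n"
        using elim by (subst abs_of_pos[of "real n", symmetric], simp, subst abs_divide[symmetric]) (simp add: field_simps)
      also have "\<dots> \<le> D / real n" by (intro divide_right_mono D) simp
      also have "\<dots> \<le> \<bar>D / real n\<bar>" by (rule abs_ge_self)
      finally show ?case by simp
    qed
  qed (rule lim_const_over_n)
  moreover have "Lam \<mu> t = lim (\<lambda>n. u n / real n)" unfolding Lam_def u by simp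
  ultimately have "Lam \<mu> t = l" by (metis limI)
  with u D \<open>(\<lambda>n. u n / real n) \<longlonglongrightarrow> l\<close> show ?thesis by (intro that[of u D]) auto
qed

lemma mom_bounds:
  assumes t: "t \<in> I_set \<mu>"
  obtains D where "\<And>n. mom \<mu> t n \<le> ennreal (exp (real n * Lam \<mu> t + D))"
    "\<And>n. ennreal (exp (real n * Lam \<mu> t - D)) \<le> mom \<mu> t n"
proof -
  obtain u D where u: "\<And>n. mom \<mu> t n = ennreal (exp (u n))" and D: "\<And>n. \<bar>u n - real n * Lam \<mu> t\<bar> \<le> D"
    by (rule mom_Lam[OF t], rule that)
  show ?thesis
  proof (rule that[of D])
    fix n show "mom \<mu> t n \<le> ennreal (exp (real n * Lam \<mu> t + D))"
      "ennreal (exp (real n * Lam \<mu> t - D)) \<le> mom \<mu> t n"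
      unfolding u using D[of n] by (auto intro!: ennreal_leI)
  qed
qed

text \<open>Chebyshev's inequality with the moment of order \<open>t\<close>. The constant
  \<open>D\<close> depends on neither \<open>n\<close> nor \<open>x\<close>, which later yields
  uniformity in the threshold.\<close>

lemma tail_le:
  assumes t: "t \<in> I_set \<mu>"
  obtains D where "\<And>n x. tail \<mu> n x \<le> exp (real n * Lam \<mu> t - t * x + D)"
proof -
  obtain D where D: "\<And>n. mom \<mu> t n \<le> ennreal (exp (real n * Lam \<mu> t + D))"
    by (rule mom_bounds[OF t], rule that)
  show ?thesis
  proof (rule that[of D])
    fix n x
    have "ennreal (tail \<mu> n x) \<le> (\<integral>\<^sup>+H. ennreal (exp (- t * x)) * ennreal (mnorm H powr t) \<partial>cpow \<mu> n)"
      unfolding ennreal_tail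
    proof (rule nn_integral_mono)
      fix H :: "real^'n^'n"
      show "indicator {H. exp x \<le> mnorm H} H \<le> ennreal (exp (- t * x)) * ennreal (mnorm H powr t)"
      proof (cases "exp x \<le> mnorm H")
        case True
        have "exp (t * x) = exp x powr t" by (simp add: powr_def)
        also have "\<dots> \<le> mnorm H powr t" using True t by (intro powr_mono2) (auto simp: I_set_def)
        finally have "1 \<le> exp (- t * x) * mnorm H powr t" by (simp add: exp_minus field_simps)
        with True show ?thesis by (simp add: ennreal_mult[symmetric] ennreal_1[symmetric] del: ennreal_1)
      qed simp
    qed
    also have "\<dots> = ennreal (exp (- t * x)) * mom \<mu> t n"
      unfolding mom_def by (rule nn_integral_cmult) measurable
    also have "\<dots> \<le> ennreal (exp (- t * x)) * ennreal (exp (real n * Lam \<mu> t + D))"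
      by (intro mult_left_mono D) simp
    also have "\<dots> = ennreal (exp (real n * Lam \<mu> t - t * x + D))"
      by (simp add: ennreal_mult[symmetric] exp_add[symmetric])
    finally show "tail \<mu> n x \<le> exp (real n * Lam \<mu> t - t * x + D)" by simp
  qed
qed

text \<open>Under the law of the product tilted by \<open>mnorm H powr s\<close>, the exponential Chebyshev
  inequality at \<open>s + \<tau>\<close> and \<open>s - \<tau>\<close> shows that \<open>ln (mnorm H) / n\<close> concentrates at \<open>q\<close>.\<close>

lemma concentration:
  assumes "tangent \<mu> s q" and \<delta>: "0 < \<delta>"
  obtains c where "0 < c" "\<forall>\<^sub>F n in sequentially. c * exp (real n * (Lam \<mu> s - s * q - s * \<delta>)) \<le>
     measure (cpow \<mu> n) {H. exp (real n * (q - \<delta>)) \<le> mnorm H \<and> mnorm H \<le> exp (real n * (q + \<delta>))}"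
proof -
  have s: "s \<in> I_set \<mu>" "0 < s" using assms by (auto simp: tangent_def)
  \<comment> \<open>Using the tangent with \<open>\<delta> / 2\<close> leaves a gap
    \<open>\<tau> * \<delta> / 2\<close> per factor, so the parts of the moment outside the window
    decay exponentially relative to the whole.\<close>
  obtain \<tau> where \<tau>: "0 < \<tau>" "s + \<tau> \<in> I_set \<mu>" "s - \<tau> \<in> I_set \<mu>"
    "Lam \<mu> (s + \<tau>) \<le> Lam \<mu> s + \<tau> * (q + \<delta> / 2)" "Lam \<mu> (s - \<tau>) \<le> Lam \<mu> s - \<tau> * (q - \<delta> / 2)"
    using assms unfolding tangent_def by (meson half_gt_zero)
  obtain D0 where D0: "\<And>n. ennreal (exp (real n * Lam \<mu> s - D0)) \<le> mom \<mu> s n"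
    by (rule mom_bounds[OF s(1)], rule that)
  obtain D1 where D1: "\<And>n. mom \<mu> (s + \<tau>) n \<le> ennreal (exp (real n * Lam \<mu> (s + \<tau>) + D1))"
    by (rule mom_bounds[OF \<tau>(2)], rule that)
  obtain D2 where D2: "\<And>n. mom \<mu> (s - \<tau>) n \<le> ennreal (exp (real n * Lam \<mu> (s - \<tau>) + D2))"
    by (rule mom_bounds[OF \<tau>(3)], rule that)
  define E where "E n = {H::real^'n^'n. exp (real n * (q - \<delta>)) \<le> mnorm H \<and> mnorm H \<le> exp (real n * (q + \<delta>))}" for n
  have [measurable]: "E n \<in> sets borel" for n unfolding E_def by measurable
  define P where "P n = measure (cpow \<mu> n) (E n)" for n
  have main: "exp (real n * Lam \<mu> s - D0) \<le> exp (s * (real n * (q + \<delta>))) * P n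
      + exp (real n * Lam \<mu> s - real n * (\<tau> * \<delta> / 2) + D1) + exp (real n * Lam \<mu> s - real n * (\<tau> * \<delta> / 2) + D2)" for n
  proof -
    let ?a = "real n * (q + \<delta>)" and ?b = "real n * (q - \<delta>)"
    have "ennreal (exp (real n * Lam \<mu> s - D0)) \<le> mom \<mu> s n" by (rule D0)
    also have "\<dots> \<le> (\<integral>\<^sup>+H. ennreal (exp (s * ?a)) * indicator (E n) H + ennreal (exp (- \<tau> * ?a)) * ennreal (mnorm H powr (s + \<tau>))
         + ennreal (exp (\<tau> * ?b)) * ennreal (mnorm H powr (s - \<tau>)) \<partial>cpow \<mu> n)"
      unfolding mom_def
    proof (rule nn_integral_mono_AE, use AE_cpow_nonzero in eventually_elim)
      case (elim H)
      define h where "h = ln (mnorm H)"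
      have h: "mnorm H = exp h" using elim by (simp add: h_def)
      consider "h < ?b" | "?a < h" | "?b \<le> h" "h \<le> ?a" by linarith
      then show ?case
      proof cases
        case 1
        then have "0 \<le> \<tau> * (?b - h)" using \<tau>(1) by simp
        then have "s * h \<le> \<tau> * ?b + (s - \<tau>) * h" by (simp add: algebra_simps)
        then have "ennreal (mnorm H powr s) \<le> ennreal (exp (\<tau> * ?b)) * ennreal (mnorm H powr (s - \<tau>))"
          by (simp add: h powr_def ennreal_mult[symmetric] exp_add[symmetric] mult.commute)
        then show ?thesis by (simp add: add_increasing)
      next
        case 2
        then have "0 \<le> \<tau> * (h - ?a)" using \<tau>(1) by simp
        then have "s * h \<le> - \<tau> * ?a + (s + \<tau>) * h" by (simp add: algebra_simps)
        then have "ennreal (mnorm H powr s) \<le> ennreal (exp (- \<tau> * ?a)) * ennreal (mnorm H powr (s + \<tau>))"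
          by (simp add: h powr_def ennreal_mult[symmetric] exp_add[symmetric] mult.commute)
        then show ?thesis by (simp add: add_increasing add_increasing2)
      next
        case 3
        then have "H \<in> E n" by (simp add: E_def h)
        moreover have "ennreal (mnorm H powr s) \<le> ennreal (exp (s * ?a))"
          using 3 s by (simp add: h powr_def mult.commute)
        ultimately show ?thesis by (simp add: add_increasing2)
      qed
    qed
    also have "\<dots> = ennreal (exp (s * ?a)) * ennreal (P n) + ennreal (exp (- \<tau> * ?a)) * mom \<mu> (s + \<tau>) n
         + ennreal (exp (\<tau> * ?b)) * mom \<mu> (s - \<tau>) n"
      by (simp add: nn_integral_add nn_integral_cmult mom_def P_def C.emeasure_eq_measure)
    also have "\<dots> \<le> ennreal (exp (s * ?a)) * ennreal (P n)
         + ennreal (exp (- \<tau> * ?a)) * ennreal (exp (real n * Lam \<mu> (s + \<tau>) + D1))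
         + ennreal (exp (\<tau> * ?b)) * ennreal (exp (real n * Lam \<mu> (s - \<tau>) + D2))"
      by (intro add_mono mult_left_mono D1 D2) auto
    also have "\<dots> = ennreal (exp (s * ?a) * P n
         + exp (- \<tau> * ?a + (real n * Lam \<mu> (s + \<tau>) + D1)) + exp (\<tau> * ?b + (real n * Lam \<mu> (s - \<tau>) + D2)))"
      by (simp add: ennreal_mult[symmetric] ennreal_plus[symmetric] exp_add[symmetric] P_def del: ennreal_plus)
    finally have "exp (real n * Lam \<mu> s - D0) \<le> exp (s * ?a) * P n
         + exp (- \<tau> * ?a + (real n * Lam \<mu> (s + \<tau>) + D1)) + exp (\<tau> * ?b + (real n * Lam \<mu> (s - \<tau>) + D2))"
      by (subst (asm) ennreal_le_iff) (auto simp: P_def)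
    moreover have "real n * Lam \<mu> (s + \<tau>) \<le> real n * (Lam \<mu> s + \<tau> * (q + \<delta> / 2))"
      "real n * Lam \<mu> (s - \<tau>) \<le> real n * (Lam \<mu> s - \<tau> * (q - \<delta> / 2))"
      using \<tau> by (auto intro!: mult_left_mono)
    then have "exp (- \<tau> * ?a + (real n * Lam \<mu> (s + \<tau>) + D1)) \<le> exp (real n * Lam \<mu> s - real n * (\<tau> * \<delta> / 2) + D1)"
      "exp (\<tau> * ?b + (real n * Lam \<mu> (s - \<tau>) + D2)) \<le> exp (real n * Lam \<mu> s - real n * (\<tau> * \<delta> / 2) + D2)"
      by (auto simp: algebra_simps)
    ultimately show ?thesis by linarith
  qed
  have lim: "(\<lambda>n. exp (- (real n * (\<tau> * \<delta> / 2)) + D1) + exp (- (real n * (\<tau> * \<delta> / 2)) + D2)) \<longlonglongrightarrow> 0"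
  proof -
    have a: "0 < \<tau> * \<delta> / 2" using \<tau> \<delta> by simp
    have "(\<lambda>n. exp (- (\<tau> * \<delta> / 2)) ^ n * exp D1 + exp (- (\<tau> * \<delta> / 2)) ^ n * exp D2) \<longlonglongrightarrow> 0 * exp D1 + 0 * exp D2"
      using a by (intro tendsto_intros LIMSEQ_power_zero) auto
    then show ?thesis by (simp add: exp_add[symmetric] exp_of_nat_mult[symmetric])
  qed
  show ?thesis
  proof (rule that[of "exp (- D0) / 2"])
    have "\<forall>\<^sub>F n in sequentially. exp (- (real n * (\<tau> * \<delta> / 2)) + D1) + exp (- (real n * (\<tau> * \<delta> / 2)) + D2) < exp (- D0) / 2"
      by (rule order_tendstoD(2)[OF lim]) simp
    then have "\<forall>\<^sub>F n in sequentially. exp (- D0) / 2 * exp (real n * (Lam \<mu> s - s * q - s * \<delta>)) \<le> P n"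
    proof eventually_elim
      case (elim n)
      let ?e = "exp (real n * Lam \<mu> s)"
      have "?e * exp (- D0) \<le> exp (s * (real n * (q + \<delta>))) * P n
          + ?e * (exp (- (real n * (\<tau> * \<delta> / 2)) + D1) + exp (- (real n * (\<tau> * \<delta> / 2)) + D2))"
        using main[of n] by (simp add: exp_add[symmetric] distrib_left algebra_simps)
      also have "?e * (exp (- (real n * (\<tau> * \<delta> / 2)) + D1) + exp (- (real n * (\<tau> * \<delta> / 2)) + D2)) \<le> ?e * (exp (- D0) / 2)"
        using elim by (intro mult_left_mono) auto
      finally have "?e * (exp (- D0) / 2) \<le> exp (s * (real n * (q + \<delta>))) * P n" by simp
      then have "exp (- (s * (real n * (q + \<delta>)))) * (?e * (exp (- D0) / 2)) \<le>
          exp (- (s * (real n * (q + \<delta>)))) * (exp (s * (real n * (q + \<delta>))) * P n)"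
        by (intro mult_left_mono) auto
      also have "\<dots> = P n" by (simp add: exp_minus)
      also have "exp (- (s * (real n * (q + \<delta>)))) * (?e * (exp (- D0) / 2)) =
          exp (- D0) / 2 * exp (real n * (Lam \<mu> s - s * q - s * \<delta>))"
        by (simp add: exp_add[symmetric] algebra_simps)
      finally show ?case .
    qed
    then show "\<forall>\<^sub>F n in sequentially. exp (- D0) / 2 * exp (real n * (Lam \<mu> s - s * q - s * \<delta>)) \<le>
       measure (cpow \<mu> n) {H. exp (real n * (q - \<delta>)) \<le> mnorm H \<and> mnorm H \<le> exp (real n * (q + \<delta>))}"
      unfolding P_def E_def .
  qed simp
qed

lemma tail_ge_concentration:
  assumes "tangent \<mu> s q" and \<delta>: "0 < \<delta>"
  obtains c where "0 < c"
    "\<forall>\<^sub>F n in sequentially. c * exp (real n * (Lam \<mu> s - s * q - s * \<delta>)) \<le> tail \<mu> n (real n * (q - \<delta>))"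
proof -
  obtain c where c: "0 < c" and ev: "\<forall>\<^sub>F n in sequentially. c * exp (real n * (Lam \<mu> s - s * q - s * \<delta>)) \<le>
     measure (cpow \<mu> n) {H. exp (real n * (q - \<delta>)) \<le> mnorm H \<and> mnorm H \<le> exp (real n * (q + \<delta>))}"
    by (rule concentration[OF assms])
  from ev have "\<forall>\<^sub>F n in sequentially. c * exp (real n * (Lam \<mu> s - s * q - s * \<delta>)) \<le> tail \<mu> n (real n * (q - \<delta>))"
  proof eventually_elim
    case (elim n)
    note elim
    also have "measure (cpow \<mu> n) {H. exp (real n * (q - \<delta>)) \<le> mnorm H \<and> mnorm H \<le> exp (real n * (q + \<delta>))}
        \<le> tail \<mu> n (real n * (q - \<delta>))"
      unfolding tail_def by (intro C.finite_measure_mono) auto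
    finally show ?case .
  qed
  with c show ?thesis by (rule that)
qed

text \<open>The supporting line is obtained from probabilities rather than from convexity: the lower
  bound for the tail near \<open>q\<close>, due to the tilted law at \<open>s\<close>, is compared
  with Chebyshev's upper bound at \<open>t\<close>.\<close>

lemma Lam_ge_tangent:
  assumes tan: "tangent \<mu> s q" and t: "t \<in> I_set \<mu>"
  shows "Lam \<mu> s + q * (t - s) \<le> Lam \<mu> t"
proof (rule field_le_epsilon)
  fix e :: real assume e: "0 < e"
  have s: "0 < s" and t0: "0 \<le> t" using assms by (auto simp: tangent_def I_set_def)
  \<comment> \<open>The lower bound loses \<open>s * \<delta>\<close> and the upper one
    \<open>t * \<delta>\<close> per factor; together this is \<open>e\<close>.\<close>
  define \<delta> where "\<delta> = e / (s + t)"
  have \<delta>: "0 < \<delta>" "(s + t) * \<delta> = e" using e s t0 by (auto simp: \<delta>_def)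
  obtain c where c: "0 < c" and ev: "\<forall>\<^sub>F n in sequentially. c * exp (real n * (Lam \<mu> s - s * q - s * \<delta>)) \<le> tail \<mu> n (real n * (q - \<delta>))"
    by (rule tail_ge_concentration[OF tan \<delta>(1)])
  obtain D where D: "\<And>n x. tail \<mu> n x \<le> exp (real n * Lam \<mu> t - t * x + D)"
    by (rule tail_le[OF t], rule that)
  have "\<forall>\<^sub>F n in sequentially. real n * (Lam \<mu> s + q * (t - s) - e) - (D - ln c) \<le> real n * Lam \<mu> t"
    using ev
  proof eventually_elim
    case (elim n)
    note elim
    also have "tail \<mu> n (real n * (q - \<delta>)) \<le> exp (real n * Lam \<mu> t - t * (real n * (q - \<delta>)) + D)" by (rule D)
    also have "c * exp (real n * (Lam \<mu> s - s * q - s * \<delta>)) = exp (ln c + real n * (Lam \<mu> s - s * q - s * \<delta>))"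
      using c by (simp add: exp_add)
    finally have "ln c + real n * (Lam \<mu> s - s * q - s * \<delta>) \<le> real n * Lam \<mu> t - t * (real n * (q - \<delta>)) + D"
      by simp
    then show ?case unfolding \<delta>(2)[symmetric] by (simp add: algebra_simps)
  qed
  then have "Lam \<mu> s + q * (t - s) - e \<le> Lam \<mu> t" by (rule linear_lower_bound)
  then show "Lam \<mu> s + q * (t - s) \<le> Lam \<mu> t + e" by simp
qed

section \<open>Lifting the threshold above \<open>q\<close> by splicing\<close>

lemma tail_iterate:
  assumes "connecting K c p"
  shows "(p / real (Suc K) * tail \<mu> m y) ^ r * tail \<mu> n x \<le> tail \<mu> (r * (K + m) + n) (real r * (y + ln c) + x)"
proof (induction r)
  case (Suc r)
  have p: "0 < p" using assms by (simp add: connecting_def)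
  let ?t = "tail \<mu> (r * (K + m) + n) (real r * (y + ln c) + x)"
  have "(p / real (Suc K) * tail \<mu> m y) ^ Suc r * tail \<mu> n x \<le> p / real (Suc K) * tail \<mu> m y * ?t"
    using mult_left_mono[OF Suc, of "p / real (Suc K) * tail \<mu> m y"] p by (simp add: tail_nonneg mult.assoc)
  also have "\<dots> = p * (tail \<mu> m y * ?t) / real (Suc K)" by simp
  also have "\<dots> \<le> (real (Suc K) * tail \<mu> (K + m + (r * (K + m) + n)) (y + (real r * (y + ln c) + x) + ln c)) / real (Suc K)"
    by (intro divide_right_mono tail_splice assms) simp
  also have "\<dots> = tail \<mu> (K + m + (r * (K + m) + n)) (y + (real r * (y + ln c) + x) + ln c)"
    by simp
  also have "\<dots> = tail \<mu> (Suc r * (K + m) + n) (real (Suc r) * (y + ln c) + x)"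
    by (simp add: algebra_simps)
  finally show ?case .
qed simp

text \<open>Splicing a small proportion of blocks growing faster than \<open>q\<close> into typical products of the tilted
  law lifts the typical exponent \<open>q - \<delta>\<close> above \<open>q\<close> at small exponential cost.\<close>

lemma tail_ge_if_fast_block:
  assumes tan: "tangent \<mu> s q" and K: "connecting K c p"
    and fast: "0 < tail \<mu> m y" "real (K + m) * q < y + ln c" and \<epsilon>: "0 < \<epsilon>"
  obtains \<eta> where "0 < \<eta>"
    "\<forall>\<^sub>F n in sequentially. exp (real n * (Lam \<mu> s - s * q - \<epsilon>)) \<le> tail \<mu> n (real n * (q + \<eta>))"
proof -
  have s: "0 < s" and p: "0 < p" using tan K by (auto simp: tangent_def connecting_def)
  define L where "L = K + m"
  \<comment> \<open>Net gain of one fast block over the speed \<open>q\<close>, after the additional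
    \<open>K\<close> factors and the loss \<open>ln c\<close> of its connection.\<close>
  define \<kappa> where "\<kappa> = y + ln c - real L * q"
  define \<pi> where "\<pi> = p / real (Suc K) * tail \<mu> m y"
  define b where "b = Lam \<mu> s - s * q"
  \<comment> \<open>Bounds the logarithmic cost of one block: its probability, entering through
    \<open>\<pi>\<close>, and the \<open>L\<close> factors that it takes away from the typical
    product.\<close>
  define B where "B = \<bar>ln \<pi>\<bar> + real L * \<bar>b\<bar>"
  have \<kappa>: "0 < \<kappa>" and \<pi>: "0 < \<pi>" and B: "0 \<le> B" using fast p by (auto simp: \<kappa>_def \<pi>_def L_def B_def)
  \<comment> \<open>The first bound keeps the total cost \<open>\<rho> * B + s * \<delta>\<close>
    below \<open>\<epsilon> / 2\<close>; the second keeps \<open>\<rho> * L\<close> at most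
    \<open>1 / 2\<close>, so that about half of the length remains for the typical product.\<close>
  define \<delta> where "\<delta> = min (\<epsilon> / (2 * (2 * B / \<kappa> + s))) (\<kappa> / (4 * (real L + 1)))"
  \<comment> \<open>The density of blocks is such that their gain is \<open>2 * \<delta>\<close> per
    factor: one \<open>\<delta>\<close> brings \<open>q - \<delta>\<close> back to \<open>q\<close>,
    the other is the surplus, so that \<open>\<eta>\<close> will be \<open>\<delta>\<close>.\<close>
  define \<rho> where "\<rho> = 2 * \<delta> / \<kappa>"
  have Bs: "0 < 2 * B / \<kappa> + s" using B \<kappa> s by (simp add: add_nonneg_pos)
  have \<delta>: "0 < \<delta>" using \<epsilon> \<kappa> Bs by (simp add: \<delta>_def)
  have \<rho>: "0 < \<rho>" "\<rho> * \<kappa> = 2 * \<delta>" using \<delta> \<kappa> by (auto simp: \<rho>_def)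
  have \<delta>1: "\<rho> * B + s * \<delta> \<le> \<epsilon> / 2"
  proof -
    have "\<rho> * B + s * \<delta> = (2 * B / \<kappa> + s) * \<delta>" by (simp add: \<rho>_def algebra_simps)
    also have "\<dots> \<le> (2 * B / \<kappa> + s) * (\<epsilon> / (2 * (2 * B / \<kappa> + s)))"
      using Bs by (intro mult_left_mono) (auto simp: \<delta>_def)
    also have "\<dots> = \<epsilon> / 2" using Bs by (simp add: divide_simps)
    finally show ?thesis .
  qed
  have \<rho>L: "\<rho> * real L \<le> 1 / 2"
  proof -
    have "\<delta> \<le> \<kappa> / (4 * (real L + 1))" by (simp add: \<delta>_def)
    then have "\<rho> \<le> 1 / (2 * (real L + 1))" using \<kappa> by (simp add: \<rho>_def field_simps)
    then have "\<rho> * real L \<le> 1 / (2 * (real L + 1)) * real L" by (intro mult_right_mono) auto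
    also have "\<dots> \<le> 1 / 2" by (simp add: field_simps)
    finally show ?thesis .
  qed
  obtain c0 where c0: "0 < c0" and ev: "\<forall>\<^sub>F n in sequentially. c0 * exp (real n * (Lam \<mu> s - s * q - s * \<delta>)) \<le> tail \<mu> n (real n * (q - \<delta>))"
    by (rule tail_ge_concentration[OF tan \<delta>])
  then obtain N where N: "\<And>n. n \<ge> N \<Longrightarrow> c0 * exp (real n * (b - s * \<delta>)) \<le> tail \<mu> n (real n * (q - \<delta>))"
    by (auto simp: eventually_sequentially b_def)
  have "\<forall>\<^sub>F n in sequentially. exp (real n * (b - \<epsilon>)) \<le> tail \<mu> n (real n * (q + \<delta>))"
    \<comment> \<open>The first bound on \<open>n\<close> leaves at least \<open>N\<close> factors
      to the typical product; the second absorbs \<open>ln c0\<close> and the constant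
      \<open>B\<close> that comes from rounding up the number of blocks.\<close>
    using eventually_ge_at_top[of "nat \<lceil>2 * (real L + real N)\<rceil>"] eventually_ge_at_top[of "nat \<lceil>2 * (B + \<bar>ln c0\<bar>) / \<epsilon>\<rceil>"]
  proof eventually_elim
    case (elim n)
    have n1: "2 * (real L + real N) \<le> real n" and n2: "2 * (B + \<bar>ln c0\<bar>) \<le> real n * \<epsilon>"
      using elim \<epsilon> by (auto simp: nat_le_iff ceiling_le_iff field_simps)
    define r where "r = nat \<lceil>\<rho> * real n\<rceil>"
    have r: "\<rho> * real n \<le> real r" "real r \<le> \<rho> * real n + 1"
      using \<rho> by (auto simp: r_def of_nat_ceiling le_of_int_ceiling of_nat_nat)
    have "real r * real L \<le> (\<rho> * real n + 1) * real L" using r by (intro mult_right_mono) auto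
    also have "\<dots> = \<rho> * real L * real n + real L" by (simp add: algebra_simps)
    also have "\<dots> \<le> 1 / 2 * real n + real L" using \<rho>L by (intro add_mono mult_right_mono) auto
    also have "\<dots> \<le> real n - real N" using n1 by simp
    finally have "real (r * L + N) \<le> real n" by simp
    then have rL: "r * L + N \<le> n" by (simp only: of_nat_le_iff)
    define n1 where "n1 = n - r * L"
    have n1: "N \<le> n1" "r * L + n1 = n" using rL by (auto simp: n1_def)
    then have n1r: "real n1 = real n - real r * real L" by (metis add_diff_cancel_left' of_nat_add of_nat_mult)
    have x: "real n * (q + \<delta>) \<le> real r * (y + ln c) + real n1 * (q - \<delta>)"
    proof -
      have "real r * (y + ln c) + real n1 * (q - \<delta>) = real n * q + real r * \<kappa> - real n1 * \<delta>"
        unfolding n1r by (simp add: \<kappa>_def algebra_simps)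
      moreover have "\<rho> * real n * \<kappa> \<le> real r * \<kappa>" using r \<kappa> by (intro mult_right_mono) auto
      moreover have "\<rho> * real n * \<kappa> = 2 * (real n * \<delta>)" using \<rho>(2) by (metis mult.assoc mult.commute)
      moreover have "real n1 * \<delta> \<le> real n * \<delta>" using \<delta> by (intro mult_right_mono) (auto simp: n1_def)
      ultimately show ?thesis by (simp add: distrib_left)
    qed
    have "real n * (b - \<epsilon>) \<le> real r * ln \<pi> + (ln c0 + real n1 * (b - s * \<delta>))"
    proof -
      have "real r * B \<le> (\<rho> * real n + 1) * B" using r B by (intro mult_right_mono) auto
      moreover have "real r * B = real r * \<bar>ln \<pi>\<bar> + real r * (real L * \<bar>b\<bar>)" by (simp add: B_def algebra_simps)
      moreover have "- (real r * \<bar>ln \<pi>\<bar>) \<le> real r * ln \<pi>"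
        using mult_left_mono[of "- \<bar>ln \<pi>\<bar>" "ln \<pi>" "real r"] by simp
      moreover have "real r * (real L * b) \<le> real r * (real L * \<bar>b\<bar>)" by (intro mult_left_mono) auto
      moreover have "real n1 * (s * \<delta>) \<le> real n * (s * \<delta>)" using s \<delta> by (intro mult_right_mono) (auto simp: n1_def)
      moreover have "real n1 * b = real n * b - real r * (real L * b)" unfolding n1r by (simp add: algebra_simps)
      moreover have "real n * (\<rho> * B + s * \<delta>) \<le> real n * (\<epsilon> / 2)" using \<delta>1 by (intro mult_left_mono) auto
      ultimately show ?thesis using n2 abs_ge_minus_self[of "ln c0"]
        by (simp add: algebra_simps)
    qed
    then have "exp (real n * (b - \<epsilon>)) \<le> exp (real r * ln \<pi> + (ln c0 + real n1 * (b - s * \<delta>)))" by simp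
    also have "\<dots> = \<pi> ^ r * (c0 * exp (real n1 * (b - s * \<delta>)))"
      using \<pi> c0 by (simp add: exp_add exp_of_nat_mult)
    also have "\<dots> \<le> \<pi> ^ r * tail \<mu> n1 (real n1 * (q - \<delta>))"
      using \<pi> by (intro mult_left_mono N n1) auto
    also have "\<dots> \<le> tail \<mu> (r * L + n1) (real r * (y + ln c) + real n1 * (q - \<delta>))"
      unfolding \<pi>_def L_def by (rule tail_iterate[OF K])
    also have "\<dots> \<le> tail \<mu> n (real n * (q + \<delta>))"
      unfolding n1(2) by (rule tail_antimono[OF x])
    finally show ?case .
  qed
  with \<delta> show ?thesis unfolding b_def by (rule that)
qed

end

section \<open>Bounded semigroups\<close>

context cone_law begin

text \<open>Where the norm is below \<open>\<epsilon>\<close>, its power \<open>t\<close> is at most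
  \<open>c1 / 2\<close> times its power \<open>s\<close>, by the choice of
  \<open>\<epsilon>\<close>; this accounts for at most half of the assumed lower bound. The rest
  comes from norms between \<open>\<epsilon>\<close> and \<open>C\<close>, where the two powers
  differ by at most the factor \<open>C powr (t - s)\<close>.\<close>

lemma mom_truncated_ge:
  assumes bd: "\<And>n. AE H in cpow \<mu> n. mnorm H \<le> C" and C: "1 \<le> C"
    and s: "s \<in> I_set \<mu>" "s < t" and c1: "0 < c1" "\<And>n. ennreal c1 * mom \<mu> s n \<le> mom \<mu> t n"
  obtains \<epsilon> c where "0 < \<epsilon>" "0 < c"
    "\<And>n. ennreal c * mom \<mu> s n \<le> (\<integral>\<^sup>+H. indicator {H. \<epsilon> \<le> mnorm H} H * ennreal (mnorm H powr s) \<partial>cpow \<mu> n)"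
proof -
  define \<epsilon> where "\<epsilon> = (c1 / 2) powr (1 / (t - s))"
  have \<epsilon>: "0 < \<epsilon>" "\<epsilon> powr (t - s) = c1 / 2" using c1 s by (auto simp: \<epsilon>_def powr_powr)
  define d where "d = C powr (t - s)"
  have d: "0 < d" using C by (simp add: d_def)
  show ?thesis
  proof (rule that[of \<epsilon> "c1 / 2 / d"])
    fix n
    let ?B = "\<integral>\<^sup>+H. indicator {H. \<epsilon> \<le> mnorm H} H * ennreal (mnorm H powr s) \<partial>cpow \<mu> n"
    obtain a where a: "mom \<mu> s n = ennreal a" "0 \<le> a"
      using mom_finite[OF s(1), of n] by (cases "mom \<mu> s n") auto
    have "ennreal c1 * mom \<mu> s n \<le> mom \<mu> t n" by (rule c1)
    also have "\<dots> \<le> (\<integral>\<^sup>+H. ennreal (c1 / 2) * ennreal (mnorm H powr s)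
        + ennreal d * (indicator {H. \<epsilon> \<le> mnorm H} H * ennreal (mnorm H powr s)) \<partial>cpow \<mu> n)"
      unfolding mom_def
    proof (rule nn_integral_mono_AE, use bd AE_cpow_nonzero in eventually_elim)
      case (elim H)
      have H: "mnorm H powr t = mnorm H powr (t - s) * mnorm H powr s"
        by (simp add: powr_add[symmetric])
      show ?case
      proof (cases "\<epsilon> \<le> mnorm H")
        case True
        have "mnorm H powr (t - s) \<le> d"
          unfolding d_def using elim s by (intro powr_mono2) auto
        then have "ennreal (mnorm H powr t) \<le> ennreal d * ennreal (mnorm H powr s)"
          unfolding H using d by (subst ennreal_mult[symmetric]) (auto intro!: ennreal_leI mult_right_mono)
        then show ?thesis using True by (simp add: add_increasing)
      next
        case False
        have "mnorm H powr (t - s) \<le> c1 / 2"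
          unfolding \<epsilon>(2)[symmetric] using False s by (intro powr_mono2) auto
        then have "ennreal (mnorm H powr t) \<le> ennreal (c1 / 2) * ennreal (mnorm H powr s)"
          unfolding H using c1 mult_right_mono[OF _ powr_ge_zero, of "mnorm H powr (t - s)" "c1 / 2" "mnorm H" s]
          by (subst ennreal_mult[symmetric]) (auto intro!: ennreal_leI)
        then show ?thesis using False by simp
      qed
    qed
    also have "\<dots> = ennreal (c1 / 2) * mom \<mu> s n + ennreal d * ?B"
      unfolding mom_def by (subst nn_integral_add, measurable) (simp add: nn_integral_cmult)
    finally have "ennreal (c1 / 2 * a) + ennreal (c1 / 2 * a) \<le> ennreal (c1 / 2 * a) + ennreal d * ?B"
      using a c1 by (simp add: ennreal_mult[symmetric] ennreal_plus[symmetric] mult.commute[of a] del: ennreal_plus)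
    then have "ennreal (c1 / 2 * a) \<le> ennreal d * ?B"
      by (simp add: ennreal_add_left_cancel_le)
    then have "ennreal (1 / d) * ennreal (c1 / 2 * a) \<le> ennreal (1 / d) * (ennreal d * ?B)"
      by (rule mult_left_mono) simp
    then show "ennreal (c1 / 2 / d) * mom \<mu> s n \<le> ?B"
      using d a c1 by (simp add: mult.assoc[symmetric] ennreal_mult[symmetric] mult.commute[of d 2])
  qed (use \<epsilon> c1 d in auto)
qed

text \<open>A small factor \<open>A\<close> is connected to \<open>Z\<close>. The bound
  \<open>C\<close> for each of \<open>J\<close>, \<open>H\<close> and \<open>Z\<close> explains the
  threshold \<open>\<epsilon> / C ^ 3\<close>, and the connection keeps a fixed share of the power
  of \<open>mnorm Z\<close> because \<open>A\<close>, though small, is nonzero.\<close>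

lemma small_step_ge:
  assumes bd: "\<And>n. AE H in cpow \<mu> n. mnorm H \<le> C" and C: "1 \<le> C"
    and s: "s \<in> I_set \<mu>" and K: "connecting K c p"
    and small: "\<not> (AE H in cpow \<mu> m. \<epsilon> / C ^ 3 \<le> mnorm H)"
  obtains d where "0 < d" "\<And>Z. Z \<in> CA \<Longrightarrow> Z \<noteq> 0 \<Longrightarrow> mnorm Z \<le> C \<Longrightarrow>
    ennreal d * ennreal (mnorm Z powr s) \<le>
      (\<integral>\<^sup>+Y. indicator {X. mnorm X < \<epsilon>} (Y ** Z) * ennreal (mnorm (Y ** Z) powr s) \<partial>cpow \<mu> (K + m))"
proof -
  have c: "0 < c" "0 < p" and s0: "0 \<le> s" using K s by (auto simp: connecting_def I_set_def)
  define w :: "real^'n^'n \<Rightarrow> ennreal" where "w A = indicator {A. mnorm A < \<epsilon> / C ^ 3} A * ennreal (mnorm A powr s)" for A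
  have [measurable]: "w \<in> borel_measurable borel" unfolding w_def[abs_def] by measurable
  define e where "e = (\<integral>\<^sup>+A. w A \<partial>cpow \<mu> m)"
  have "e \<le> mom \<mu> s m"
    unfolding e_def w_def mom_def by (intro nn_integral_mono) (auto split: split_indicator)
  then have e_fin: "e < \<infinity>" using mom_finite[OF s, of m] by (rule le_less_trans)
  have "e \<noteq> 0"
  proof
    assume "e = 0"
    then have "AE A in cpow \<mu> m. w A = 0"
      unfolding e_def by (subst (asm) nn_integral_0_iff_AE) auto
    with AE_cpow_nonzero have "AE A in cpow \<mu> m. \<epsilon> / C ^ 3 \<le> mnorm A"
      by eventually_elim (auto simp: w_def ennreal_eq_0_iff split: split_indicator_asm)
    with small show False by simp
  qed
  then obtain e' where e': "e = ennreal e'" "0 < e'"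
    using e_fin by (cases e) auto
  define d where "d = p * c powr s * e' / real (Suc K)"
  have d: "0 < d" using c e' by (simp add: d_def)
  show ?thesis
  proof (rule that[OF d])
    fix Z assume Z: "Z \<in> CA" "Z \<noteq> 0" "mnorm Z \<le> C"
    let ?\<psi> = "\<lambda>X::real^'n^'n. indicator {X. mnorm X < \<epsilon>} X * ennreal (mnorm X powr s)"
    let ?z = "c powr s * mnorm Z powr s"
    have "ennreal p * (\<integral>\<^sup>+A. ennreal ?z * w A \<partial>cpow \<mu> m) \<le> of_nat (Suc K) * (\<integral>\<^sup>+Y. ?\<psi> (Y ** Z) \<partial>cpow \<mu> (K + m))"
    proof (rule connecting_nn_integral_le[OF K Z(1,2)])
      fix A :: "real^'n^'n" and k
      show "AE H in cpow \<mu> k. AE J in cpow \<mu> (K - k). c * mnorm A * mnorm Z \<le> mnorm (J ** A ** H ** Z) \<longrightarrow>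
          ennreal ?z * w A \<le> ?\<psi> (J ** A ** H ** Z)"
        using bd[of k]
      proof eventually_elim
        case H: (elim H)
        show ?case
          using bd[of "K - k"]
        proof eventually_elim
          case J: (elim J)
          show ?case
          proof (rule impI)
            assume le: "c * mnorm A * mnorm Z \<le> mnorm (J ** A ** H ** Z)"
            show "ennreal ?z * w A \<le> ?\<psi> (J ** A ** H ** Z)"
            proof (cases "mnorm A < \<epsilon> / C ^ 3")
              case True
              have "mnorm (J ** A ** H ** Z) \<le> mnorm J * mnorm A * mnorm H * mnorm Z"
                by (rule order_trans[OF mnorm_mult_le mult_right_mono[OF mnorm_mult3_le mnorm_nonneg]])
              also have "\<dots> \<le> C * mnorm A * C * C"
                using H J Z C by (intro mult_mono) auto
              also have "\<dots> = C ^ 3 * mnorm A" by (simp add: power3_eq_cube)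
              also have "\<dots> < C ^ 3 * (\<epsilon> / C ^ 3)" using True C by (intro mult_strict_left_mono) auto
              also have "\<dots> = \<epsilon>" using C by simp
              finally have "mnorm (J ** A ** H ** Z) < \<epsilon>" .
              moreover have "(c * mnorm A * mnorm Z) powr s \<le> mnorm (J ** A ** H ** Z) powr s"
                using le c s0 by (intro powr_mono2) auto
              then have "ennreal ?z * ennreal (mnorm A powr s) \<le> ennreal (mnorm (J ** A ** H ** Z) powr s)"
                using c by (subst ennreal_mult[symmetric]) (auto simp: powr_mult ac_simps intro!: ennreal_leI)
              ultimately show ?thesis by (simp add: w_def True)
            qed (simp add: w_def)
          qed
        qed
      qed
    qed measurable
    moreover have "(\<integral>\<^sup>+A. ennreal ?z * w A \<partial>cpow \<mu> m) = ennreal ?z * ennreal e'"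
      unfolding e'(1)[symmetric] e_def by (rule nn_integral_cmult) measurable
    ultimately have "ennreal (p * (?z * e')) \<le> ennreal (real (Suc K)) * (\<integral>\<^sup>+Y. ?\<psi> (Y ** Z) \<partial>cpow \<mu> (K + m))"
      using c e' by (simp add: ennreal_mult[symmetric] ennreal_of_nat_eq_real_of_nat del: of_nat_Suc)
    then have "ennreal (1 / real (Suc K)) * ennreal (p * (?z * e')) \<le>
        ennreal (1 / real (Suc K)) * (ennreal (real (Suc K)) * (\<integral>\<^sup>+Y. ?\<psi> (Y ** Z) \<partial>cpow \<mu> (K + m)))"
      by (rule mult_left_mono) simp
    moreover have "1 / real (Suc K) * (p * (?z * e')) = d * mnorm Z powr s" by (simp add: d_def)
    moreover have "1 / real (Suc K) * real (Suc K) = 1" by simp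
    ultimately show "ennreal d * ennreal (mnorm Z powr s) \<le> (\<integral>\<^sup>+Y. ?\<psi> (Y ** Z) \<partial>cpow \<mu> (K + m))"
      using d c e' by (simp add: mult.assoc[symmetric] ennreal_mult[symmetric] del: of_nat_Suc)
  qed
qed

text \<open>Suppose some product is very small with positive probability. By boundedness, a trajectory that
  once drops below \<open>\<epsilon>'\<close> stays below \<open>\<epsilon>\<close>, so the drops from above \<open>\<epsilon>\<close> to below \<open>\<epsilon>'\<close> at different times
  exclude each other. Each of them carries a fixed proportion of the moment of order \<open>s\<close>, which
  contradicts the finiteness of that moment. Here \<open>W r Z\<close> is the part of the moment \<open>U r Z\<close> of the
  product of \<open>r\<close> blocks, started at \<open>Z\<close>, that is carried by the drops.\<close>

lemma mnorm_bounded_below: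
  assumes bd: "\<And>n. AE H in cpow \<mu> n. mnorm H \<le> C" and C: "1 \<le> C"
    and s: "s \<in> I_set \<mu>" "s < t" and c1: "0 < c1" "\<And>n. ennreal c1 * mom \<mu> s n \<le> mom \<mu> t n"
  obtains \<eta> where "0 < \<eta>" "\<And>n. AE H in cpow \<mu> n. \<eta> \<le> mnorm H"
proof -
  have s0: "0 \<le> s" using s by (simp add: I_set_def)
  obtain \<epsilon> c2 where \<epsilon>: "0 < \<epsilon>" and c2: "0 < c2"
    "\<And>n. ennreal c2 * mom \<mu> s n \<le> (\<integral>\<^sup>+H. indicator {H. \<epsilon> \<le> mnorm H} H * ennreal (mnorm H powr s) \<partial>cpow \<mu> n)"
    by (rule mom_truncated_ge[OF bd C s c1], rule that)
  \<comment> \<open>After a drop below \<open>\<epsilon>'\<close> no continuation returns to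
    \<open>\<epsilon>\<close>, as it multiplies the norm by at most \<open>C\<close>.\<close>
  define \<epsilon>' where "\<epsilon>' = \<epsilon> / C"
  have \<epsilon>': "0 < \<epsilon>'" "C * \<epsilon>' = \<epsilon>" using \<epsilon> C by (auto simp: \<epsilon>'_def)
  have "AE H in cpow \<mu> m. \<epsilon>' / C ^ 3 \<le> mnorm H" for m
  proof (rule ccontr)
    assume small: "\<not> (AE H in cpow \<mu> m. \<epsilon>' / C ^ 3 \<le> mnorm H)"
    obtain K c p where K: "connecting K c p" by (rule connecting_exists)
    define L where "L = K + m"
    obtain c4 where c4: "0 < c4" "\<And>Z. Z \<in> CA \<Longrightarrow> Z \<noteq> 0 \<Longrightarrow> mnorm Z \<le> C \<Longrightarrow>
      ennreal c4 * ennreal (mnorm Z powr s) \<le>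
        (\<integral>\<^sup>+Y. indicator {X. mnorm X < \<epsilon>'} (Y ** Z) * ennreal (mnorm (Y ** Z) powr s) \<partial>cpow \<mu> L)"
      by (rule small_step_ge[OF bd C s(1) K small, folded L_def], rule that)
    obtain c3 where c3: "0 < c3" "\<And>n Z. Z \<in> CA \<Longrightarrow>
      ennreal c3 * mom \<mu> s n * ennreal (mnorm Z powr s) \<le> (\<integral>\<^sup>+G. ennreal (mnorm (G ** Z) powr s) \<partial>cpow \<mu> n)"
      by (rule nn_integral_mult_powr_ge[OF s(1)], rule that)
    obtain a where a: "mom \<mu> s L = ennreal a" "0 < a"
      using mom_finite[OF s(1), of L] mom_pos[of s L] by (cases "mom \<mu> s L") auto
    \<comment> \<open>Share of the full moment carried by a drop at a prescribed time:
      \<open>c2\<close> before the drop, \<open>c4\<close> during it, \<open>c3\<close> after it.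
      Dividing by \<open>a\<close> allows comparison with the moment of the whole product.\<close>
    define c6 where "c6 = c2 * c3 * c4 / a"
    have c6: "0 < c6" "ennreal c2 * ennreal c3 * ennreal c4 = ennreal c6 * ennreal a"
      using c2 c3 c4 a by (auto simp: c6_def ennreal_mult[symmetric])
    define U where "U r Z = (\<integral>\<^sup>+X. ennreal (mnorm (X ** Z) powr s) \<partial>cpow \<mu> (r * L))" for r and Z :: "real^'n^'n"
    have [measurable]: "U r \<in> borel_measurable borel" for r unfolding U_def[abs_def] by measurable
    \<comment> \<open>The first summand is a drop in the next block, followed by \<open>r\<close>
      free blocks; the second passes the count on to the remaining blocks.\<close>
    define W where "W = rec_nat (\<lambda>_. 0) (\<lambda>r w Z.
        indicator {H. \<epsilon> \<le> mnorm H} Z * (\<integral>\<^sup>+Y. indicator {X. mnorm X < \<epsilon>'} (Y ** Z) * U r (Y ** Z) \<partial>cpow \<mu> L)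
        + (\<integral>\<^sup>+Y. w (Y ** Z) \<partial>cpow \<mu> L))"
    have W0: "W 0 Z = 0" for Z :: "real^'n^'n" by (simp add: W_def)
    have WSuc: "W (Suc r) Z = indicator {H. \<epsilon> \<le> mnorm H} Z * (\<integral>\<^sup>+Y. indicator {X. mnorm X < \<epsilon>'} (Y ** Z) * U r (Y ** Z) \<partial>cpow \<mu> L)
        + (\<integral>\<^sup>+Y. W r (Y ** Z) \<partial>cpow \<mu> L)" for r and Z :: "real^'n^'n"
      by (simp add: W_def)
    have [measurable]: "W r \<in> borel_measurable borel" for r
    proof (induction r)
      case 0
      show ?case by (simp add: W0[abs_def])
    next
      case (Suc r)
      note [measurable] = Suc
      show ?case unfolding WSuc[abs_def] by measurable
    qed
    have W_AE: "AE H in cpow \<mu> n. W r (H ** Z) = 0" if Z: "mnorm Z < \<epsilon>'" for r n and Z :: "real^'n^'n"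
    proof (induction r arbitrary: n)
      case 0
      show ?case by (simp add: W0)
    next
      case (Suc r)
      have P: "Measurable.pred borel (\<lambda>H. W r (H ** Z) = 0)" by measurable
      have "AE H in cpow \<mu> n. AE Y in cpow \<mu> L. W r (Y ** H ** Z) = 0"
        using Suc[of "L + n"] unfolding AE_cpow_add'[OF P] .
      with bd[of n] show ?case
      proof eventually_elim
        case (elim H)
        have "mnorm (H ** Z) \<le> C * mnorm Z"
          by (rule order_trans[OF mnorm_mult_le mult_right_mono]) (use elim in auto)
        also have "\<dots> < C * \<epsilon>'" using Z C by (intro mult_strict_left_mono) auto
        finally have "\<not> \<epsilon> \<le> mnorm (H ** Z)" using \<epsilon>' by simp
        moreover have "(\<integral>\<^sup>+Y. W r (Y ** (H ** Z)) \<partial>cpow \<mu> L) = (\<integral>\<^sup>+Y. 0 \<partial>cpow \<mu> L)"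
          by (rule nn_integral_cong_AE, use elim(2) in eventually_elim) (simp add: matrix_mul_assoc)
        ultimately show ?case by (simp add: WSuc)
      qed
    qed
    have W_0: "W r Z = 0" if Z: "mnorm Z < \<epsilon>'" for r and Z :: "real^'n^'n"
    proof -
      have P: "Measurable.pred borel (\<lambda>H. W r (H ** Z) = 0)" by measurable
      from W_AE[OF Z, of r 0] show ?thesis
        unfolding cpow.simps(1) by (subst (asm) AE_return[OF _ P]) simp_all
    qed
    \<comment> \<open>Disjointness of the drops is used here: \<open>W r\<close> vanishes wherever
      the indicator of a drop is 1, so the two summands together never exceed
      \<open>U\<close>.\<close>
    have W_le_U: "W r Z \<le> U r Z" for r and Z :: "real^'n^'n"
    proof (induction r arbitrary: Z)
      case 0
      show ?case by (simp add: W0)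
    next
      case (Suc r)
      have "W (Suc r) Z \<le> (\<integral>\<^sup>+Y. indicator {X. mnorm X < \<epsilon>'} (Y ** Z) * U r (Y ** Z) \<partial>cpow \<mu> L) + (\<integral>\<^sup>+Y. W r (Y ** Z) \<partial>cpow \<mu> L)"
        unfolding WSuc by (intro add_right_mono) (auto split: split_indicator)
      also have "\<dots> = (\<integral>\<^sup>+Y. indicator {X. mnorm X < \<epsilon>'} (Y ** Z) * U r (Y ** Z) + W r (Y ** Z) \<partial>cpow \<mu> L)"
        by (rule nn_integral_add[symmetric]) measurable
      also have "\<dots> \<le> (\<integral>\<^sup>+Y. U r (Y ** Z) \<partial>cpow \<mu> L)"
        by (intro nn_integral_mono) (use Suc W_0 in \<open>auto split: split_indicator\<close>)
      also have "\<dots> = (\<integral>\<^sup>+X. ennreal (mnorm (X ** Z) powr s) \<partial>cpow \<mu> (r * L + L))"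
        unfolding U_def by (subst nn_integral_cpow_add') (auto simp: matrix_mul_assoc)
      also have "\<dots> = U (Suc r) Z" by (simp add: U_def add.commute)
      finally show ?case .
    qed
    \<comment> \<open>Here \<open>j\<close> counts the blocks before the starting point. Each of the
      \<open>r\<close> times at which a drop may occur contributes the same share of the moment of
      all \<open>j + r\<close> blocks.\<close>
    have low: "of_nat r * (ennreal c6 * mom \<mu> s ((j + r) * L)) \<le> (\<integral>\<^sup>+Z. W r Z \<partial>cpow \<mu> (j * L))" for r j
    proof (induction r arbitrary: j)
      case 0
      show ?case by simp
    next
      case (Suc r)
      have "mom \<mu> s ((j + Suc r) * L) = mom \<mu> s (r * L + (L + j * L))" by (simp add: algebra_simps)
      also have "\<dots> \<le> mom \<mu> s (r * L) * (mom \<mu> s L * mom \<mu> s (j * L))"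
        by (intro order_trans[OF mom_add_le[OF s0] mult_left_mono] mom_add_le s0) simp
      finally have "ennreal c6 * mom \<mu> s ((j + Suc r) * L) \<le> ennreal c6 * (mom \<mu> s (r * L) * (mom \<mu> s L * mom \<mu> s (j * L)))"
        by (rule mult_left_mono) simp
      also have "\<dots> = (ennreal c6 * ennreal a) * mom \<mu> s (r * L) * mom \<mu> s (j * L)"
        unfolding a(1) by (simp add: ac_simps)
      also have "\<dots> = ennreal c3 * mom \<mu> s (r * L) * ennreal c4 * (ennreal c2 * mom \<mu> s (j * L))"
        unfolding c6(2)[symmetric] by (simp add: ac_simps)
      also have "\<dots> \<le> ennreal c3 * mom \<mu> s (r * L) * ennreal c4 *
          (\<integral>\<^sup>+Z. indicator {H. \<epsilon> \<le> mnorm H} Z * ennreal (mnorm Z powr s) \<partial>cpow \<mu> (j * L))"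
        by (intro mult_left_mono c2) simp
      also have "\<dots> = (\<integral>\<^sup>+Z. ennreal c3 * mom \<mu> s (r * L) * ennreal c4 *
          (indicator {H. \<epsilon> \<le> mnorm H} Z * ennreal (mnorm Z powr s)) \<partial>cpow \<mu> (j * L))"
        by (rule nn_integral_cmult[symmetric]) measurable
      also have "\<dots> \<le> (\<integral>\<^sup>+Z. indicator {H. \<epsilon> \<le> mnorm H} Z *
          (\<integral>\<^sup>+Y. indicator {X. mnorm X < \<epsilon>'} (Y ** Z) * U r (Y ** Z) \<partial>cpow \<mu> L) \<partial>cpow \<mu> (j * L))"
      proof (rule nn_integral_mono_AE, use bd[of "j * L"] AE_cpow_CA[of "j * L"] AE_cpow_nonzero[of "j * L"] in eventually_elim)
        case (elim Z)
        have "ennreal c3 * mom \<mu> s (r * L) * (ennreal c4 * ennreal (mnorm Z powr s)) \<le>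
            ennreal c3 * mom \<mu> s (r * L) *
            (\<integral>\<^sup>+Y. indicator {X. mnorm X < \<epsilon>'} (Y ** Z) * ennreal (mnorm (Y ** Z) powr s) \<partial>cpow \<mu> L)"
          by (intro mult_left_mono c4 elim) simp
        also have "\<dots> = (\<integral>\<^sup>+Y. ennreal c3 * mom \<mu> s (r * L) *
            (indicator {X. mnorm X < \<epsilon>'} (Y ** Z) * ennreal (mnorm (Y ** Z) powr s)) \<partial>cpow \<mu> L)"
          by (rule nn_integral_cmult[symmetric]) measurable
        also have "\<dots> \<le> (\<integral>\<^sup>+Y. indicator {X. mnorm X < \<epsilon>'} (Y ** Z) * U r (Y ** Z) \<partial>cpow \<mu> L)"
        proof (rule nn_integral_mono_AE, use AE_cpow_CA[of L] in eventually_elim)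
          case (elim Y)
          have "ennreal c3 * mom \<mu> s (r * L) * ennreal (mnorm (Y ** Z) powr s) \<le> U r (Y ** Z)"
            unfolding U_def by (intro c3 CA_mult elim \<open>Z \<in> CA\<close>)
          then show ?case by (auto split: split_indicator)
        qed
        finally show ?case by (auto simp: mult.assoc split: split_indicator)
      qed
      finally have 1: "ennreal c6 * mom \<mu> s ((j + Suc r) * L) \<le> \<dots>" .
      have "of_nat r * (ennreal c6 * mom \<mu> s ((j + Suc r) * L)) \<le> (\<integral>\<^sup>+Z. W r Z \<partial>cpow \<mu> (Suc j * L))"
        using Suc[of "Suc j"] by simp
      also have "\<dots> = (\<integral>\<^sup>+Z. \<integral>\<^sup>+Y. W r (Y ** Z) \<partial>cpow \<mu> L \<partial>cpow \<mu> (j * L))"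
        using nn_integral_cpow_add'[of "W r" L "j * L"] by simp
      finally have 2: "of_nat r * (ennreal c6 * mom \<mu> s ((j + Suc r) * L)) \<le> \<dots>" .
      have "of_nat (Suc r) * (ennreal c6 * mom \<mu> s ((j + Suc r) * L)) =
          ennreal c6 * mom \<mu> s ((j + Suc r) * L) + of_nat r * (ennreal c6 * mom \<mu> s ((j + Suc r) * L))"
        by (simp add: distrib_right)
      also have "\<dots> \<le> (\<integral>\<^sup>+Z. W (Suc r) Z \<partial>cpow \<mu> (j * L))"
        unfolding WSuc by (subst nn_integral_add, measurable) (intro add_mono 1 2)
      finally show ?case .
    qed
    have "real r * c6 \<le> 1" for r
    proof -
      obtain b where b: "mom \<mu> s (r * L) = ennreal b" "0 < b"
        using mom_finite[OF s(1), of "r * L"] mom_pos[of s "r * L"] by (cases "mom \<mu> s (r * L)") auto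
      have "of_nat r * (ennreal c6 * mom \<mu> s (r * L)) \<le> (\<integral>\<^sup>+Z. W r Z \<partial>cpow \<mu> 0)"
        using low[of r 0] by simp
      also have "\<dots> = W r (mat 1)" by (rule nn_integral_cpow_0) measurable
      also have "\<dots> \<le> U r (mat 1)" by (rule W_le_U)
      also have "\<dots> = mom \<mu> s (r * L)" by (simp add: U_def mom_def)
      finally have "real r * (c6 * b) \<le> b"
        using b c6 by (simp add: ennreal_of_nat_eq_real_of_nat ennreal_mult[symmetric])
      then show ?thesis using b by (simp add: mult.assoc[symmetric])
    qed
    moreover obtain r where "1 / c6 < real r" using reals_Archimedean2 by blast
    ultimately show False using c6 by (metis divide_less_eq not_le)
  qed
  then show ?thesis using \<epsilon>' C by (intro that[of "\<epsilon>' / C ^ 3"]) auto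
qed

end

section \<open>Proximal matrices\<close>

lemma poly_det: "poly (det (M :: complex poly^'n^'n)) x = det (\<chi> i j. poly (M $ i $ j) x)"
  unfolding det_def by (simp add: poly_sum poly_prod)

lemma det_const_poly: "det (\<chi> i j. [:P $ i $ j:]) = [:det (P :: complex^'n^'n):]"
proof -
  have s: "(\<Sum>x\<in>S. [:f x:]) = [:\<Sum>x\<in>S. f x:]" for S :: "('n \<Rightarrow> 'n) set" and f :: "_ \<Rightarrow> complex"
    by (induction S rule: infinite_finite_induct) auto
  have p: "(\<Prod>x\<in>S. [:f x:]) = [:\<Prod>x\<in>S. f x:]" for S :: "'n set" and f :: "_ \<Rightarrow> complex"
    by (induction S rule: infinite_finite_induct) (auto simp: one_pCons)
  show ?thesis unfolding det_def by (simp add: p s of_int_poly mult.commute)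
qed

text \<open>A vanishing characteristic polynomial would make every number an eigenvalue, also one of
  larger modulus than \<open>z\<close>. Nonvanishing is what turns divisibility by a power of a
  linear factor into a bound on \<open>order\<close>.\<close>

lemma charpoly_ne_0:
  assumes "dominant_eigenvalue A z"
  shows "charpoly A \<noteq> 0"
proof
  assume 0: "charpoly A = 0"
  define x where "x = complex_of_real (cmod z + 1)"
  have x: "cmod z < cmod x" by (simp add: x_def del: of_real_add)
  let ?M = "(\<chi> i j. (if i = j then x else 0) - complexify A $ i $ j) :: complex^'a^'a"
  have "det ?M = poly (charpoly A) x"
    unfolding charpoly_def poly_det by (intro arg_cong[where f = det]) (simp add: vec_eq_iff)
  with 0 have "det ?M = 0" by simp
  then have "\<not> invertible ?M" by (simp add: invertible_det_nz)
  then obtain v where v: "?M *v v = 0" "v \<noteq> 0"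
    using invertible_left_inverse matrix_left_invertible_ker by blast
  have "?M *v v = x *s v - complexify A *v v"
  proof (subst vec_eq_iff, rule allI)
    fix i
    have "(?M *v v) $ i = (\<Sum>j\<in>UNIV. (if i = j then x * v $ j else 0) - complexify A $ i $ j * v $ j)"
      unfolding matrix_vector_mult_def by (auto simp: left_diff_distrib intro!: sum.cong)
    also have "\<dots> = x * v $ i - (\<Sum>j\<in>UNIV. complexify A $ i $ j * v $ j)"
      by (simp add: sum_subtractf)
    finally show "(?M *v v) $ i = (x *s v - complexify A *v v) $ i"
      by (simp add: matrix_vector_mult_def)
  qed
  with v have "is_eigenvalue A x" unfolding is_eigenvalue_def by (intro exI[of _ v]) auto
  with x assms show False unfolding dominant_eigenvalue_def by (cases "x = z") auto
qed

text \<open>Replacing two columns of the identity matrix by the eigenvectors \<open>v\<close> and \<open>w\<close> produces two columns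
  divisible by \<open>X - z\<close> in the characteristic matrix.\<close>

lemma simple_eigenspace:
  fixes A :: "real^'n^'n"
  assumes dom: "dominant_eigenvalue A z" and ord: "order z (charpoly A) = 1"
    and v: "complexify A *v v = z *s v" and w: "complexify A *v w = z *s w"
  shows "v $ i * w $ j = v $ j * w $ i"
proof (rule ccontr)
  assume ne: "v $ i * w $ j \<noteq> v $ j * w $ i"
  then have ij: "i \<noteq> j" by auto
  define P :: "complex^'n^'n" where "P = (\<chi> k l. if l = i then v $ k else if l = j then w $ k else if k = l then 1 else 0)"
  have "x = 0" if x: "P *v x = 0" for x
  proof -
    have Pk: "v $ k * x $ i + w $ k * x $ j + (if k = i \<or> k = j then 0 else x $ k) = 0" for k
    proof -
      have "(P *v x) $ k = (\<Sum>l\<in>UNIV. (if l = i then v $ k * x $ i else 0) + (if l = j then w $ k * x $ j else 0)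
          + (if l = k then (if k = i \<or> k = j then 0 else x $ k) else 0))"
        unfolding matrix_vector_mult_def P_def using ij by (auto intro!: sum.cong)
      also have "\<dots> = v $ k * x $ i + w $ k * x $ j + (if k = i \<or> k = j then 0 else x $ k)"
        by (simp add: sum.distrib)
      finally show ?thesis using x by simp
    qed
    have 1: "v $ i * x $ i + w $ i * x $ j = 0" "v $ j * x $ i + w $ j * x $ j = 0"
      using Pk[of i] Pk[of j] by auto
    have "(v $ i * w $ j - v $ j * w $ i) * x $ i = w $ j * (v $ i * x $ i + w $ i * x $ j) - w $ i * (v $ j * x $ i + w $ j * x $ j)"
      "(v $ i * w $ j - v $ j * w $ i) * x $ j = v $ i * (v $ j * x $ i + w $ j * x $ j) - v $ j * (v $ i * x $ i + w $ i * x $ j)"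
      by (simp_all add: algebra_simps)
    then have xij: "x $ i = 0" "x $ j = 0" using ne unfolding 1 by auto
    then have "x $ k = 0" for k using Pk[of k] by (auto split: if_splits)
    then show ?thesis by (simp add: vec_eq_iff)
  qed
  then have "invertible P"
    using invertible_left_inverse matrix_left_invertible_ker by blast
  then have dP: "det P \<noteq> 0" by (simp add: invertible_det_nz)
  define X :: "complex poly^'n^'n" where "X = (\<chi> i j. (if i = j then [:0, 1:] else 0) - [:complexify A $ i $ j:])"
  define PP :: "complex poly^'n^'n" where "PP = (\<chi> i j. [:P $ i $ j:])"
  \<comment> \<open>Transposed, because the factors are pulled out of rows.\<close>
  define Q where "Q = transpose (X ** PP)"
  let ?c = "[:- z, 1:]"
  have XP: "(X ** PP) $ k $ l = [:0, P $ k $ l:] - [:(\<Sum>m\<in>UNIV. complexify A $ k $ m * P $ m $ l):]" for k l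
  proof -
    have s: "(\<Sum>x\<in>S. [:f x:]) = [:\<Sum>x\<in>S. f x:]" for S :: "'n set" and f :: "_ \<Rightarrow> complex"
      by (induction S rule: infinite_finite_induct) auto
    have "(X ** PP) $ k $ l = (\<Sum>m\<in>UNIV. (if m = k then [:0, P $ k $ l:] else 0) - [:complexify A $ k $ m * P $ m $ l:])"
      unfolding matrix_matrix_mult_def X_def PP_def by (auto simp: left_diff_distrib intro!: sum.cong)
    also have "\<dots> = [:0, P $ k $ l:] - (\<Sum>m\<in>UNIV. [:complexify A $ k $ m * P $ m $ l:])"
      by (simp add: sum_subtractf)
    finally show ?thesis by (simp only: s)
  qed
  have Qi: "Q $ i = ?c *s (\<chi> k. [:v $ k:])"
  proof -
    have "(\<Sum>m\<in>UNIV. complexify A $ k $ m * P $ m $ i) = z * v $ k" for k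
      using arg_cong[OF v, of "\<lambda>x. x $ k"] by (simp add: P_def matrix_vector_mult_def)
    then show ?thesis
      by (simp add: vec_eq_iff Q_def transpose_def XP) (simp add: P_def)
  qed
  have Qj: "Q $ j = ?c *s (\<chi> k. [:w $ k:])"
  proof -
    have "(\<Sum>m\<in>UNIV. complexify A $ k $ m * P $ m $ j) = z * w $ k" for k
      using arg_cong[OF w, of "\<lambda>x. x $ k"] ij by (simp add: P_def matrix_vector_mult_def)
    then show ?thesis using ij
      by (simp add: vec_eq_iff Q_def transpose_def XP) (simp add: P_def)
  qed
  define R1 where "R1 = (\<chi> m. if m = i then (\<chi> k. [:v $ k:]) else Q $ m)"
  define R2 where "R2 = (\<chi> m. if m = j then (\<chi> k. [:w $ k:]) else R1 $ m)"
  have "Q = (\<chi> m. if m = i then ?c *s (\<chi> k. [:v $ k:]) else Q $ m)"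
    by (simp add: vec_eq_iff[of Q] Qi)
  then have "det Q = ?c * det R1"
    unfolding R1_def using det_row_mul[of i ?c "\<lambda>_. \<chi> k. [:v $ k:]" "\<lambda>m. Q $ m"] by simp
  also have "R1 = (\<chi> m. if m = j then ?c *s (\<chi> k. [:w $ k:]) else R1 $ m)"
    by (subst vec_eq_iff, rule allI) (use ij in \<open>simp add: R1_def Qj\<close>)
  then have "det R1 = ?c * det R2"
    unfolding R2_def using det_row_mul[of j ?c "\<lambda>_. \<chi> k. [:w $ k:]" "\<lambda>m. R1 $ m"] by simp
  finally have "det Q = ?c ^ 2 * det R2" by (simp only: power2_eq_square mult.assoc)
  moreover have "det Q = charpoly A * [:det P:]"
    unfolding Q_def det_transpose det_mul by (simp add: X_def charpoly_def PP_def det_const_poly)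
  ultimately have "?c ^ 2 dvd charpoly A * [:det P:]" by simp
  also have "charpoly A * [:det P:] = smult (det P) (charpoly A)" by simp
  finally have "?c ^ 2 dvd charpoly A" using dP by (simp add: dvd_smult_iff)
  then have "2 \<le> order z (charpoly A)"
    using charpoly_ne_0[OF dom] by (simp only: order_divides) simp
  with ord show False by simp
qed

text \<open>\<open>app p v\<close> is \<open>p(M) v\<close>, and \<open>W\<close> is an invariant
  complex subspace given by its closure properties. Linear factors of \<open>p\<close> are split off
  one by one; as soon as removing a factor \<open>X - l\<close> leaves a nonzero vector, that vector
  is annihilated by \<open>M - l\<close>.\<close>

lemma eigenvector_if_annihilated:
  fixes M :: "complex^'n^'n"
  assumes W: "\<And>x y. x \<in> W \<Longrightarrow> y \<in> W \<Longrightarrow> x + y \<in> W" "\<And>c x. x \<in> W \<Longrightarrow> c *s x \<in> W" "\<And>x. x \<in> W \<Longrightarrow> M *v x \<in> W"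
  defines "app \<equiv> \<lambda>p v. \<Sum>i\<le>degree p. coeff p i *s (((*v) M ^^ i) v)"
  assumes v: "v \<in> W" "v \<noteq> 0" and p: "p \<noteq> 0" "app p v = 0"
  obtains x l where "x \<in> W" "x \<noteq> 0" "M *v x = l *s x"
proof -
  have iter: "((*v) M ^^ i) v \<in> W" for i by (induction i) (auto intro: v W)
  have W0: "0 \<in> W" using W(2)[OF v(1), of 0] by simp
  have appW: "app q v \<in> W" for q
  proof -
    have "(\<Sum>i\<in>S. coeff q i *s (((*v) M ^^ i) v)) \<in> W" for S
      by (induction S rule: infinite_finite_induct) (auto intro: W W0 iter)
    then show ?thesis unfolding app_def .
  qed
  have app_eq: "app q v = (\<Sum>i\<le>n. coeff q i *s (((*v) M ^^ i) v))" if "degree q \<le> n" for q n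
    unfolding app_def using that
    by (intro sum.mono_neutral_left) (auto simp: coeff_eq_0)
  have app_root: "app ([:- l, 1:] * q) v = M *v app q v - l *s app q v" for l q
  proof -
    define n where "n = degree q"
    let ?x = "\<lambda>i. ((*v) M ^^ i) v"
    have "[:- l, 1:] * q = pCons 0 q - smult l q" by (simp add: algebra_simps)
    moreover have "degree (pCons 0 q - smult l q) \<le> Suc n"
      unfolding n_def by (intro degree_diff_le) (auto simp: degree_pCons_le le_SucI degree_smult_le)
    ultimately have "app ([:- l, 1:] * q) v = (\<Sum>i\<le>Suc n. (coeff (pCons 0 q) i - l * coeff q i) *s ?x i)"
      by (subst app_eq[of _ "Suc n"]) auto
    also have "\<dots> = (\<Sum>i\<le>Suc n. coeff (pCons 0 q) i *s ?x i) - (\<Sum>i\<le>Suc n. (l * coeff q i) *s ?x i)"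
      by (simp add: vec.scale_left_diff_distrib sum_subtractf)
    also have "(\<Sum>i\<le>Suc n. coeff (pCons 0 q) i *s ?x i) = (\<Sum>i\<le>n. coeff q i *s ?x (Suc i))"
      by (subst sum.atMost_Suc_shift) simp
    also have "\<dots> = M *v app q v"
      unfolding app_def n_def by (simp add: vec.linear_sum matrix_vector_mult_scaleR vec.linear_scale vector_scalar_commute matrix_vector_mul_linear_gen)
    also have "(\<Sum>i\<le>Suc n. (l * coeff q i) *s ?x i) = l *s app q v"
      unfolding n_def by (subst app_eq[of q "Suc (degree q)"]) (auto simp: vec.scale_sum_right simp del: sum.atMost_Suc)
    finally show ?thesis .
  qed
  have "\<exists>x\<in>W. \<exists>l. x \<noteq> 0 \<and> M *v x = l *s x" using p
  proof (induction "degree p" arbitrary: p rule: less_induct)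
    case less
    show ?case
    proof (cases "degree p = 0")
      case True
      then obtain c where "p = [:c:]" by (metis degree_eq_zeroE)
      with less.prems v show ?thesis by (auto simp: app_def)
    next
      case False
      then obtain l where l: "poly p l = 0"
        using fundamental_theorem_of_algebra[of p] constant_degree[of p] by auto
      then obtain q where q: "p = [:- l, 1:] * q" by (metis dvdE poly_eq_0_iff_dvd)
      have q0: "q \<noteq> 0" using q less.prems by auto
      have deg: "degree q < degree p" unfolding q using q0 by (subst degree_mult_eq) auto
      show ?thesis
      proof (cases "app q v = 0")
        case True
        then show ?thesis using less.hyps[OF deg q0] by blast
      next
        case False
        then show ?thesis
          using less.prems app_root[of l q] appW[of q] unfolding q
          by (intro bexI[of _ "app q v"] exI[of _ l]) auto
      qed
    qed
  qed
  then show ?thesis using that by blast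
qed

text \<open>More than \<open>DIM(complex^'n)\<close> iterates of \<open>v\<close> are linearly
  dependent, even over the reals, and a relation between them is an annihilating polynomial.\<close>

lemma eigenvector_in_invariant_set:
  fixes M :: "complex^'n^'n"
  assumes W: "\<And>x y. x \<in> W \<Longrightarrow> y \<in> W \<Longrightarrow> x + y \<in> W" "\<And>c x. x \<in> W \<Longrightarrow> c *s x \<in> W" "\<And>x. x \<in> W \<Longrightarrow> M *v x \<in> W"
    and v: "v \<in> W" "v \<noteq> 0"
  obtains x l where "x \<in> W" "x \<noteq> 0" "M *v x = l *s x"
proof -
  let ?x = "\<lambda>i. ((*v) M ^^ i) v"
  have "\<exists>p. p \<noteq> 0 \<and> (\<Sum>i\<le>degree p. coeff p i *s ?x i) = 0"
  proof -
    define d where "d = DIM(complex^'n)"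
    have "\<exists>c::nat \<Rightarrow> real. (\<exists>i\<le>d. c i \<noteq> 0) \<and> (\<Sum>i\<le>d. complex_of_real (c i) *s ?x i) = 0"
    proof (cases "inj_on ?x {..d}")
      case True
      have card: "card (?x ` {..d}) = Suc d" by (simp add: card_image[OF True])
      have "dependent (?x ` {..d})"
      proof (rule dependent_biggerset)
        assume "finite (?x ` {..d})"
        show "DIM(complex^'n) < card (?x ` {..d})" unfolding card by (simp only: d_def lessI)
      qed
      then obtain u where u: "\<exists>y\<in>?x ` {..d}. u y \<noteq> 0" "(\<Sum>y\<in>?x ` {..d}. u y *\<^sub>R y) = 0"
        by (auto simp: dependent_finite)
      have "(\<Sum>i\<le>d. u (?x i) *\<^sub>R ?x i) = 0"
        using u(2) by (subst (asm) sum.reindex[OF True]) (simp add: o_def)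
      moreover have "u y *\<^sub>R y = complex_of_real (u y) *s y" for y
        by (simp only: vec_eq_iff vector_scaleR_component vector_smult_component scaleR_conv_of_real[where 'a=complex]) simp
      ultimately show ?thesis using u(1) by (intro exI[of _ "\<lambda>i. u (?x i)"]) auto
    next
      \<comment> \<open>\<open>dependent\<close> speaks of sets, so a coincidence of two iterates is
        treated separately.\<close>
      case False
      then obtain i j where ij: "i \<le> d" "j \<le> d" "i \<noteq> j" "?x i = ?x j" by (auto simp: inj_on_def)
      define c :: "nat \<Rightarrow> real" where "c k = (if k = i then 1 else 0) - (if k = j then 1 else 0)" for k
      have "complex_of_real (c k) *s ?x k = (if k = i then ?x i else 0) - (if k = j then ?x j else 0)" for k
        by (simp add: c_def)
      then have "(\<Sum>k\<le>d. complex_of_real (c k) *s ?x k) = ?x i - ?x j"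
        using ij by (simp add: sum_subtractf)
      moreover have "c i \<noteq> 0" using ij by (simp add: c_def)
      ultimately show ?thesis using ij by auto
    qed
    then obtain c i where c: "i \<le> d" "c i \<noteq> 0" "(\<Sum>i\<le>d. complex_of_real (c i) *s ?x i) = 0" by blast
    define p where "p = Poly (map (\<lambda>i. complex_of_real (c i)) [0..<Suc d])"
    have co: "coeff p k = (if k \<le> d then complex_of_real (c k) else 0)" for k
      by (simp add: p_def nth_default_def del: upt_Suc)
    then have "p \<noteq> 0" using c by (metis coeff_0 of_real_eq_0_iff)
    moreover have "degree p \<le> d" by (rule degree_le) (simp add: co)
    then have "(\<Sum>i\<le>degree p. coeff p i *s ?x i) = (\<Sum>i\<le>d. coeff p i *s ?x i)"
      by (intro sum.mono_neutral_left) (auto simp: coeff_eq_0)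
    then have "(\<Sum>i\<le>degree p. coeff p i *s ?x i) = 0" using c(3) by (simp add: co)
    ultimately show ?thesis by blast
  qed
  then obtain p where p: "p \<noteq> 0" "(\<Sum>i\<le>degree p. coeff p i *s ?x i) = 0" by blast
  show ?thesis
    by (rule eigenvector_if_annihilated[of W M v p]) (use W v p that in auto)
qed

section \<open>Rank-one elements of bounded semigroups\<close>

primrec mpow :: "real^'n^'n \<Rightarrow> nat \<Rightarrow> real^'n^'n" where
  "mpow A 0 = mat 1"
| "mpow A (Suc n) = A ** mpow A n"

lemma mpow_add: "mpow A (m + n) = mpow A m ** mpow A n"
  by (induction m) (simp_all add: matrix_mul_assoc)

lemma mpow_commute: "mpow A n ** A = A ** mpow A n"
  by (induction n) (simp_all add: matrix_mul_assoc[symmetric])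

lemma tendsto_matrix_mult [tendsto_intros]:
  fixes f :: "'a \<Rightarrow> real^'n^'m" and g :: "'a \<Rightarrow> real^'k^'n"
  assumes "(f \<longlongrightarrow> A) F" "(g \<longlongrightarrow> B) F"
  shows "((\<lambda>x. f x ** g x) \<longlongrightarrow> A ** B) F"
  unfolding matrix_matrix_mult_def
  by (intro tendsto_vec_lambda tendsto_sum tendsto_mult tendsto_vec_nth assms)

lemma tendsto_matrix_vector_mult [tendsto_intros]:
  fixes f :: "'a \<Rightarrow> real^'n^'m" and g :: "'a \<Rightarrow> real^'n"
  assumes "(f \<longlongrightarrow> A) F" "(g \<longlongrightarrow> B) F"
  shows "((\<lambda>x. f x *v g x) \<longlongrightarrow> A *v B) F"
  unfolding matrix_vector_mult_def
  by (intro tendsto_vec_lambda tendsto_sum tendsto_mult tendsto_vec_nth assms)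

lemma tendsto_mnorm [tendsto_intros]: "(f \<longlongrightarrow> A) F \<Longrightarrow> ((\<lambda>x. mnorm (f x)) \<longlongrightarrow> mnorm A) F"
  by (rule continuous_on_tendsto_compose[of UNIV mnorm]) (auto intro: continuous_on_mnorm continuous_on_id)

definition outer :: "real^'n \<Rightarrow> real^'n \<Rightarrow> real^'n^'n" where
  "outer u f = (\<chi> i j. u $ i * f $ j)"

lemma mult_outer: "A ** outer u f = outer (A *v u) f"
  by (simp add: outer_def matrix_matrix_mult_def matrix_vector_mult_def vec_eq_iff sum_distrib_right mult.assoc)

lemma outer_mult_vector: "outer u f *v x = (f \<bullet> x) *\<^sub>R u"
  by (simp add: outer_def matrix_vector_mult_def vec_eq_iff inner_vec_def sum_distrib_left mult_ac)

lemma outer_scaleR_left: "outer (c *\<^sub>R u) f = c *\<^sub>R outer u f"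
  by (simp add: outer_def vec_eq_iff)

lemma outer_if_minors_0:
  assumes "\<And>i j k l. B $ i $ k * B $ j $ l = B $ j $ k * B $ i $ l" "B \<noteq> 0"
  obtains u f where "B = outer u f"
proof -
  obtain i0 k0 where 0: "B $ i0 $ k0 \<noteq> 0" using assms(2) by (auto simp: vec_eq_iff)
  have "B = outer (\<chi> i. B $ i $ k0) (\<chi> l. B $ i0 $ l / B $ i0 $ k0)"
    using 0 assms(1) by (auto simp: outer_def vec_eq_iff field_simps)
  then show ?thesis by (rule that)
qed

lemma strictly_positive_mult_vector_pos:
  assumes "strictly_positive_matrix A" "\<And>i. 0 \<le> x $ i" "x \<noteq> 0"
  shows "0 < (A *v x) $ i"
proof -
  obtain j where "x $ j \<noteq> 0" using assms(3) by (auto simp: vec_eq_iff)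
  then have j: "0 < x $ j" using assms(2)[of j] by simp
  show ?thesis unfolding matrix_vector_mult_def vec_lambda_beta
    by (rule sum_pos2[of _ j]) (use assms j in \<open>auto simp: strictly_positive_matrix_def intro!: mult_nonneg_nonneg intro: less_imp_le\<close>)
qed

text \<open>With \<open>t\<close> the largest ratio of coordinates, \<open>t *\<^sub>R u - v\<close>
  is nonnegative, has a zero coordinate and is fixed by \<open>E\<close>; if it were nonzero,
  \<open>E\<close> would make all its coordinates positive.\<close>

lemma perron_unique:
  fixes E :: "real^'n^'n"
  assumes E: "strictly_positive_matrix E" "E *v u = u" "\<And>i. 0 < u $ i" "E *v v = v"
  obtains t where "v = t *\<^sub>R u"
proof -
  define t where "t = Max (range (\<lambda>i. v $ i / u $ i))"
  have le: "v $ i / u $ i \<le> t" for i unfolding t_def by (intro Max_ge) auto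
  have "t \<in> range (\<lambda>i. v $ i / u $ i)" unfolding t_def by (intro Max_in) auto
  then obtain k where k: "t = v $ k / u $ k" by auto
  define w where "w = t *\<^sub>R u - v"
  have Ew: "E *v w = w"
    by (simp add: w_def matrix_vector_mult_diff_distrib matrix_vector_mult_scaleR E)
  have w0: "0 \<le> w $ i" for i using le[of i] E(3)[of i] by (simp add: w_def field_simps)
  have wk: "w $ k = 0" using k E(3)[of k] by (simp add: w_def)
  have "w = 0"
  proof (rule ccontr)
    assume "w \<noteq> 0"
    from strictly_positive_mult_vector_pos[OF E(1) w0 this, of k] show False by (simp add: Ew wk)
  qed
  then show ?thesis by (intro that[of t]) (simp add: w_def)
qed

lemma complexify_mult: "complexify (A ** B) = complexify A ** complexify B"
  by (simp add: complexify_def matrix_matrix_mult_def vec_eq_iff)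

lemma complexify_mpow: "complexify (mpow A n) *v x = ((*v) (complexify A) ^^ n) x"
proof (induction n)
  case 0
  have "complexify (mat 1 :: real^'a^'a) = mat 1" by (simp add: complexify_def mat_def vec_eq_iff)
  then show ?case by simp
next
  case (Suc n)
  have "complexify (mpow A (Suc n)) *v x = complexify A *v (complexify (mpow A n) *v x)"
    by (simp add: complexify_mult matrix_vector_mul_assoc)
  with Suc show ?case by simp
qed

lemma norm_complexify_vector_component_le:
  "cmod ((complexify A *v x) $ i) \<le> mnorm A * (\<Sum>k\<in>UNIV. cmod (x $ k))"
proof -
  have "cmod ((complexify A *v x) $ i) \<le> (\<Sum>k\<in>UNIV. cmod (complexify A $ i $ k * x $ k))"
    by (simp add: matrix_vector_mult_def) (rule norm_sum)
  also have "\<dots> \<le> (\<Sum>k\<in>UNIV. mnorm A * cmod (x $ k))"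
    by (intro sum_mono) (auto simp: complexify_def norm_mult mnorm_def intro!: mult_right_mono matrix_component_le_onorm)
  finally show ?thesis by (simp add: sum_distrib_left)
qed

section \<open>Closed matrix semigroups bounded away from zero and infinity\<close>

locale bounded_semigroup =
  fixes T :: "(real^'n^'n) set" and \<eta> C :: real
  assumes closed_T: "closed T" and T_mult: "\<And>A B. A \<in> T \<Longrightarrow> B \<in> T \<Longrightarrow> A ** B \<in> T"
    and \<eta>_pos: "0 < \<eta>" and T_ge: "\<And>A. A \<in> T \<Longrightarrow> \<eta> \<le> mnorm A" and T_le: "\<And>A. A \<in> T \<Longrightarrow> mnorm A \<le> C"
begin

lemma T_nonzero: "A \<in> T \<Longrightarrow> A \<noteq> 0"
  using T_ge[of A] \<eta>_pos by auto

lemma compact_T: "compact T"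
proof -
  have "bounded T"
  proof (rule boundedI)
    fix A assume "A \<in> T"
    then show "norm A \<le> real CARD('n) * real CARD('n) * C"
      by (intro order_trans[OF norm_le_mnorm mult_left_mono[OF T_le]]) auto
  qed
  then show ?thesis using closed_T by (simp add: compact_eq_bounded_closed)
qed

lemma T_subseq:
  assumes "\<And>n. X n \<in> T"
  obtains B r where "B \<in> T" "strict_mono (r :: nat \<Rightarrow> nat)" "(\<lambda>n. X (r n)) \<longlonglongrightarrow> B"
  using compact_T[unfolded compact_def] assms that by (force simp: o_def)

lemma mpow_in_T: "A \<in> T \<Longrightarrow> 1 \<le> n \<Longrightarrow> mpow A n \<in> T"
proof (induction n)
  case (Suc n)
  then show ?case by (cases "n = 0") (auto intro: T_mult)
qed simp

lemma mnorm_mpow_le: "A \<in> T \<Longrightarrow> mnorm (mpow A n) \<le> max C 1"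
  using T_le[OF mpow_in_T[of A n]] by (cases "n = 0") auto

text \<open>Powers converge along a subsequence \<open>\<phi>\<close>. Comparing its terms at
  \<open>j + j\<close> and at \<open>j\<close> gives exponents \<open>m j\<close> along which the
  powers of \<open>A\<close> act on \<open>B\<close> as the identity in the limit; doubling the
  index makes these exponents tend to infinity.\<close>

lemma power_limit:
  assumes A: "A \<in> T"
  obtains B \<phi> m where "B \<in> T" "\<And>j. 1 \<le> \<phi> j" "(\<lambda>j. mpow A (\<phi> j)) \<longlonglongrightarrow> B"
    "\<And>j. j \<le> m j" "(\<lambda>j. mpow A (m j) ** B) \<longlonglongrightarrow> B"
proof -
  obtain B r where B: "B \<in> T" "strict_mono r" "(\<lambda>n. mpow A (Suc (r n))) \<longlonglongrightarrow> B"
    by (rule T_subseq[of "\<lambda>n. mpow A (Suc n)"]) (rule mpow_in_T[OF A], simp)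
  define \<phi> where "\<phi> j = Suc (r j)" for j
  have lim: "(\<lambda>j. mpow A (\<phi> j)) \<longlonglongrightarrow> B" using B(3) by (simp only: \<phi>_def)
  have mono: "\<phi> j + i \<le> \<phi> (j + i)" for i j
  proof (induction i)
    case (Suc i)
    then show ?case using strict_mono_less[OF B(2), of "j + i" "Suc (j + i)"] by (simp add: \<phi>_def)
  qed simp
  define m where "m j = \<phi> (j + j) - \<phi> j" for j
  have m: "j \<le> m j" "m j + \<phi> j = \<phi> (j + j)" for j using mono[of j j] by (auto simp: m_def)
  have lim2: "(\<lambda>j. mpow A (\<phi> (j + j))) \<longlonglongrightarrow> B"
    by (rule LIMSEQ_subseq_LIMSEQ[OF lim, of "\<lambda>j. j + j", unfolded o_def]) (simp add: strict_mono_def)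
  let ?N = "real CARD('n) * real CARD('n)"
  have "(\<lambda>j. mpow A (m j) ** B - mpow A (\<phi> (j + j))) \<longlonglongrightarrow> 0"
  proof (rule Lim_null_comparison)
    show "\<forall>\<^sub>F j in sequentially. norm (mpow A (m j) ** B - mpow A (\<phi> (j + j))) \<le> ?N * (max C 1 * mnorm (B - mpow A (\<phi> j)))"
    proof (rule always_eventually, rule allI)
      fix j
      have "mpow A (m j) ** B - mpow A (\<phi> (j + j)) = mpow A (m j) ** (B - mpow A (\<phi> j))"
        unfolding m(2)[symmetric] mpow_add
        by (simp add: matrix_matrix_mult_def vec_eq_iff right_diff_distrib sum_subtractf)
      then have "norm (mpow A (m j) ** B - mpow A (\<phi> (j + j))) \<le> ?N * mnorm (mpow A (m j) ** (B - mpow A (\<phi> j)))"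
        using norm_le_mnorm by metis
      also have "\<dots> \<le> ?N * (max C 1 * mnorm (B - mpow A (\<phi> j)))"
        by (intro mult_left_mono order_trans[OF mnorm_mult_le] mult_right_mono mnorm_mpow_le A) auto
      finally show "norm (mpow A (m j) ** B - mpow A (\<phi> (j + j))) \<le> ?N * (max C 1 * mnorm (B - mpow A (\<phi> j)))" .
    qed
    have "(\<lambda>j. ?N * (max C 1 * mnorm (B - mpow A (\<phi> j)))) \<longlonglongrightarrow> ?N * (max C 1 * mnorm (B - B))"
      by (intro tendsto_intros lim)
    then show "(\<lambda>j. ?N * (max C 1 * mnorm (B - mpow A (\<phi> j)))) \<longlonglongrightarrow> 0" by simp
  qed
  from tendsto_add[OF this lim2] have "(\<lambda>j. mpow A (m j) ** B) \<longlonglongrightarrow> B" by simp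
  with B(1) lim m(1) show ?thesis by (intro that[of B \<phi> m]) (auto simp: \<phi>_def)
qed

text \<open>The matrix \<open>X = outer (g *v u) f\<close> satisfies
  \<open>X ** X = c *\<^sub>R X\<close> with \<open>c\<close> the number in question, so its powers
  are multiples of \<open>X\<close> by powers of \<open>c\<close>. They stay between
  \<open>\<eta>\<close> and \<open>C\<close> only if \<open>c\<close> has modulus 1.\<close>

lemma abs_inner_outer_eq_1:
  assumes uf: "outer u f \<in> T" and g: "g \<in> T"
  shows "\<bar>f \<bullet> (g *v u)\<bar> = 1"
proof -
  define c where "c = f \<bullet> (g *v u)"
  define X where "X = outer (g *v u) f"
  have X: "X \<in> T" unfolding X_def mult_outer[symmetric] by (rule T_mult[OF g uf])
  have XX: "X ** X = c *\<^sub>R X"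
    by (simp add: X_def mult_outer outer_mult_vector outer_scaleR_left c_def)
  have pow: "mpow X (Suc n) = c ^ n *\<^sub>R X" for n
  proof (induction n)
    case (Suc n)
    have "mpow X (Suc (Suc n)) = X ** (c ^ n *\<^sub>R X)" using Suc by simp
    also have "\<dots> = c ^ n *\<^sub>R (c *\<^sub>R X)" by (simp only: mult_right_scaleR_matrix XX)
    finally show ?case by (simp add: mult.commute)
  qed simp
  have "mpow X (Suc n) \<in> T" for n by (rule mpow_in_T[OF X]) simp
  then have bounds: "\<eta> \<le> \<bar>c\<bar> ^ n * mnorm X" "\<bar>c\<bar> ^ n * mnorm X \<le> C" for n
    using T_ge[of "mpow X (Suc n)"] T_le[of "mpow X (Suc n)"] by (auto simp: pow mnorm_scaleR power_abs simp del: mpow.simps)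
  have Xpos: "0 < mnorm X" using T_nonzero[OF X] by simp
  have "\<not> \<bar>c\<bar> < 1"
  proof
    assume c1: "\<bar>c\<bar> < 1"
    have "(\<lambda>n. \<bar>c\<bar> ^ n * mnorm X) \<longlonglongrightarrow> 0 * mnorm X"
      by (intro tendsto_intros LIMSEQ_power_zero) (use c1 in simp)
    then have "\<eta> \<le> 0" using bounds(1) by (intro LIMSEQ_le_const) auto
    with \<eta>_pos show False by simp
  qed
  moreover have "\<not> 1 < \<bar>c\<bar>"
  proof
    assume "1 < \<bar>c\<bar>"
    then obtain n where "C / mnorm X < \<bar>c\<bar> ^ n" using real_arch_pow by blast
    then have "C < \<bar>c\<bar> ^ n * mnorm X" using Xpos by (simp add: divide_less_eq)
    with bounds(2)[of n] show False by simp
  qed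
  ultimately show ?thesis unfolding c_def by linarith
qed

text \<open>On the range \<open>W\<close> of a limit \<open>B\<close> of powers, some powers of
  \<open>A\<close> tend to the identity, so no eigenvalue of \<open>A\<close> on \<open>W\<close>
  has modulus below 1, and boundedness excludes modulus above 1. Dominance leaves the single value
  \<open>\<zeta>\<close>, boundedness excludes Jordan blocks, and simplicity of the eigenvalue
  reduces \<open>W\<close> to a line.\<close>

lemma proximal_outer:
  assumes P: "proximal P" and r: "0 < r" and A: "r *\<^sub>R P \<in> T"
  obtains u f where "outer u f \<in> T"
proof -
  obtain z where z: "dominant_eigenvalue P z" "order z (charpoly P) = 1" using P by (auto simp: proximal_def)
  define A where "A = r *\<^sub>R P"
  have AT: "A \<in> T" using A by (simp add: A_def)
  obtain B \<phi> m where B: "B \<in> T" and lim: "(\<lambda>j. mpow A (\<phi> j)) \<longlonglongrightarrow> B"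
    and m: "\<And>j. j \<le> m j" "(\<lambda>j. mpow A (m j) ** B) \<longlonglongrightarrow> B"
    by (rule power_limit[OF AT], rule that)
  have comm: "A ** B = B ** A"
  proof (rule LIMSEQ_unique)
    show "(\<lambda>j. A ** mpow A (\<phi> j)) \<longlonglongrightarrow> A ** B" by (intro tendsto_intros lim)
    show "(\<lambda>j. A ** mpow A (\<phi> j)) \<longlonglongrightarrow> B ** A"
      unfolding mpow_commute[symmetric] by (intro tendsto_intros lim)
  qed
  define M where "M = complexify A"
  define W where "W = range (\<lambda>x. complexify B *v x)"
  let ?it = "\<lambda>n x. ((*v) M ^^ n) x"
  have MP: "M *v x = complex_of_real r *s (complexify P *v x)" for x
    by (simp add: M_def A_def complexify_def matrix_vector_mult_def vec_eq_iff sum_distrib_left mult.assoc)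
  have bound: "cmod (?it n x $ i) \<le> max C 1 * (\<Sum>k\<in>UNIV. cmod (x $ k))" for n x i
  proof -
    have "cmod (?it n x $ i) \<le> mnorm (mpow A n) * (\<Sum>k\<in>UNIV. cmod (x $ k))"
      unfolding M_def complexify_mpow[symmetric] by (rule norm_complexify_vector_component_le)
    also have "\<dots> \<le> max C 1 * (\<Sum>k\<in>UNIV. cmod (x $ k))"
      by (intro mult_right_mono mnorm_mpow_le AT sum_nonneg) auto
    finally show ?thesis .
  qed
  have it_eig: "?it n y = l ^ n *s y" if "M *v y = l *s y" for n y l
    by (induction n) (simp_all add: that vector_smult_assoc vector_scalar_commute mult.commute)
  have eig_le: "cmod l \<le> 1" if y: "M *v y = l *s y" "y \<noteq> 0" for y l
  proof (rule ccontr)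
    assume "\<not> cmod l \<le> 1"
    then have "1 < cmod l" by simp
    obtain i where i: "y $ i \<noteq> 0" using y by (auto simp: vec_eq_iff)
    let ?K = "max C 1 * (\<Sum>k\<in>UNIV. cmod (y $ k))"
    obtain n where "?K / cmod (y $ i) < cmod l ^ n" using real_arch_pow[OF \<open>1 < cmod l\<close>] by blast
    then have "?K < cmod l ^ n * cmod (y $ i)" using i by (simp add: divide_less_eq)
    also have "\<dots> = cmod (?it n y $ i)" by (simp add: it_eig[OF y(1)] norm_mult norm_power)
    also have "\<dots> \<le> ?K" by (rule bound)
    finally show False by simp
  qed
  have W_lim: "(\<lambda>j. ?it (m j) w $ i) \<longlonglongrightarrow> w $ i" if "w \<in> W" for w i
  proof -
    obtain x where x: "w = complexify B *v x" using \<open>w \<in> W\<close> by (auto simp: W_def)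
    have "?it (m j) w = complexify (mpow A (m j) ** B) *v x" for j
      by (simp add: x M_def complexify_mpow[symmetric] complexify_mult matrix_vector_mul_assoc)
    moreover have "(\<lambda>j. (complexify (mpow A (m j) ** B) *v x) $ i) \<longlonglongrightarrow> (complexify B *v x) $ i"
      unfolding complexify_def matrix_vector_mult_def vec_lambda_beta
      by (intro tendsto_intros m(2))
    ultimately show ?thesis by (simp add: x)
  qed
  have W_add: "x + y \<in> W" if "x \<in> W" "y \<in> W" for x y
    using that unfolding W_def by (auto simp: matrix_vector_right_distrib[symmetric])
  have W_scale: "c *s x \<in> W" if xW: "x \<in> W" for c x
  proof -
    from xW obtain y where "x = complexify B *v y" unfolding W_def by (rule rangeE)
    then have "c *s x = complexify B *v (c *s y)" by (simp add: vector_scalar_commute)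
    then show ?thesis unfolding W_def by (rule range_eqI)
  qed
  have W_inv: "M *v x \<in> W" if xW: "x \<in> W" for x
  proof -
    from xW obtain y where "x = complexify B *v y" unfolding W_def by (rule rangeE)
    then have "M *v x = complexify B *v (M *v y)"
      by (simp add: M_def matrix_vector_mul_assoc complexify_mult[symmetric] comm)
    then show ?thesis by (auto simp: W_def)
  qed
  define \<zeta> where "\<zeta> = complex_of_real r * z"
  have eig_W: "l = \<zeta> \<and> cmod l = 1" if y: "y \<in> W" "y \<noteq> 0" "M *v y = l *s y" for y l
  proof -
    obtain i where i: "y $ i \<noteq> 0" using y by (auto simp: vec_eq_iff)
    have "(\<lambda>j. cmod (?it (m j) y $ i)) \<longlonglongrightarrow> cmod (y $ i)" by (intro tendsto_norm W_lim y)
    then have l1: "(\<lambda>j. cmod l ^ m j * cmod (y $ i)) \<longlonglongrightarrow> cmod (y $ i)"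
      by (simp add: it_eig[OF y(3)] norm_mult norm_power)
    have "\<not> cmod l < 1"
    proof
      assume l: "cmod l < 1"
      have "cmod l ^ m j * cmod (y $ i) \<le> cmod l ^ j * cmod (y $ i)" for j
        using l m(1)[of j] by (intro mult_right_mono power_decreasing) auto
      moreover have "(\<lambda>j. cmod l ^ j * cmod (y $ i)) \<longlonglongrightarrow> 0 * cmod (y $ i)"
        using l by (intro tendsto_intros LIMSEQ_power_zero) simp
      ultimately have "cmod (y $ i) \<le> 0 * cmod (y $ i)"
        using l1 by (intro LIMSEQ_le[of "\<lambda>j. cmod l ^ m j * cmod (y $ i)" _ "\<lambda>j. cmod l ^ j * cmod (y $ i)"]) auto
      with i show False by simp
    qed
    with eig_le[OF y(3,2)] have cl: "cmod l = 1" by simp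
    have "complex_of_real r * (complexify P *v y) $ i = l * y $ i" for i
      using arg_cong[OF y(3), of "\<lambda>x. x $ i"] by (simp add: MP)
    then have "complexify P *v y = (l / complex_of_real r) *s y"
      using r by (simp add: vec_eq_iff field_simps)
    then have "is_eigenvalue P (l / complex_of_real r)"
      unfolding is_eigenvalue_def using y(2) by blast
    \<comment> \<open>The dominant eigenvalue, scaled by \<open>r\<close>, also has modulus at most
      1. As \<open>l\<close> has modulus 1, \<open>l / r\<close> is at least as large in modulus as
      \<open>z\<close> and must be equal to it.\<close>
    moreover obtain x where x: "x \<noteq> 0" "complexify P *v x = z *s x"
      using z(1) by (auto simp: dominant_eigenvalue_def is_eigenvalue_def)
    then have "M *v x = \<zeta> *s x" by (simp add: MP \<zeta>_def vector_smult_assoc)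
    then have "r * cmod z \<le> 1" using eig_le[of x \<zeta>] x r by (simp add: \<zeta>_def norm_mult)
    ultimately have "l / complex_of_real r = z"
      using z(1) cl r unfolding dominant_eigenvalue_def by (force simp: norm_divide field_simps)
    then show ?thesis using cl r by (simp add: \<zeta>_def field_simps)
  qed
  have diag: "M *v x = \<zeta> *s x" if x: "x \<in> W" for x
  proof (rule ccontr)
    assume ne: "M *v x \<noteq> \<zeta> *s x"
    \<comment> \<open>If \<open>M - \<zeta>\<close> does not vanish on \<open>W\<close>, its image
      contains an eigenvector \<open>y\<close>. A preimage of \<open>y\<close> then starts a Jordan
      chain, and its iterates grow linearly.\<close>
    define W' where "W' = (\<lambda>x. M *v x - \<zeta> *s x) ` W"
    have sub: "W' \<subseteq> W"
    proof
      fix y assume "y \<in> W'"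
      then obtain x where x: "x \<in> W" "y = M *v x - \<zeta> *s x" by (auto simp: W'_def)
      have "y = M *v x + (- \<zeta>) *s x" unfolding x(2) by (simp add: vec_eq_iff)
      then show "y \<in> W" using W_add[OF W_inv[OF x(1)] W_scale[OF x(1), of "- \<zeta>"]] by simp
    qed
    obtain y l where y: "y \<in> W'" "y \<noteq> 0" "M *v y = l *s y"
    proof (rule eigenvector_in_invariant_set[of W' M "M *v x - \<zeta> *s x"])
      fix a b assume "a \<in> W'" "b \<in> W'"
      then obtain c d where "c \<in> W" "d \<in> W" "a = M *v c - \<zeta> *s c" "b = M *v d - \<zeta> *s d" by (auto simp: W'_def)
      then show "a + b \<in> W'"
        unfolding W'_def by (intro image_eqI[of _ _ "c + d"] W_add) (simp_all add: matrix_vector_right_distrib vector_add_ldistrib)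
    next
      fix k a assume "a \<in> W'"
      then obtain c where "c \<in> W" "a = M *v c - \<zeta> *s c" by (auto simp: W'_def)
      then show "k *s a \<in> W'"
        unfolding W'_def by (intro image_eqI[of _ _ "k *s c"] W_scale)
          (simp_all add: vector_ssub_ldistrib vector_scalar_commute vector_smult_assoc mult.commute)
    next
      fix a assume "a \<in> W'"
      then obtain c where "c \<in> W" "a = M *v c - \<zeta> *s c" by (auto simp: W'_def)
      then show "M *v a \<in> W'"
        unfolding W'_def by (intro image_eqI[of _ _ "M *v c"] W_inv)
          (simp_all add: matrix_vector_mult_diff_distrib vector_scalar_commute)
    qed (use x ne in \<open>auto simp: W'_def\<close>)
    have l: "l = \<zeta>" "cmod \<zeta> = 1" using eig_W[of y l] y sub by auto
    obtain x where x: "x \<in> W" "y = M *v x - \<zeta> *s x" using y(1) by (auto simp: W'_def)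
    then have Mx: "M *v x = \<zeta> *s x + y" by simp
    have it: "?it (Suc n) x = \<zeta> ^ Suc n *s x + (of_nat (Suc n) * \<zeta> ^ n) *s y" for n
    proof (induction n)
      case (Suc n)
      have "?it (Suc (Suc n)) x = M *v (\<zeta> ^ Suc n *s x + (of_nat (Suc n) * \<zeta> ^ n) *s y)" using Suc by simp
      also have "\<dots> = \<zeta> ^ Suc n *s (\<zeta> *s x + y) + (of_nat (Suc n) * \<zeta> ^ n) *s (\<zeta> *s y)"
        using y(3) by (simp add: matrix_vector_right_distrib vector_scalar_commute Mx l(1))
      also have "\<dots> = \<zeta> ^ Suc (Suc n) *s x + (of_nat (Suc (Suc n)) * \<zeta> ^ Suc n) *s y"
        by (simp add: vec_eq_iff algebra_simps)
      finally show ?case .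
    qed (simp add: Mx)
    obtain i where i: "y $ i \<noteq> 0" using y by (auto simp: vec_eq_iff)
    let ?K = "max C 1 * (\<Sum>k\<in>UNIV. cmod (x $ k)) + cmod (x $ i)"
    obtain n where "?K / cmod (y $ i) < real n" using reals_Archimedean2 by blast
    then have "?K < real n * cmod (y $ i)" using i by (simp add: divide_less_eq)
    also have "\<dots> \<le> cmod ((of_nat (Suc n) * \<zeta> ^ n) * y $ i)"
      using l by (simp add: norm_mult norm_power mult_right_mono del: of_nat_Suc)
    also have "(of_nat (Suc n) * \<zeta> ^ n) * y $ i = ?it (Suc n) x $ i - \<zeta> ^ Suc n * x $ i"
      unfolding it by simp
    also have "cmod \<dots> \<le> cmod (?it (Suc n) x $ i) + cmod (\<zeta> ^ Suc n * x $ i)" by (rule norm_triangle_ineq4)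
    also have "\<dots> \<le> ?K" using bound[of "Suc n" x i] l by (simp add: norm_mult norm_power del: funpow.simps)
    finally show False by simp
  qed
  have minors: "B $ i $ k * B $ j $ l = B $ j $ k * B $ i $ l" for i j k l
  proof -
    define col where "col k = (complexify B *v axis k 1)" for k
    have c: "col k $ i = complex_of_real (B $ i $ k)" for k i
      by (simp add: col_def matrix_vector_mult_def complexify_def axis_def if_distrib[of "\<lambda>x. _ * x"] cong: if_cong)
    have "complexify P *v col k = z *s col k" for k
    proof -
      have "col k \<in> W" by (auto simp: W_def col_def)
      from diag[OF this] have "complex_of_real r * (complexify P *v col k) $ i = complex_of_real r * (z * col k $ i)" for i
        by (auto simp: MP \<zeta>_def vec_eq_iff)
      then show ?thesis using r by (simp add: vec_eq_iff)
    qed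
    from simple_eigenspace[OF z this this, of k i l j]
    have "complex_of_real (B $ i $ k * B $ j $ l) = complex_of_real (B $ j $ k * B $ i $ l)" by (simp add: c)
    then show ?thesis by (simp only: of_real_eq_iff)
  qed
  obtain u f where "B = outer u f" by (rule outer_if_minors_0[OF minors T_nonzero[OF B]])
  with B show ?thesis by (intro that) auto
qed

text \<open>\<open>E\<close> is a limit of the powers of \<open>A\<close> that fix \<open>B\<close>
  asymptotically. Writing them as \<open>A ** mpow A k ** A\<close> and passing to the limit in the
  middle factor only keeps \<open>E\<close> strictly positive.\<close>

lemma strictly_positive_limit:
  assumes pos: "\<And>A. A \<in> T \<Longrightarrow> positive_matrix A" and A: "A \<in> T" "strictly_positive_matrix A"
  obtains B \<phi> E where "B \<in> T" "\<And>j. 1 \<le> \<phi> j" "(\<lambda>j. mpow A (\<phi> j)) \<longlonglongrightarrow> B"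
    "strictly_positive_matrix E" "E ** B = B" "\<And>v. A *v v = v \<Longrightarrow> E *v v = v"
proof -
  obtain B \<phi> m where B: "B \<in> T" and \<phi>: "\<And>j. 1 \<le> \<phi> j" and lim: "(\<lambda>j. mpow A (\<phi> j)) \<longlonglongrightarrow> B"
    and m: "\<And>j. j \<le> m j" "(\<lambda>j. mpow A (m j) ** B) \<longlonglongrightarrow> B"
    by (rule power_limit[OF A(1)], rule that)
  \<comment> \<open>The shift by 3 guarantees a middle exponent of at least 1, so that the middle
    factor lies in \<open>T\<close>.\<close>
  define k where "k j = m (j + 3) - 2" for j
  have k: "m (j + 3) = 1 + (k j + 1)" "1 \<le> k j" for j using m(1)[of "j + 3"] by (auto simp: k_def)
  obtain X r where X: "X \<in> T" "strict_mono r" "(\<lambda>j. mpow A (k (r j))) \<longlonglongrightarrow> X"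
    by (rule T_subseq[of "\<lambda>j. mpow A (k j)"]) (rule mpow_in_T[OF A(1) k(2)])
  define E where "E = A ** X ** A"
  have "(\<lambda>j. A ** mpow A (k (r j)) ** A ** B) \<longlonglongrightarrow> E ** B"
    unfolding E_def by (intro tendsto_intros X(3))
  moreover have "(\<lambda>j. mpow A (m (r j + 3)) ** B) \<longlonglongrightarrow> B"
  proof (rule LIMSEQ_subseq_LIMSEQ[OF m(2), of "\<lambda>j. r j + 3", unfolded o_def])
    show "strict_mono (\<lambda>j. r j + 3)" using X(2) by (simp add: strict_mono_def)
  qed
  moreover have "mpow A (m (r j + 3)) = A ** mpow A (k (r j)) ** A" for j
    unfolding k(1) mpow_add by (simp add: matrix_mul_assoc)
  ultimately have EB: "E ** B = B" by (simp add: LIMSEQ_unique)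
  have "strictly_positive_matrix E"
    unfolding strictly_positive_matrix_def
  proof (intro allI)
    fix i j
    have nn: "0 \<le> X $ a $ b" for a b using pos[OF X(1)] by (simp add: positive_matrix_def)
    obtain a b where "X $ a $ b \<noteq> 0" using T_nonzero[OF X(1)] by (auto simp: vec_eq_iff)
    then have ab: "0 < X $ a $ b" using nn[of a b] by simp
    have Apos: "0 < A $ i $ j" for i j using A by (simp add: strictly_positive_matrix_def)
    have AX: "0 \<le> (A ** X) $ i $ b" for b
      by (simp add: matrix_matrix_mult_def) (intro sum_nonneg mult_nonneg_nonneg nn less_imp_le[OF Apos])
    have "0 < (A ** X) $ i $ b"
      unfolding matrix_matrix_mult_def vec_lambda_beta
      by (rule sum_pos2[of _ a]) (use ab Apos nn less_imp_le[OF Apos] in auto)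
    then show "0 < E $ i $ j"
      unfolding E_def matrix_matrix_mult_def[of "A ** X"] vec_lambda_beta
      by (intro sum_pos2[of _ b]) (use AX Apos less_imp_le[OF Apos] in auto)
  qed
  moreover have "E *v v = v" if v: "A *v v = v" for v
  proof -
    have pv: "mpow A n *v v = v" for n
      by (induction n) (simp_all add: v matrix_vector_mul_assoc[symmetric])
    have "(\<lambda>j. mpow A (k (r j)) *v v) \<longlonglongrightarrow> X *v v" by (intro tendsto_intros X(3))
    then have "X *v v = v" unfolding pv by (simp add: LIMSEQ_const_iff)
    then show ?thesis by (simp add: E_def matrix_vector_mul_assoc[symmetric] v)
  qed
  ultimately show ?thesis using B \<phi> lim EB by (intro that[of B \<phi> E]) auto
qed

lemma positive_mult_pos_vector:
  assumes B: "positive_matrix B" "strictly_positive_matrix E" "E ** B = B" "B \<noteq> 0" and u: "\<And>i. 0 < u $ i"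
  shows "0 < (B *v u) $ i"
proof -
  have nn: "0 \<le> (B *v u) $ i" for i
    unfolding matrix_vector_mult_def vec_lambda_beta
    using B(1) u by (intro sum_nonneg mult_nonneg_nonneg) (auto simp: positive_matrix_def intro: less_imp_le)
  obtain a b where "B $ a $ b \<noteq> 0" using B(4) by (auto simp: vec_eq_iff)
  then have ab: "0 < B $ a $ b" using B(1) by (simp add: positive_matrix_def less_le)
  have "0 < (B *v u) $ a"
    unfolding matrix_vector_mult_def vec_lambda_beta
    by (rule sum_pos2[of _ b]) (use ab B(1) u in \<open>auto simp: positive_matrix_def intro!: mult_nonneg_nonneg intro: less_imp_le\<close>)
  then have "B *v u \<noteq> 0" by (intro notI) simp
  from strictly_positive_mult_vector_pos[OF B(2) nn this, of i] show ?thesis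
    by (simp add: matrix_vector_mul_assoc B(3))
qed

text \<open>All columns of a limit \<open>B\<close> of powers are fixed by \<open>E\<close>, hence
  proportional to the positive vector \<open>w\<close>. This gives \<open>B = outer w h\<close> with
  \<open>h\<close> nonnegative; a further factor \<open>A\<close> on the right makes the functional
  strictly positive.\<close>

lemma strictly_positive_outer:
  assumes pos: "\<And>A. A \<in> T \<Longrightarrow> positive_matrix A" and A: "A \<in> T" "strictly_positive_matrix A"
  obtains u f where "outer u f \<in> T" "\<And>i. 0 < u $ i" "\<And>i. 0 < f $ i"
proof -
  obtain B \<phi> E where B: "B \<in> T" and E: "strictly_positive_matrix E" "E ** B = B"
    by (rule strictly_positive_limit[OF pos A], assumption, rule that)
  define w where "w = B *v (\<chi> i. 1)"
  have w: "0 < w $ i" for i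
    unfolding w_def by (rule positive_mult_pos_vector[OF pos[OF B] E T_nonzero[OF B]]) simp
  have Efix: "E *v (B *v x) = B *v x" for x by (simp add: matrix_vector_mul_assoc E(2))
  have "\<exists>t. B *v axis k 1 = t *\<^sub>R w" for k
    by (rule perron_unique[OF E(1) _ w Efix]) (auto simp: w_def Efix)
  then obtain t where t: "\<And>k. B *v axis k 1 = t k *\<^sub>R w" by metis
  define h where "h = (\<chi> k. t k)"
  have Bwh: "B = outer w h"
  proof -
    have "B $ i $ k = w $ i * h $ k" for i k
      using arg_cong[OF t[of k], of "\<lambda>x. x $ i"] by (simp add: matrix_vector_mult_basis column_def h_def mult.commute)
    then show ?thesis by (simp add: outer_def vec_eq_iff)
  qed
  have h: "0 \<le> h $ k" for k
  proof -
    have "0 \<le> w $ k * h $ k" using pos[OF B] by (simp add: Bwh outer_def positive_matrix_def)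
    with w[of k] show ?thesis by (simp add: zero_le_mult_iff)
  qed
  have h0: "h \<noteq> 0" using T_nonzero[OF B] by (auto simp: Bwh outer_def vec_eq_iff)
  define f where "f = transpose A *v h"
  have "outer w h ** A = outer w f"
    by (simp add: f_def outer_def matrix_matrix_mult_def matrix_vector_mult_def transpose_def vec_eq_iff sum_distrib_left mult_ac)
  then have "outer w f \<in> T" using T_mult[OF B A(1)] by (simp add: Bwh)
  moreover have "0 < f $ i" for i
    unfolding f_def
    by (rule strictly_positive_mult_vector_pos[OF _ h h0]) (use A in \<open>auto simp: strictly_positive_matrix_def transpose_def\<close>)
  ultimately show ?thesis using w by (intro that) auto
qed

end

section \<open>The random products\<close>

lemma G_prod_measurable:
  assumes "\<And>i. 1 \<le> i \<Longrightarrow> i \<le> n \<Longrightarrow> g i \<in> borel_measurable N"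
  shows "(G_prod g n :: 'w \<Rightarrow> real^'n^'n) \<in> borel_measurable N"
  using assms
proof (induction n)
  case 0
  have "(G_prod g 0 :: 'w \<Rightarrow> real^'n^'n) = (\<lambda>_. mat 1)" by (simp add: fun_eq_iff)
  then show ?case by simp
next
  case (Suc n)
  have "(\<lambda>\<omega>. g (Suc n) \<omega> ** G_prod g n \<omega>) \<in> borel_measurable N"
    by (rule borel_measurable_matrix_mult) (use Suc in auto)
  moreover have "G_prod g (Suc n) = (\<lambda>\<omega>. g (Suc n) \<omega> ** G_prod g n \<omega>)" by (simp add: fun_eq_iff)
  ultimately show ?case by simp
qed

lemma G_prod_cong: "(\<And>i. 1 \<le> i \<Longrightarrow> i \<le> n \<Longrightarrow> g i \<omega> = h i \<omega>') \<Longrightarrow> G_prod g n \<omega> = G_prod h n \<omega>'"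
  by (induction n) auto

lemma distr_G_prod:
  fixes M :: "'w measure" and g :: "nat \<Rightarrow> 'w \<Rightarrow> real^'n^'n"
  assumes "prob_space M" and ind: "prob_space.indep_vars M (\<lambda>_. borel) g {1..}"
    and \<mu>: "\<forall>n\<ge>1. distr M borel (g n) = \<mu>"
  shows "G_prod g n \<in> borel_measurable M" and "distr M borel (G_prod g n) = cpow \<mu> n"
proof -
  interpret prob_space M by fact
  have g: "g i \<in> borel_measurable M" if "1 \<le> i" for i
    using ind that by (auto simp: indep_vars_def)
  show meas: "G_prod g n \<in> borel_measurable M" for n
    by (rule G_prod_measurable) (rule g)
  show "distr M borel (G_prod g n) = cpow \<mu> n"
  proof (induction n)
    case 0
    have "(G_prod g 0 :: 'w \<Rightarrow> real^'n^'n) = (\<lambda>_. mat 1)" by (simp add: fun_eq_iff)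
    then show ?case by (simp add: distr_const)
  next
    case (Suc n)
    \<comment> \<open>The product is written as a function of the family of factors, so that
      independence over the disjoint index sets \<open>{Suc n}\<close> and \<open>{1..n}\<close>
      applies.\<close>
    let ?G = "\<lambda>f. G_prod (\<lambda>i f. f i) n (f :: nat \<Rightarrow> real^'n^'n)"
    have "indep_var borel ((\<lambda>f. f (Suc n)) \<circ> (\<lambda>\<omega>. restrict (\<lambda>i. g i \<omega>) {Suc n}))
        borel (?G \<circ> (\<lambda>\<omega>. restrict (\<lambda>i. g i \<omega>) {1..n}))"
    proof (rule indep_var_compose[OF indep_var_restrict[OF ind]])
      show "?G \<in> borel_measurable (Pi\<^sub>M {1..n} (\<lambda>_. borel))"
        by (rule G_prod_measurable) (auto intro!: measurable_component_singleton)
    qed auto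
    also have "(\<lambda>f. f (Suc n)) \<circ> (\<lambda>\<omega>. restrict (\<lambda>i. g i \<omega>) {Suc n}) = g (Suc n)"
      by (auto simp: fun_eq_iff)
    also have "?G \<circ> (\<lambda>\<omega>. restrict (\<lambda>i. g i \<omega>) {1..n}) = G_prod g n"
      by (auto simp: fun_eq_iff intro!: G_prod_cong)
    finally have "indep_var borel (g (Suc n)) borel (G_prod g n)" .
    then have eq: "distr M borel (g (Suc n)) \<Otimes>\<^sub>M distr M borel (G_prod g n) =
        distr M (borel \<Otimes>\<^sub>M borel) (\<lambda>\<omega>. (g (Suc n) \<omega>, G_prod g n \<omega>))"
      by (simp add: indep_var_distribution_eq)
    have mm: "(\<lambda>(A, B). A ** B :: real^'n^'n) \<in> borel_measurable (borel \<Otimes>\<^sub>M borel)" by measurable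
    have pm: "(\<lambda>\<omega>. (g (Suc n) \<omega>, G_prod g n \<omega>)) \<in> measurable M (borel \<Otimes>\<^sub>M borel)"
      by (intro measurable_Pair g meas) simp
    have "cpow \<mu> (Suc n) = distr (distr M (borel \<Otimes>\<^sub>M borel) (\<lambda>\<omega>. (g (Suc n) \<omega>, G_prod g n \<omega>))) borel (\<lambda>(A, B). A ** B)"
      using eq Suc \<mu> by simp
    also have "\<dots> = distr M borel (\<lambda>\<omega>. g (Suc n) \<omega> ** G_prod g n \<omega>)"
      by (subst distr_distr[OF mm pm]) (simp add: o_def)
    also have "(\<lambda>\<omega>. g (Suc n) \<omega> ** G_prod g n \<omega>) = G_prod g (Suc n)" by (simp add: fun_eq_iff)
    finally show ?case by (rule sym)
  qed
qed

section \<open>From the random products to convolution powers\<close>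

context cone_law begin

text \<open>Almost surely the product is nonzero, so the value \<open>ln 0 = 0\<close> does not
  affect the event and \<open>ln\<close> may be inverted.\<close>

lemma measure_deviation_event:
  assumes "prob_space M" and ind: "prob_space.indep_vars M (\<lambda>_. borel) g {1..}"
    and \<mu>: "\<forall>n\<ge>1. distr M borel (g n) = \<mu>"
  shows "measure M (deviation_event M g n a) = tail \<mu> n a"
proof -
  note G = distr_G_prod[OF assms]
  have "deviation_event M g n a = G_prod g n -` {H. a \<le> ln (mnorm H)} \<inter> space M"
    by (auto simp: deviation_event_def)
  then have "measure M (deviation_event M g n a) = measure (cpow \<mu> n) {H. a \<le> ln (mnorm H)}"
    unfolding G(2)[symmetric] by (subst measure_distr[OF G(1)]) auto
  also have "\<dots> = tail \<mu> n a"
    unfolding tail_def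
  proof (rule C.finite_measure_eq_AE)
    show "AE H in cpow \<mu> n. (H \<in> {H. a \<le> ln (mnorm H)}) = (H \<in> {H. exp a \<le> mnorm H})"
      using AE_cpow_nonzero by eventually_elim (simp add: ln_ge_iff)
  qed measurable
  finally show ?thesis .
qed

lemma Lambda_eq_Lam:
  assumes "prob_space M" and ind: "prob_space.indep_vars M (\<lambda>_. borel) g {1..}"
    and \<mu>: "\<forall>n\<ge>1. distr M borel (g n) = \<mu>" and t: "t \<in> I_set \<mu>"
  shows "Lambda M g t = Lam \<mu> t"
proof -
  note G = distr_G_prod[OF assms(1-3)]
  obtain u D where u: "\<And>n. mom \<mu> t n = ennreal (exp (u n))" "(\<lambda>n. u n / real n) \<longlonglongrightarrow> Lam \<mu> t"
    by (rule mom_Lam[OF t], rule that)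
  have "(\<integral>\<omega>. mnorm (G_prod g n \<omega>) powr t \<partial>M) = exp (u n)" for n
  proof -
    have "(\<integral>\<^sup>+\<omega>. ennreal (mnorm (G_prod g n \<omega>) powr t) \<partial>M) = ennreal (exp (u n))"
      unfolding u(1)[symmetric] mom_def G(2)[symmetric] by (subst nn_integral_distr[OF G(1)]) auto
    moreover have "(\<lambda>\<omega>. mnorm (G_prod g n \<omega>) powr t) \<in> borel_measurable M"
      using G(1)[of n] by measurable
    ultimately show ?thesis by (subst integral_eq_nn_integral) auto
  qed
  then have "kappa M g t = lim (\<lambda>n. exp (u n / real n))"
    by (simp add: kappa_def powr_def)
  also have "\<dots> = exp (Lam \<mu> t)"
    by (intro limI tendsto_exp u(2))
  finally show ?thesis by (simp add: Lambda_def)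
qed

lemma tangent_if_derivative:
  assumes "prob_space M" and ind: "prob_space.indep_vars M (\<lambda>_. borel) g {1..}"
    and \<mu>: "\<forall>n\<ge>1. distr M borel (g n) = \<mu>"
    and s: "s \<in> interior (I_set \<mu>)" and d: "(Lambda M g has_real_derivative q) (at s)"
  shows "tangent \<mu> s q"
  unfolding tangent_def
proof (intro conjI allI impI)
  note L = Lambda_eq_Lam[OF assms(1-3)]
  show sI: "s \<in> I_set \<mu>" using s interior_subset by blast
  obtain e where e: "0 < e" "ball s e \<subseteq> I_set \<mu>" using s by (auto simp: mem_interior)
  have near: "t \<in> I_set \<mu>" if "\<bar>t - s\<bar> < e" for t
    using that e by (auto simp: dist_real_def abs_minus_commute)
  \<comment> \<open>\<open>I_set \<mu>\<close> contains nonnegative numbers only, so a point of it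
    to the left of \<open>s\<close> forces \<open>s\<close> to be positive.\<close>
  have "s - e / 2 \<in> I_set \<mu>" using e by (intro near) auto
  then show "0 < s" using e by (simp add: I_set_def)
  fix \<delta> :: real assume \<delta>: "0 < \<delta>"
  have "((\<lambda>h. (Lambda M g (s + h) - Lambda M g s) / h) \<longlongrightarrow> q) (at 0)"
    using d by (simp add: DERIV_def)
  then have "\<forall>\<^sub>F h in at 0. dist ((Lambda M g (s + h) - Lambda M g s) / h) q < \<delta>"
    using \<delta> by (rule tendstoD)
  then obtain d0 where d0: "0 < d0" "\<And>h. h \<noteq> 0 \<Longrightarrow> \<bar>h\<bar> < d0 \<Longrightarrow> \<bar>(Lambda M g (s + h) - Lambda M g s) / h - q\<bar> < \<delta>"
    by (auto simp: eventually_at dist_real_def)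
  define \<tau> where "\<tau> = min d0 e / 2"
  have \<tau>: "0 < \<tau>" "\<tau> < d0" "\<tau> < e" using d0 e by (auto simp: \<tau>_def)
  have I: "s + \<tau> \<in> I_set \<mu>" "s - \<tau> \<in> I_set \<mu>" using \<tau> by (auto intro: near)
  have "(Lam \<mu> (s + \<tau>) - Lam \<mu> s) / \<tau> \<le> q + \<delta>"
    using d0(2)[of \<tau>] \<tau> L[OF I(1)] L[OF sI] by (simp add: abs_less_iff)
  then have 1: "Lam \<mu> (s + \<tau>) \<le> Lam \<mu> s + \<tau> * (q + \<delta>)"
    using \<tau> by (simp add: divide_le_eq algebra_simps)
  have "q - \<delta> \<le> (Lam \<mu> s - Lam \<mu> (s - \<tau>)) / \<tau>"
  proof -
    have "(Lam \<mu> (s - \<tau>) - Lam \<mu> s) / \<tau> = - ((Lam \<mu> s - Lam \<mu> (s - \<tau>)) / \<tau>)"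
      by (simp add: minus_divide_left)
    then show ?thesis
      using d0(2)[of "- \<tau>"] \<tau> L[OF I(2)] L[OF sI] by (simp add: abs_less_iff)
  qed
  then have 2: "Lam \<mu> (s - \<tau>) \<le> Lam \<mu> s - \<tau> * (q - \<delta>)"
    using \<tau> by (simp add: le_divide_eq algebra_simps)
  show "\<exists>\<tau>>0. s + \<tau> \<in> I_set \<mu> \<and> s - \<tau> \<in> I_set \<mu> \<and>
      Lam \<mu> (s + \<tau>) \<le> Lam \<mu> s + \<tau> * (q + \<delta>) \<and> Lam \<mu> (s - \<tau>) \<le> Lam \<mu> s - \<tau> * (q - \<delta>)"
    using \<tau> I 1 2 by blast
qed

lemma Lambda_star_eq:
  assumes "prob_space M" and ind: "prob_space.indep_vars M (\<lambda>_. borel) g {1..}"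
    and \<mu>: "\<forall>n\<ge>1. distr M borel (g n) = \<mu>" and tan: "tangent \<mu> s q"
  shows "Lambda_star \<mu> M g q = s * q - Lam \<mu> s"
  unfolding Lambda_star_def
proof (rule cSup_eq_maximum)
  note L = Lambda_eq_Lam[OF assms(1-3)]
  have s: "s \<in> I_set \<mu>" using tan by (simp add: tangent_def)
  then show "s * q - Lam \<mu> s \<in> (\<lambda>s. s * q - Lambda M g s) ` I_set \<mu>"
    using L[OF s] by (intro image_eqI[of _ _ s]) auto
  fix x assume "x \<in> (\<lambda>s. s * q - Lambda M g s) ` I_set \<mu>"
  then obtain t where t: "t \<in> I_set \<mu>" "x = t * q - Lambda M g t" by auto
  then show "x \<le> s * q - Lam \<mu> s"
    using Lam_ge_tangent[OF tan t(1)] L[OF t(1)] by (simp add: algebra_simps)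
qed

section \<open>Normalisation\<close>

lemma nn_integral_cpow_scaled:
  assumes [measurable]: "f \<in> borel_measurable borel"
  shows "(\<integral>\<^sup>+H. f H \<partial>cpow (distr \<mu> borel (\<lambda>A. c *\<^sub>R A)) n) = (\<integral>\<^sup>+H. f (c ^ n *\<^sub>R H) \<partial>cpow \<mu> n)"
proof -
  interpret S: matrix_law "distr \<mu> borel (\<lambda>A. c *\<^sub>R A)"
    by (intro matrix_law.intro matrix_law_axioms.intro prob_space_distr) auto
  show ?thesis using assms
  proof (induction n arbitrary: f)
    case 0
    note [measurable] = 0
    show ?case by (subst S.nn_integral_cpow_0, simp, subst nn_integral_cpow_0) auto
  next
    case (Suc n)
    note [measurable] = Suc.prems
    have "(\<integral>\<^sup>+H. f H \<partial>cpow (distr \<mu> borel (\<lambda>A. c *\<^sub>R A)) (Suc n)) =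
        (\<integral>\<^sup>+A. \<integral>\<^sup>+B. f (A ** B) \<partial>cpow (distr \<mu> borel (\<lambda>A. c *\<^sub>R A)) n \<partial>distr \<mu> borel (\<lambda>A. c *\<^sub>R A))"
      by (rule S.nn_integral_cpow_Suc) simp
    also have "\<dots> = (\<integral>\<^sup>+A. \<integral>\<^sup>+B. f (A ** (c ^ n *\<^sub>R B)) \<partial>cpow \<mu> n \<partial>distr \<mu> borel (\<lambda>A. c *\<^sub>R A))"
      by (subst Suc.IH) auto
    also have "\<dots> = (\<integral>\<^sup>+A. \<integral>\<^sup>+B. f ((c *\<^sub>R A) ** (c ^ n *\<^sub>R B)) \<partial>cpow \<mu> n \<partial>\<mu>)"
      by (subst nn_integral_distr) auto
    also have "\<dots> = (\<integral>\<^sup>+A. \<integral>\<^sup>+B. f (c ^ Suc n *\<^sub>R (A ** B)) \<partial>cpow \<mu> n \<partial>\<mu>)"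
      by (simp add: mult_left_scaleR_matrix mult_right_scaleR_matrix mult.commute)
    also have "\<dots> = (\<integral>\<^sup>+H. f (c ^ Suc n *\<^sub>R H) \<partial>cpow \<mu> (Suc n))"
      by (rule nn_integral_cpow_Suc[symmetric]) measurable
    finally show ?case .
  qed
qed

lemma AE_cpow_scaled:
  assumes [measurable]: "Measurable.pred borel P"
  shows "(AE H in cpow (distr \<mu> borel (\<lambda>A. c *\<^sub>R A)) n. P H) \<longleftrightarrow> (AE H in cpow \<mu> n. P (c ^ n *\<^sub>R H))"
proof -
  interpret S: matrix_law "distr \<mu> borel (\<lambda>A. c *\<^sub>R A)"
    by (intro matrix_law.intro matrix_law_axioms.intro prob_space_distr) auto
  have "(AE H in cpow (distr \<mu> borel (\<lambda>A. c *\<^sub>R A)) n. P H) \<longleftrightarrow>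
      (\<integral>\<^sup>+H. indicator {H. \<not> P H} (c ^ n *\<^sub>R H) \<partial>cpow \<mu> n) = 0"
    by (subst S.AE_cpow_iff_nn_integral, simp, subst nn_integral_cpow_scaled) auto
  also have "\<dots> \<longleftrightarrow> (AE H in cpow \<mu> n. indicator {H. \<not> P H} (c ^ n *\<^sub>R H) = (0::ennreal))"
    by (subst nn_integral_0_iff_AE) measurable
  also have "\<dots> \<longleftrightarrow> (AE H in cpow \<mu> n. P (c ^ n *\<^sub>R H))"
    by (simp add: indicator_eq_0_iff)
  finally show ?thesis .
qed

lemma cone_law_scaled:
  assumes c: "0 < c"
  shows "cone_law (distr \<mu> borel (\<lambda>A. c *\<^sub>R A)) CA"
proof (intro cone_law.intro matrix_law.intro matrix_law_axioms.intro cone_law_axioms.intro)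
  show "prob_space (distr \<mu> borel (\<lambda>A. c *\<^sub>R A))" by (rule prob_space_distr) simp
  show "AE A in distr \<mu> borel (\<lambda>A. c *\<^sub>R A). A \<in> CA"
  proof (subst AE_distr_iff)
    show "AE A in \<mu>. c *\<^sub>R A \<in> CA" using AE_law_CA by eventually_elim (use c CA_scaleR in auto)
  qed (use pred_CA in \<open>auto simp: pred_def\<close>)
  fix A assume A: "A \<in> CA" "A \<noteq> 0"
  have P: "Measurable.pred borel (\<lambda>H. H ** A \<noteq> 0)" by measurable
  show "AE H in distr \<mu> borel (\<lambda>A. c *\<^sub>R A). H ** A \<noteq> 0"
  proof (subst AE_distr_iff)
    show "AE H in \<mu>. (c *\<^sub>R H) ** A \<noteq> 0"
      using AE_law_nonzero[OF A] by eventually_elim (use c in \<open>simp add: mult_left_scaleR_matrix\<close>)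
  qed (use P in \<open>auto simp: pred_def\<close>)
next
  fix A B assume AB: "A \<in> CA" "B \<in> CA" "A \<noteq> 0" "B \<noteq> 0"
  have P: "Measurable.pred borel (\<lambda>H. A ** H ** B = 0)" by measurable
  have "(AE H in cpow \<mu> k. A ** (c ^ k *\<^sub>R H) ** B = 0) \<longleftrightarrow> (AE H in cpow \<mu> k. A ** H ** B = 0)" for k
    using c by (simp add: mult_left_scaleR_matrix mult_right_scaleR_matrix)
  then show "\<exists>k. \<not> (AE H in cpow (distr \<mu> borel (\<lambda>A. c *\<^sub>R A)) k. A ** H ** B = 0)"
    unfolding AE_cpow_scaled[OF P] using transitive[OF AB] by simp
qed (use closed_CA CA_scaleR CA_mult CA_one in auto)

lemma mom_scaled:
  assumes "0 < c"
  shows "mom (distr \<mu> borel (\<lambda>A. c *\<^sub>R A)) t n = ennreal ((c ^ n) powr t) * mom \<mu> t n"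
proof -
  have "mom (distr \<mu> borel (\<lambda>A. c *\<^sub>R A)) t n = (\<integral>\<^sup>+H. ennreal ((c ^ n) powr t) * ennreal (mnorm H powr t) \<partial>cpow \<mu> n)"
    unfolding mom_def using assms
    by (subst nn_integral_cpow_scaled) (auto simp: mnorm_scaleR powr_mult ennreal_mult)
  then show ?thesis by (simp add: nn_integral_cmult mom_def)
qed

text \<open>Scaling all factors by \<open>exp (- q)\<close> reduces to bounded products. There the
  supporting line, evaluated at \<open>s + \<tau>\<close>, bounds the moment of order
  \<open>s + \<tau>\<close> below by a constant times that of order \<open>s\<close>, the condition
  under which the products are bounded below.\<close>

lemma mnorm_exact_order:
  assumes tan: "tangent \<mu> s q" and C: "1 \<le> C"
    and bd: "\<And>n. AE H in cpow \<mu> n. mnorm H \<le> C * exp (real n * q)"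
  obtains \<eta> where "0 < \<eta>" "\<And>n. AE H in cpow \<mu> n. \<eta> * exp (real n * q) \<le> mnorm H"
proof -
  define c where "c = exp (- q)"
  have c: "0 < c" "c ^ n = exp (- (real n * q))" for n by (auto simp: c_def exp_of_nat_mult[symmetric])
  define \<nu> where "\<nu> = distr \<mu> borel (\<lambda>A. c *\<^sub>R A)"
  interpret N: cone_law \<nu> CA unfolding \<nu>_def by (rule cone_law_scaled[OF c(1)])
  have s: "s \<in> I_set \<mu>" using tan by (simp add: tangent_def)
  obtain \<tau> where \<tau>: "0 < \<tau>" "s + \<tau> \<in> I_set \<mu>"
    using tan unfolding tangent_def by (meson zero_less_one)
  have mom\<nu>: "mom \<nu> t n = ennreal (exp (- (t * (real n * q)))) * mom \<mu> t n" for t n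
    using mom_scaled[OF c(1), of t n] by (simp add: \<nu>_def c(2) powr_def)
  have bd\<nu>: "AE H in cpow \<nu> n. mnorm H \<le> C" for n
  proof -
    have P: "Measurable.pred borel (\<lambda>H::real^'n^'n. mnorm H \<le> C)" by measurable
    show ?thesis
      unfolding \<nu>_def AE_cpow_scaled[OF P] using bd[of n]
      by eventually_elim (simp add: mnorm_scaleR c(2) exp_minus field_simps)
  qed
  have s\<nu>: "s \<in> I_set \<nu>"
    using s mom_finite[OF s, of 1] mom\<nu>[of s 1] by (auto simp: I_set_def N.mom_1[symmetric] ennreal_mult_less_top)
  obtain D1 where D1: "\<And>n. mom \<mu> s n \<le> ennreal (exp (real n * Lam \<mu> s + D1))"
    by (rule mom_bounds[OF s], rule that)
  obtain D2 where D2: "\<And>n. ennreal (exp (real n * Lam \<mu> (s + \<tau>) - D2)) \<le> mom \<mu> (s + \<tau>) n"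
    by (rule mom_bounds[OF \<tau>(2)], rule that)
  have ratio: "ennreal (exp (- D1 - D2)) * mom \<nu> s n \<le> mom \<nu> (s + \<tau>) n" for n
  proof -
    have "real n * (Lam \<mu> s + q * \<tau>) \<le> real n * Lam \<mu> (s + \<tau>)"
      using Lam_ge_tangent[OF tan \<tau>(2)] by (intro mult_left_mono) auto
    then have le: "- D1 - D2 - s * (real n * q) + (real n * Lam \<mu> s + D1)
        \<le> - ((s + \<tau>) * (real n * q)) + (real n * Lam \<mu> (s + \<tau>) - D2)"
      by (simp add: algebra_simps)
    have "ennreal (exp (- D1 - D2)) * mom \<nu> s n
        \<le> ennreal (exp (- D1 - D2)) * (ennreal (exp (- (s * (real n * q)))) * ennreal (exp (real n * Lam \<mu> s + D1)))"
      unfolding mom\<nu> by (intro mult_left_mono D1) auto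
    also have "\<dots> = ennreal (exp (- D1 - D2 - s * (real n * q) + (real n * Lam \<mu> s + D1)))"
      by (simp add: ennreal_mult[symmetric] exp_add[symmetric])
    also have "\<dots> \<le> ennreal (exp (- ((s + \<tau>) * (real n * q)) + (real n * Lam \<mu> (s + \<tau>) - D2)))"
      using le by (intro ennreal_leI) simp
    also have "\<dots> = ennreal (exp (- ((s + \<tau>) * (real n * q)))) * ennreal (exp (real n * Lam \<mu> (s + \<tau>) - D2))"
      by (simp add: ennreal_mult[symmetric] exp_add[symmetric])
    also have "\<dots> \<le> mom \<nu> (s + \<tau>) n"
      unfolding mom\<nu> by (intro mult_left_mono D2) auto
    finally show ?thesis .
  qed
  obtain \<eta> where \<eta>: "0 < \<eta>" "\<And>n. AE H in cpow \<nu> n. \<eta> \<le> mnorm H"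
    by (rule N.mnorm_bounded_below[OF bd\<nu> C s\<nu> _ _ ratio]) (use \<tau> that in auto)
  show ?thesis
  proof (rule that[OF \<eta>(1)])
    fix n
    have P: "Measurable.pred borel (\<lambda>H::real^'n^'n. \<eta> \<le> mnorm H)" by measurable
    have "AE H in cpow \<mu> n. \<eta> \<le> mnorm (c ^ n *\<^sub>R H)"
      using \<eta>(2)[of n] unfolding \<nu>_def AE_cpow_scaled[OF P] .
    then show "AE H in cpow \<mu> n. \<eta> * exp (real n * q) \<le> mnorm H"
      by eventually_elim (simp add: mnorm_scaleR c(2) exp_minus field_simps)
  qed
qed

end

section \<open>The two cases\<close>

lemma closed_subspace_invariant:
  fixes W :: "(real^'n) set"
  assumes "subspace W"
  shows "closed {A :: real^'n^'n. \<forall>v\<in>W. A *v v \<in> W}"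
proof -
  have "{A :: real^'n^'n. \<forall>v\<in>W. A *v v \<in> W} = (\<Inter>v\<in>W. (\<lambda>A. A *v v) -` W)" by auto
  moreover have "closed ((\<lambda>A :: real^'n^'n. A *v v) -` W)" for v
    by (intro closed_vimage closed_subspace assms continuous_on_matrix_vector_mult continuous_on_id continuous_on_const)
  ultimately show ?thesis by auto
qed

lemma strongly_irreducible_subspace:
  assumes irr: "strongly_irreducible G" and W: "subspace W" "\<And>A x. A \<in> G \<Longrightarrow> x \<in> W \<Longrightarrow> A *v x \<in> W"
  shows "W = {0} \<or> W = UNIV"
proof (rule ccontr)
  assume "\<not> ?thesis"
  then have "\<exists>F. finite F \<and> F \<noteq> {} \<and> (\<forall>W\<in>F. subspace W \<and> W \<noteq> {0} \<and> W \<noteq> UNIV) \<and>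
      (\<forall>A\<in>G. (\<lambda>x. A *v x) ` (\<Union>F) \<subseteq> \<Union>F)"
    using W by (intro exI[of _ "{W}"]) auto
  with irr show False unfolding strongly_irreducible_def by blast
qed

text \<open>If no product connects \<open>A\<close> and \<open>B\<close>, the vectors
  \<open>v\<close> with \<open>A *v (H *v v) = 0\<close> for almost every product \<open>H\<close>
  of every length form a subspace invariant under \<open>Gamma \<mu>\<close>. It is nonzero, as it
  contains the columns of \<open>B\<close>, and proper, as the empty product shows; this contradicts
  irreducibility.\<close>

lemma (in matrix_law) cone_law_invertible:
  assumes inv: "AE A in \<mu>. invertible A" and irr: "strongly_irreducible (Gamma \<mu>)"
  shows "cone_law \<mu> UNIV"
proof (intro cone_law.intro cone_law_axioms.intro)
  fix A :: "real^'n^'n" assume "A \<noteq> 0"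
  show "AE H in \<mu>. H ** A \<noteq> 0"
    using inv
  proof eventually_elim
    case (elim H)
    then obtain H' where "H' ** H = mat 1" by (auto simp: invertible_def)
    then have "H' ** (H ** A) = A" by (simp add: matrix_mul_assoc)
    with \<open>A \<noteq> 0\<close> show ?case by auto
  qed
next
  fix A B :: "real^'n^'n" assume A: "A \<noteq> 0" and B: "B \<noteq> 0"
  show "\<exists>k. \<not> (AE H in cpow \<mu> k. A ** H ** B = 0)"
  proof (rule ccontr)
    assume "\<not> ?thesis"
    then have 0: "AE H in cpow \<mu> k. A ** H ** B = 0" for k by blast
    define W where "W = {v. \<forall>k. AE H in cpow \<mu> k. A *v (H *v v) = 0}"
    have P: "Measurable.pred borel (\<lambda>H. A *v (H *v v) = 0)" for v
    proof -
      have "closed {H. A *v (H *v v) = 0}"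
        by (intro closed_Collect_eq continuous_on_matrix_vector_mult continuous_on_id continuous_on_const)
      then show ?thesis by (auto simp: pred_def dest: borel_closed)
    qed
    have W: "subspace W"
      unfolding subspace_def
    proof (intro conjI ballI allI)
      show "0 \<in> W" by (simp add: W_def)
      fix x y assume "x \<in> W" "y \<in> W"
      then have x: "AE H in cpow \<mu> k. A *v (H *v x) = 0" and y: "AE H in cpow \<mu> k. A *v (H *v y) = 0" for k
        by (auto simp: W_def)
      have "AE H in cpow \<mu> k. A *v (H *v (x + y)) = 0" for k
        using x[of k] y[of k] by eventually_elim (simp add: matrix_vector_right_distrib)
      then show "x + y \<in> W" by (simp add: W_def)
    next
      fix c x assume "x \<in> W"
      then have x: "AE H in cpow \<mu> k. A *v (H *v x) = 0" for k by (auto simp: W_def)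
      have "AE H in cpow \<mu> k. A *v (H *v (c *\<^sub>R x)) = 0" for k
        using x[of k] by eventually_elim (simp add: matrix_vector_mult_scaleR)
      then show "c *\<^sub>R x \<in> W" by (simp add: W_def)
    qed
    have AE_inv: "AE g in \<mu>. g *v v \<in> W" if v: "v \<in> W" for v
    proof -
      have "AE g in cpow \<mu> 1. AE H in cpow \<mu> k. A *v (H ** g *v v) = 0" for k
      proof -
        have "AE H in cpow \<mu> (k + 1). A *v (H *v v) = 0" using v unfolding W_def by blast
        then show ?thesis unfolding AE_cpow_add'[OF P] .
      qed
      then have "AE g in cpow \<mu> 1. \<forall>k. AE H in cpow \<mu> k. A *v (H ** g *v v) = 0"
        by (simp only: AE_all_countable) simp
      then have "AE g in cpow \<mu> 1. g *v v \<in> W"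
        by eventually_elim (simp add: W_def matrix_vector_mul_assoc matrix_mul_assoc)
      moreover have "Measurable.pred borel (\<lambda>g. g *v v \<in> W)"
      proof -
        have "closed ((\<lambda>g :: real^'n^'n. g *v v) -` W)"
          by (intro closed_vimage closed_subspace W continuous_on_matrix_vector_mult continuous_on_id continuous_on_const)
        then show ?thesis by (auto simp: pred_def vimage_def dest: borel_closed)
      qed
      ultimately show ?thesis using AE_cpow_1 by blast
    qed
    \<comment> \<open>The exceptional null set depends on \<open>v\<close>; a finite basis provides
      one that serves for all \<open>v\<close> in \<open>W\<close>.\<close>
    obtain Bs where Bs: "Bs \<subseteq> W" "independent Bs" "W \<subseteq> span Bs" by (rule basis_exists[of W]) auto
    have "finite Bs" using Bs(2) by (rule independent_imp_finite)
    then have "AE g in \<mu>. \<forall>b\<in>Bs. g *v b \<in> W"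
      using AE_inv Bs(1) by (subst AE_ball_countable) (auto intro: countable_finite)
    then have "AE g in \<mu>. g \<in> {g. \<forall>v\<in>W. g *v v \<in> W}"
    proof eventually_elim
      case (elim g)
      have "(*v) g ` span Bs = span ((*v) g ` Bs)"
        by (rule linear_span_image[symmetric]) (rule matrix_vector_mul_linear)
      also have "\<dots> \<subseteq> W" using elim W by (intro span_minimal) auto
      finally show ?case using Bs(3) by blast
    qed
    then have inv: "Gamma \<mu> \<subseteq> {g. \<forall>v\<in>W. g *v v \<in> W}"
      by (intro Gamma_subset closed_subspace_invariant W) (simp_all add: matrix_vector_mul_assoc[symmetric])
    have "W \<noteq> {0}"
    proof -
      obtain i j where ij: "B $ i $ j \<noteq> 0" using B by (auto simp: vec_eq_iff)
      have "(B *v axis j 1) $ i \<noteq> 0" using ij by (simp add: matrix_vector_mult_basis column_def)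
      then have "B *v axis j 1 \<noteq> 0" by (metis zero_index)
      moreover have "AE H in cpow \<mu> k. A *v (H *v (B *v axis j 1)) = 0" for k
        using 0[of k] by eventually_elim (simp add: matrix_vector_mul_assoc matrix_mul_assoc)
      then have "B *v axis j 1 \<in> W" by (simp add: W_def)
      ultimately show ?thesis by blast
    qed
    moreover have "W \<noteq> UNIV"
    proof
      assume "W = UNIV"
      have "A *v v = 0" for v
      proof -
        have "AE H in cpow \<mu> 0. A *v (H *v v) = 0" using \<open>W = UNIV\<close> unfolding W_def by blast
        then show ?thesis unfolding cpow.simps(1) by (subst (asm) AE_return[OF _ P]) simp_all
      qed
      then show False using A by (metis matrix_eq matrix_vector_mult_0)
    qed
    ultimately show False
      using strongly_irreducible_subspace[OF irr W] inv by blast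
  qed
qed (auto simp: matrix_law_axioms)

lemma open_strictly_positive: "open {A :: real^'n^'n. strictly_positive_matrix A}"
proof -
  have "{A :: real^'n^'n. strictly_positive_matrix A} = (\<Inter>i. \<Inter>j. {A. 0 < A $ i $ j})"
    by (auto simp: strictly_positive_matrix_def)
  moreover have "open {A :: real^'n^'n. 0 < A $ i $ j}" for i j
    by (intro open_Collect_less continuous_on_const bounded_linear.continuous_on[OF bounded_linear_entry] continuous_on_id)
  ultimately show ?thesis by (simp add: open_INT)
qed

lemma closed_positive: "closed {A :: real^'n^'n. positive_matrix A}"
  unfolding positive_matrix_def
  by (intro closed_Collect_all closed_Collect_le continuous_on_const bounded_linear.continuous_on[OF bounded_linear_entry] continuous_on_id)

lemma positive_matrix_mult: "positive_matrix A \<Longrightarrow> positive_matrix B \<Longrightarrow> positive_matrix (A ** B)"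
  unfolding positive_matrix_def matrix_matrix_mult_def by (auto intro!: sum_nonneg)

lemma positive_mult_entry_pos:
  assumes "positive_matrix A" "positive_matrix B" "0 < A $ i $ k" "0 < B $ k $ j"
  shows "0 < (A ** B) $ i $ j"
  unfolding matrix_matrix_mult_def vec_lambda_beta
  by (rule sum_pos2[of _ k]) (use assms in \<open>auto simp: positive_matrix_def\<close>)

lemma positive_nonzero_entry: "positive_matrix A \<Longrightarrow> A \<noteq> 0 \<Longrightarrow> \<exists>i j. 0 < A $ i $ j"
  unfolding positive_matrix_def vec_eq_iff by (metis less_eq_real_def zero_index)

text \<open>The strictly positive matrices form an open set that meets \<open>Gamma \<mu>\<close>,
  hence the support of some convolution power. Such products have positive probability and connect
  any two nonzero positive matrices. Left multiplication does not annihilate because every column of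
  an allowable matrix has a positive entry.\<close>

lemma (in matrix_law) cone_law_positive:
  assumes all: "\<forall>A\<in>Gamma \<mu>. allowable A" and sp: "\<exists>A\<in>Gamma \<mu>. strictly_positive_matrix A"
  shows "cone_law \<mu> {A. positive_matrix A}"
proof (intro cone_law.intro cone_law_axioms.intro)
  have AE: "AE A in \<mu>. allowable A"
    using AE_measure_support[OF sets_law]
    by eventually_elim (use all measure_support_subset_Gamma in blast)
  show "AE A in \<mu>. A \<in> {A. positive_matrix A}"
    using AE by eventually_elim (simp add: allowable_def)
  fix A :: "real^'n^'n" assume A: "A \<in> {A. positive_matrix A}" "A \<noteq> 0"
  then obtain a b where ab: "0 < A $ a $ b" using positive_nonzero_entry by blast
  show "AE H in \<mu>. H ** A \<noteq> 0"
    using AE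
  proof eventually_elim
    case (elim H)
    then obtain i where "0 < H $ i $ a" by (auto simp: allowable_def)
    then have "0 < (H ** A) $ i $ b"
      using elim A ab by (intro positive_mult_entry_pos) (auto simp: allowable_def)
    then show ?case by (intro notI) simp
  qed
next
  fix A B :: "real^'n^'n"
  assume AB: "A \<in> {A. positive_matrix A}" "B \<in> {A. positive_matrix A}" "A \<noteq> 0" "B \<noteq> 0"
  let ?P = "{A :: real^'n^'n. strictly_positive_matrix A}"
  obtain h where h: "h \<in> Gamma \<mu>" "h \<in> ?P" using sp by auto
  then have "?P \<inter> (\<Union>n\<in>{1..}. measure_support (cpow \<mu> n)) \<noteq> {}"
    using Gamma_subset_closure open_Int_closure_eq_empty[OF open_strictly_positive] by blast
  then obtain n H0 where n: "H0 \<in> measure_support (cpow \<mu> n)" "H0 \<in> ?P" by blast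
  then have pos: "0 < emeasure (cpow \<mu> n) ?P"
    using open_strictly_positive by (auto simp: measure_support_def)
  obtain a b where ab: "0 < A $ a $ b" using AB positive_nonzero_entry by blast
  obtain c d where cd: "0 < B $ c $ d" using AB positive_nonzero_entry by blast
  have "\<not> (AE H in cpow \<mu> n. A ** H ** B = 0)"
  proof
    assume "AE H in cpow \<mu> n. A ** H ** B = 0"
    then have "AE H in cpow \<mu> n. H \<notin> ?P"
    proof eventually_elim
      case (elim H)
      show ?case
      proof
        assume "H \<in> ?P"
        then have H: "positive_matrix H" "0 < H $ b $ c"
          by (auto simp: strictly_positive_matrix_def positive_matrix_def less_imp_le)
        have "0 < (A ** H ** B) $ a $ d"
          using AB H ab cd by (intro positive_mult_entry_pos[of _ _ _ c] positive_matrix_mult positive_mult_entry_pos[of _ _ _ b]) auto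
        with elim show False by simp
      qed
    qed
    then have "emeasure (cpow \<mu> n) ?P = 0"
      using AE_iff_measurable[of ?P "cpow \<mu> n" "\<lambda>H. H \<notin> ?P"] borel_open[OF open_strictly_positive] by simp
    with pos show False by simp
  qed
  then show "\<exists>k. \<not> (AE H in cpow \<mu> k. A ** H ** B = 0)" by blast
next
  show "mat 1 \<in> {A :: real^'n^'n. positive_matrix A}" by (simp add: positive_matrix_def mat_def)
  show "c *\<^sub>R A \<in> {A. positive_matrix A}" if "0 \<le> c" "A \<in> {A. positive_matrix A}" for c and A :: "real^'n^'n"
    using that by (auto simp: positive_matrix_def)
qed (auto simp: matrix_law_axioms closed_positive positive_matrix_mult)

text \<open>The normalisation is applied to each convolution power and not to elements of
  \<open>Gamma \<mu>\<close>, since a matrix alone does not determine its length as a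
  product.\<close>

definition nsem :: "(real^'n^'n) measure \<Rightarrow> real \<Rightarrow> (real^'n^'n) set" where
  "nsem \<mu> q = closure (\<Union>n\<in>{1..}. (\<lambda>H. exp (- (real n * q)) *\<^sub>R H) ` measure_support (cpow \<mu> n))"

section \<open>Degeneration of the normalised semigroup\<close>

context matrix_law begin

lemma nsem_memI: "1 \<le> n \<Longrightarrow> H \<in> measure_support (cpow \<mu> n) \<Longrightarrow> exp (- (real n * q)) *\<^sub>R H \<in> nsem \<mu> q"
  unfolding nsem_def by (rule subsetD[OF closure_subset]) auto

lemma bounded_semigroup_nsem:
  assumes \<eta>: "0 < \<eta>"
    and bd: "\<And>n. AE H in cpow \<mu> n. mnorm H \<le> C * exp (real n * q)"
    and lb: "\<And>n. AE H in cpow \<mu> n. \<eta> * exp (real n * q) \<le> mnorm H"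
  shows "bounded_semigroup (nsem \<mu> q) \<eta> C"
proof
  let ?S = "\<Union>n\<in>{1..}. (\<lambda>H. exp (- (real n * q)) *\<^sub>R H) ` measure_support (cpow \<mu> n)"
  have "?S \<subseteq> {A. \<eta> \<le> mnorm A} \<inter> {A. mnorm A \<le> C}"
  proof
    fix X assume "X \<in> ?S"
    then obtain n H where H: "H \<in> measure_support (cpow \<mu> n)" "X = exp (- (real n * q)) *\<^sub>R H" by auto
    have "closed ({A :: real^'n^'n. \<eta> * exp (real n * q) \<le> mnorm A} \<inter> {A. mnorm A \<le> C * exp (real n * q)})"
      by (intro closed_Int closed_Collect_le continuous_on_const continuous_on_mnorm continuous_on_id)
    moreover have "AE H in cpow \<mu> n. H \<in> {A. \<eta> * exp (real n * q) \<le> mnorm A} \<inter> {A. mnorm A \<le> C * exp (real n * q)}"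
      using bd[of n] lb[of n] by eventually_elim simp
    ultimately have "measure_support (cpow \<mu> n) \<subseteq> {A. \<eta> * exp (real n * q) \<le> mnorm A} \<inter> {A. mnorm A \<le> C * exp (real n * q)}"
      by (rule measure_support_subset[OF sets_cpow])
    with H(1) have "\<eta> * exp (real n * q) \<le> mnorm H" "mnorm H \<le> C * exp (real n * q)" by auto
    then show "X \<in> {A. \<eta> \<le> mnorm A} \<inter> {A. mnorm A \<le> C}"
      unfolding H(2) by (simp add: mnorm_scaleR exp_minus field_simps)
  qed
  then have "nsem \<mu> q \<subseteq> {A. \<eta> \<le> mnorm A} \<inter> {A. mnorm A \<le> C}"
    unfolding nsem_def
    by (rule closure_minimal) (intro closed_Int closed_Collect_le continuous_on_const continuous_on_mnorm continuous_on_id)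
  then show "\<And>A. A \<in> nsem \<mu> q \<Longrightarrow> \<eta> \<le> mnorm A" "\<And>A. A \<in> nsem \<mu> q \<Longrightarrow> mnorm A \<le> C" by auto
  have S_mult: "A ** B \<in> ?S" if AB: "A \<in> ?S" "B \<in> ?S" for A B
  proof -
    obtain m A' where m: "m \<ge> 1" "A' \<in> measure_support (cpow \<mu> m)" "A = exp (- (real m * q)) *\<^sub>R A'" using AB(1) by auto
    obtain n B' where n: "n \<ge> 1" "B' \<in> measure_support (cpow \<mu> n)" "B = exp (- (real n * q)) *\<^sub>R B'" using AB(2) by auto
    have "A ** B = exp (- (real (m + n) * q)) *\<^sub>R (A' ** B')"
      by (simp add: m n mult_left_scaleR_matrix mult_right_scaleR_matrix exp_add[symmetric] algebra_simps)
    then show ?thesis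
      using measure_support_cpow_mult[OF m(2) n(2)] m(1) by (intro UN_I[of "m + n"] image_eqI[of _ _ "A' ** B'"]) auto
  qed
  show "A ** B \<in> nsem \<mu> q" if "A \<in> nsem \<mu> q" "B \<in> nsem \<mu> q" for A B
    using that unfolding nsem_def
  proof (rule closure_closed_under_mult[rotated])
    show "A ** B \<in> ?S" if "A \<in> ?S" "B \<in> ?S" for A B by (rule S_mult[OF that])
  qed
qed (use \<eta> in \<open>auto simp: nsem_def\<close>)

text \<open>Products approximating \<open>g\<close> are normalised by their lengths. By compactness
  they converge along a subsequence to a nonzero limit, so the normalising factors converge as well;
  for \<open>q \<noteq> 0\<close> the integer lengths are therefore eventually constant, and for
  \<open>q = 0\<close> they do not matter.\<close>

lemma Gamma_nsem:
  assumes bs: "bounded_semigroup (nsem \<mu> q) \<eta> C" and g: "g \<in> Gamma \<mu>" "g \<noteq> 0"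
  obtains n :: nat where "exp (- (real n * q)) *\<^sub>R g \<in> nsem \<mu> q"
proof -
  interpret bounded_semigroup "nsem \<mu> q" \<eta> C by (rule bs)
  have "g \<in> closure (\<Union>n\<in>{1..}. measure_support (cpow \<mu> n))" using Gamma_subset_closure g by blast
  then obtain w where w: "\<And>j. w j \<in> (\<Union>n\<in>{1..}. measure_support (cpow \<mu> n))" "w \<longlonglongrightarrow> g"
    unfolding closure_sequential by blast
  then have "\<exists>n. n \<ge> 1 \<and> w j \<in> measure_support (cpow \<mu> n)" for j by (meson UN_E atLeast_iff)
  then obtain N where N: "\<And>j. 1 \<le> N j" "\<And>j. w j \<in> measure_support (cpow \<mu> (N j))" by metis
  define X where "X j = exp (- (real (N j) * q)) *\<^sub>R w j" for j
  have "X j \<in> nsem \<mu> q" for j unfolding X_def by (rule nsem_memI[OF N])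
  then obtain Y r where Y: "Y \<in> nsem \<mu> q" "strict_mono r" "(\<lambda>j. X (r j)) \<longlonglongrightarrow> Y" by (rule T_subseq)
  have wr: "(\<lambda>j. w (r j)) \<longlonglongrightarrow> g" by (rule LIMSEQ_subseq_LIMSEQ[OF w(2) Y(2), unfolded o_def])
  have "\<exists>n. Y = exp (- (real n * q)) *\<^sub>R g"
  proof (cases "q = 0")
    case True
    then have "Y = g" using LIMSEQ_unique[OF Y(3)] wr by (simp add: X_def)
    then show ?thesis using True by simp
  next
    case False
    have g0: "0 < mnorm g" and Y0: "0 < mnorm Y" using g(2) T_nonzero[OF Y(1)] by auto
    have "(\<lambda>j. mnorm (X (r j)) / mnorm (w (r j))) \<longlonglongrightarrow> mnorm Y / mnorm g"
      by (intro tendsto_divide tendsto_mnorm Y(3) wr) (use g0 in simp)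
    moreover have "w j \<noteq> 0" for j using T_nonzero[OF \<open>\<And>j. X j \<in> nsem \<mu> q\<close>, of j] by (auto simp: X_def)
    then have "mnorm (X j) / mnorm (w j) = exp (- (real (N j) * q))" for j by (simp add: X_def mnorm_scaleR)
    ultimately have "(\<lambda>j. exp (- (real (N (r j)) * q))) \<longlonglongrightarrow> mnorm Y / mnorm g" by simp
    then have "(\<lambda>j. ln (exp (- (real (N (r j)) * q)))) \<longlonglongrightarrow> ln (mnorm Y / mnorm g)"
      by (rule tendsto_ln) (use g0 Y0 in simp)
    then have "(\<lambda>j. - (real (N (r j)) * q) / (- q)) \<longlonglongrightarrow> ln (mnorm Y / mnorm g) / (- q)"
      by (intro tendsto_divide tendsto_const) (use False in simp_all)
    then have "(\<lambda>j. real (N (r j))) \<longlonglongrightarrow> ln (mnorm Y / mnorm g) / (- q)" using False by simp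
    then have "Cauchy (\<lambda>j. real (N (r j)))" by (rule LIMSEQ_imp_Cauchy)
    then obtain j0 where j0: "\<And>i j. i \<ge> j0 \<Longrightarrow> j \<ge> j0 \<Longrightarrow> dist (real (N (r i))) (real (N (r j))) < 1"
      unfolding Cauchy_def by (metis zero_less_one)
    have const: "N (r j) = N (r j0)" if "j \<ge> j0" for j
      using j0[OF that order_refl] by (simp add: dist_real_def)
    have "(\<lambda>j. exp (- (real (N (r j0)) * q)) *\<^sub>R w (r j)) \<longlonglongrightarrow> exp (- (real (N (r j0)) * q)) *\<^sub>R g"
      by (rule tendsto_scaleR[OF tendsto_const wr])
    moreover have "\<forall>\<^sub>F j in sequentially. exp (- (real (N (r j0)) * q)) *\<^sub>R w (r j) = X (r j)"
      using eventually_ge_at_top[of j0]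
    proof eventually_elim
      case (elim j)
      show ?case unfolding X_def const[OF elim] ..
    qed
    ultimately have "(\<lambda>j. X (r j)) \<longlonglongrightarrow> exp (- (real (N (r j0)) * q)) *\<^sub>R g"
      by (rule Lim_transform_eventually)
    then have "Y = exp (- (real (N (r j0)) * q)) *\<^sub>R g" by (rule LIMSEQ_unique[OF Y(3)])
    then show ?thesis by blast
  qed
  with Y(1) show ?thesis using that by auto
qed

text \<open>The orbit of \<open>u\<close> is finite for the following reason. The common kernel
  \<open>N\<close> of the functionals \<open>f v* g\<close> is invariant and does not contain
  \<open>u\<close>, so irreducibility makes it zero and the functionals span. A basis chosen among
  them takes only the values 1 and -1 on the orbit, whose points are thus determined by finitely
  many signs.\<close>

lemma degenerate_if_irreducible_proximal:
  assumes bs: "bounded_semigroup (nsem \<mu> q) \<eta> C"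
    and irr: "strongly_irreducible (Gamma \<mu>)" and prox: "P \<in> Gamma \<mu>" "proximal P"
  shows "CARD('n) = 1"
proof (rule ccontr)
  assume card: "CARD('n) \<noteq> 1"
  interpret bounded_semigroup "nsem \<mu> q" \<eta> C by (rule bs)
  let ?T = "nsem \<mu> q"
  obtain i j :: 'n where ij: "i \<noteq> j"
  proof -
    have "\<not> (\<forall>i j :: 'n. i = j)"
    proof
      assume *: "\<forall>i j :: 'n. i = j"
      obtain i :: 'n where True by simp
      have "(UNIV :: 'n set) = {i}" using * by auto
      with card show False by (metis card_1_singleton_iff One_nat_def)
    qed
    then show ?thesis using that by blast
  qed
  \<comment> \<open>The zero matrix has the whole space as eigenspace of 0, which is not a simple
    eigenvalue in dimension at least two.\<close>
  have "P \<noteq> 0"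
  proof
    assume P: "P = 0"
    obtain z where z: "dominant_eigenvalue P z" "order z (charpoly P) = 1" using prox by (auto simp: proximal_def)
    have C0: "complexify P *v v = 0" for v by (simp add: P complexify_def matrix_vector_mult_def vec_eq_iff)
    then have z0: "z = 0" using z(1) by (auto simp: dominant_eigenvalue_def is_eigenvalue_def)
    have "complexify P *v v = z *s v" for v by (simp add: C0 z0)
    from simple_eigenspace[OF z this this, of "axis i 1" i "axis j 1" j] ij show False by (simp add: axis_def)
  qed
  then obtain n where "exp (- (real n * q)) *\<^sub>R P \<in> ?T" by (rule Gamma_nsem[OF bs prox(1)])
  then obtain u f where uf: "outer u f \<in> ?T" by (rule proximal_outer[OF prox(2) exp_gt_zero])
  have one: "\<bar>f \<bullet> (g *v u)\<bar> = 1" if "g \<in> ?T" for g by (rule abs_inner_outer_eq_1[OF uf that])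
  define N where "N = {x. \<forall>g\<in>?T. f \<bullet> (g *v x) = 0}"
  have subN: "subspace N"
    by (auto simp: N_def subspace_def matrix_vector_right_distrib matrix_vector_mult_scaleR inner_add_right)
  have invN: "A *v x \<in> N" if A: "A \<in> Gamma \<mu>" and x: "x \<in> N" for A x
  proof (cases "A = 0")
    case True
    then show ?thesis using subN by (simp add: subspace_0)
  next
    case False
    then obtain n where n: "exp (- (real n * q)) *\<^sub>R A \<in> ?T" by (rule Gamma_nsem[OF bs A])
    have "f \<bullet> (g *v (A *v x)) = 0" if g: "g \<in> ?T" for g
    proof -
      have "f \<bullet> ((g ** (exp (- (real n * q)) *\<^sub>R A)) *v x) = 0" using x T_mult[OF g n] by (simp add: N_def)
      then show ?thesis
        by (simp add: mult_right_scaleR_matrix scaleR_matrix_vector_assoc[symmetric] matrix_vector_mul_assoc)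
    qed
    then show ?thesis by (simp add: N_def)
  qed
  have "u \<notin> N"
  proof
    assume "u \<in> N"
    then have "f \<bullet> (outer u f *v u) = 0" using uf by (simp add: N_def)
    with one[OF uf] show False by simp
  qed
  then have "N \<noteq> UNIV" by auto
  have N0: "N = {0}"
  proof (rule ccontr)
    assume "N \<noteq> {0}"
    then show False
      using strongly_irreducible_subspace[OF irr subN invN] \<open>N \<noteq> UNIV\<close> by blast
  qed
  define S where "S = (\<lambda>g. f v* g) ` ?T"
  have spanS: "span S = UNIV"
  proof (rule ccontr)
    assume "span S \<noteq> UNIV"
    then obtain a where a: "a \<noteq> 0" "\<forall>x\<in>span S. a \<bullet> x = 0" using span_not_UNIV_orthogonal by blast
    have "f \<bullet> (g *v a) = 0" if "g \<in> ?T" for g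
    proof -
      have "f v* g \<in> span S" using that by (intro span_base) (simp add: S_def)
      then show ?thesis using a(2) dot_lmul_matrix[of f g a] inner_commute[of a "f v* g"] by simp
    qed
    then have "a \<in> N" by (simp add: N_def)
    with a N0 show False by simp
  qed
  obtain Bs where Bs: "Bs \<subseteq> S" "independent Bs" "S \<subseteq> span Bs" by (rule basis_exists[of S]) auto
  have finB: "finite Bs" using Bs(2) by (rule independent_imp_finite)
  have spanB: "span Bs = UNIV" using Bs(3) spanS span_mono[OF Bs(3)] by (simp add: span_span top.extremum_unique)
  let ?U = "(\<lambda>g. g *v u) ` ?T"
  have val: "b \<bullet> x \<in> {-1, 1}" if b: "b \<in> Bs" and x: "x \<in> ?U" for b x
  proof -
    obtain g h where "g \<in> ?T" "h \<in> ?T" "b = f v* g" "x = h *v u" using b x Bs(1) by (auto simp: S_def)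
    then have "\<bar>b \<bullet> x\<bar> = 1" using one[OF T_mult, of g h] by (simp add: dot_lmul_matrix matrix_vector_mul_assoc)
    then show ?thesis by auto
  qed
  have "inj_on (\<lambda>x. \<lambda>b\<in>Bs. b \<bullet> x) ?U"
  proof (rule inj_onI)
    fix x y assume eq: "(\<lambda>b\<in>Bs. b \<bullet> x) = (\<lambda>b\<in>Bs. b \<bullet> y)"
    have orth: "orthogonal (x - y) b" if b: "b \<in> Bs" for b
      using fun_cong[OF eq, of b] b by (simp add: orthogonal_def inner_diff_left inner_commute[of x b] inner_commute[of y b])
    have "x - y \<in> span Bs" by (simp add: spanB)
    then have "orthogonal (x - y) (x - y)" by (rule orthogonal_to_span) (rule orth)
    then show "x = y" by (simp add: orthogonal_def)
  qed
  moreover have "finite ((\<lambda>x. \<lambda>b\<in>Bs. b \<bullet> x) ` ?U)"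
  proof (rule finite_subset)
    show "(\<lambda>x. \<lambda>b\<in>Bs. b \<bullet> x) ` ?U \<subseteq> (\<Pi>\<^sub>E b\<in>Bs. {-1, 1::real})" using val by fastforce
    show "finite (\<Pi>\<^sub>E b\<in>Bs. {-1, 1::real})" by (intro finite_PiE finB) auto
  qed
  ultimately have finU: "finite ?U" by (rule finite_imageD[rotated])
  define F where "F = (\<lambda>x. span {x}) ` ?U"
  have x0: "x \<noteq> 0" if x: "x \<in> ?U" for x
  proof
    assume "x = 0"
    moreover obtain g where "g \<in> ?T" "x = g *v u" using x by auto
    ultimately show False using one[of g] by simp
  qed
  have "\<exists>F. finite F \<and> F \<noteq> {} \<and> (\<forall>W\<in>F. subspace W \<and> W \<noteq> {0} \<and> W \<noteq> UNIV) \<and>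
      (\<forall>A\<in>Gamma \<mu>. (\<lambda>x. A *v x) ` (\<Union>F) \<subseteq> \<Union>F)"
  proof (intro exI[of _ F] conjI ballI)
    show "finite F" using finU by (simp add: F_def)
    show "F \<noteq> {}" using uf by (auto simp: F_def)
    fix W assume "W \<in> F"
    then obtain x where x: "x \<in> ?U" "W = span {x}" by (auto simp: F_def)
    show "subspace W" by (simp add: x)
    show "W \<noteq> {0}" using x0[OF x(1)] x(2) span_base[of x "{x}"] by auto
    have "dim W \<le> 1" unfolding x(2) dim_span using dim_le_card'[of "{x}"] by simp
    moreover have "2 \<le> CARD('n)"
      using card_mono[of UNIV "{i, j}"] ij by simp
    ultimately show "W \<noteq> UNIV" by (auto simp: dim_UNIV)
  next
    fix A assume A: "A \<in> Gamma \<mu>"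
    show "(\<lambda>x. A *v x) ` (\<Union>F) \<subseteq> \<Union>F"
    proof
      fix y assume "y \<in> (\<lambda>x. A *v x) ` (\<Union>F)"
      then obtain g c where gc: "g \<in> ?T" "y = A *v (c *\<^sub>R (g *v u))" by (auto simp: F_def span_singleton)
      show "y \<in> \<Union>F"
      proof (cases "A = 0")
        case True
        then have "y = 0" using gc by simp
        then show ?thesis using uf by (auto simp: F_def intro!: bexI[of _ "outer u f"] span_zero)
      next
        case False
        then obtain n where n: "exp (- (real n * q)) *\<^sub>R A \<in> ?T" by (rule Gamma_nsem[OF bs A])
        let ?r = "exp (- (real n * q))"
        have "y = (c / ?r) *\<^sub>R (((?r *\<^sub>R A) ** g) *v u)"
          by (simp add: gc matrix_vector_mult_scaleR mult_left_scaleR_matrix scaleR_matrix_vector_assoc[symmetric] matrix_vector_mul_assoc)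
        then show ?thesis
          using T_mult[OF n gc(1)] by (auto simp: F_def span_singleton intro!: bexI[of _ "(?r *\<^sub>R A) ** g"])
      qed
    qed
  qed
  with irr show False unfolding strongly_irreducible_def by blast
qed

end

text \<open>On the positive cone the modulus in the relation for \<open>f\<close> disappears, so
  \<open>f\<close> is constant on the orbit of \<open>u\<close>. The closed set \<open>X\<close> of
  points at which all of \<open>nsem \<mu> q\<close> preserves \<open>f\<close> contains the Perron
  vectors, hence \<open>V_set (Gamma \<mu>)\<close>. On it an element of \<open>Gamma \<mu>\<close>
  adds some \<open>n * q\<close> to the logarithm of \<open>f\<close>, and a multiple of that
  logarithm serves as \<open>\<theta>\<close>.\<close>

lemma (in matrix_law) arithmetic_if_bounded:
  assumes bs: "bounded_semigroup (nsem \<mu> q) \<eta> C"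
    and all: "\<forall>A\<in>Gamma \<mu>. allowable A" and sp: "\<exists>A\<in>Gamma \<mu>. strictly_positive_matrix A"
  shows "arithmetic \<mu>"
proof -
  interpret bounded_semigroup "nsem \<mu> q" \<eta> C by (rule bs)
  interpret cone_law \<mu> "{A. positive_matrix A}" by (rule cone_law_positive[OF all sp])
  let ?T = "nsem \<mu> q"
  have supp: "measure_support (cpow \<mu> n) \<subseteq> {A. positive_matrix A}" for n
    by (rule measure_support_subset[OF sets_cpow closed_positive AE_cpow_CA])
  have "?T \<subseteq> {A. positive_matrix A}"
    unfolding nsem_def
  proof (rule closure_minimal[OF _ closed_positive], rule UN_least, rule image_subsetI)
    fix n H assume "H \<in> measure_support (cpow \<mu> n)"
    then show "exp (- (real n * q)) *\<^sub>R H \<in> {A. positive_matrix A}"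
      using supp[of n] by (auto simp: positive_matrix_def)
  qed
  then have pos: "positive_matrix A" if "A \<in> ?T" for A using that by blast
  have Gamma0: "A \<noteq> 0" if "A \<in> Gamma \<mu>" for A
  proof
    assume "A = 0"
    then show False using all that by (auto simp: allowable_def)
  qed
  have Gamma_T: "\<exists>n::nat. exp (- (real n * q)) *\<^sub>R A \<in> ?T" if "A \<in> Gamma \<mu>" for A
    by (rule Gamma_nsem[OF bs that Gamma0[OF that]]) (rule exI)
  obtain A0 n0 where A0: "exp (- (real n0 * q)) *\<^sub>R A0 \<in> ?T" "strictly_positive_matrix A0"
    using sp Gamma_T by blast
  then have sp0: "strictly_positive_matrix (exp (- (real n0 * q)) *\<^sub>R A0)"
    by (simp add: strictly_positive_matrix_def)
  obtain u f where uf: "outer u f \<in> ?T" and u: "\<And>i. 0 < u $ i" and f: "\<And>i. 0 < f $ i"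
    by (rule strictly_positive_outer[OF pos A0(1) sp0], assumption, rule that)
  have f_nonneg: "0 \<le> f \<bullet> x" if "\<And>i. 0 \<le> x $ i" for x
    unfolding inner_vec_def using that f by (auto intro!: sum_nonneg mult_nonneg_nonneg intro: less_imp_le)
  have f_pos: "0 < f \<bullet> x" if "\<And>i. 0 \<le> x $ i" "x \<noteq> 0" for x
  proof -
    obtain j where "x $ j \<noteq> 0" using \<open>x \<noteq> 0\<close> by (auto simp: vec_eq_iff)
    then have "0 < x $ j" using that(1)[of j] by simp
    then show ?thesis
      unfolding inner_vec_def
      by (intro sum_pos2[of _ j]) (use that f in \<open>auto intro!: mult_nonneg_nonneg intro: less_imp_le\<close>)
  qed
  have mult_nonneg: "0 \<le> (g *v x) $ i" if "positive_matrix g" "\<And>i. 0 \<le> x $ i" for g :: "real^'n^'n" and x i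
    unfolding matrix_vector_mult_def vec_lambda_beta
    using that by (intro sum_nonneg mult_nonneg_nonneg) (auto simp: positive_matrix_def)
  have one: "f \<bullet> (g *v u) = 1" if g: "g \<in> ?T" for g
  proof -
    have "0 \<le> f \<bullet> (g *v u)" by (intro f_nonneg mult_nonneg pos g) (rule less_imp_le[OF u])
    with abs_inner_outer_eq_1[OF uf g] show ?thesis by simp
  qed
  have "u \<noteq> 0" using u by (metis less_irrefl zero_index)
  then have fu0: "0 < f \<bullet> u" by (intro f_pos less_imp_le[OF u])
  have "f \<bullet> (outer u f *v u) = 1" by (rule one[OF uf])
  then have "(f \<bullet> u)\<^sup>2 = 1" by (simp add: outer_mult_vector power2_eq_square)
  then have fu: "f \<bullet> u = 1" using fu0 by (auto simp: power2_eq_1_iff)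
  define X where "X = {x. \<forall>g\<in>?T. f \<bullet> (g *v x) = f \<bullet> x}"
  have uX: "u \<in> X" by (simp add: X_def one fu)
  have X_inv: "h *v x \<in> X" if h: "h \<in> ?T" and x: "x \<in> X" for h x
    using x T_mult[OF _ h] h by (simp add: X_def matrix_vector_mul_assoc)
  have "X = (\<Inter>g\<in>?T. {x. f \<bullet> (g *v x) = f \<bullet> x})" by (auto simp: X_def)
  moreover have "closed {x. f \<bullet> (g *v x) = f \<bullet> x}" for g
    by (intro closed_Collect_eq continuous_on_inner continuous_on_matrix_vector_mult continuous_on_const continuous_on_id)
  ultimately have X_closed: "closed X" by auto
  have PF: "v \<in> X \<and> v \<in> pos_sphere" if A: "A \<in> Gamma \<mu>" "strictly_positive_matrix A" and v: "perron_frobenius_vector A v" for A v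
  proof -
    obtain n where n: "exp (- (real n * q)) *\<^sub>R A \<in> ?T" using Gamma_T[OF A(1)] by blast
    define A' where "A' = exp (- (real n * q)) *\<^sub>R A"
    have A'T: "A' \<in> ?T" using n by (simp add: A'_def)
    have A'sp: "strictly_positive_matrix A'" using A(2) by (simp add: A'_def strictly_positive_matrix_def)
    have vs: "v \<in> pos_sphere" using v by (simp add: perron_frobenius_vector_def)
    then have v0: "\<And>i. 0 \<le> v $ i" "v \<noteq> 0" by (auto simp: pos_sphere_def)
    obtain r0 where "A *v v = r0 *\<^sub>R v" using v by (auto simp: perron_frobenius_vector_def)
    then have "A' *v v = (exp (- (real n * q)) * r0) *\<^sub>R v" by (simp add: A'_def scaleR_matrix_vector_assoc[symmetric])
    then obtain r where r: "A' *v v = r *\<^sub>R v" by blast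
    have rv: "0 < r * v $ i" for i
      using strictly_positive_mult_vector_pos[OF A'sp v0, of i] by (simp add: r)
    have vpos: "0 < v $ i" for i using rv[of i] v0(1)[of i] by (auto simp: zero_less_mult_iff)
    have rpos: "0 < r" using rv[of undefined] v0(1)[of undefined] by (auto simp: zero_less_mult_iff)
    have pw: "mpow A' k *v v = r ^ k *\<^sub>R v" for k
      by (induction k) (simp_all add: matrix_vector_mul_assoc[symmetric] matrix_vector_mult_scaleR r mult.commute)
    \<comment> \<open>The largest \<open>e\<close> for which \<open>v\<close> dominates
      \<open>e *\<^sub>R u\<close> coordinatewise. It prevents powers of \<open>A'\<close> from
      contracting \<open>v\<close>: as \<open>f\<close> equals 1 on the orbit of \<open>u\<close>,
      it is at least \<open>e\<close> on the images of \<open>v\<close>.\<close>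
    define e where "e = Min (range (\<lambda>i. v $ i / u $ i))"
    have e_le: "e \<le> v $ i / u $ i" for i unfolding e_def by (intro Min_le) auto
    have "e \<in> range (\<lambda>i. v $ i / u $ i)" unfolding e_def by (intro Min_in) auto
    then have e0: "0 < e" using vpos u by auto
    have ve: "0 \<le> (v - e *\<^sub>R u) $ i" for i using e_le[of i] u[of i] by (simp add: field_simps)
    have lower: "e \<le> r ^ k * (f \<bullet> v)" if "1 \<le> k" for k
    proof -
      have T: "mpow A' k \<in> ?T" by (rule mpow_in_T[OF A'T that])
      have "0 \<le> f \<bullet> (mpow A' k *v (v - e *\<^sub>R u))" by (intro f_nonneg mult_nonneg pos T ve)
      also have "\<dots> = r ^ k * (f \<bullet> v) - e"
        by (simp add: matrix_vector_mult_diff_distrib matrix_vector_mult_scaleR pw inner_diff_right one[OF T])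
      finally show ?thesis by simp
    qed
    have nv: "norm v = 1" using vs by (simp add: pos_sphere_def)
    have upper: "r ^ k \<le> C" if "1 \<le> k" for k
    proof -
      have "norm (mpow A' k *v v) \<le> mnorm (mpow A' k) * norm v" by (rule norm_matrix_vector_le)
      then show ?thesis using T_le[OF mpow_in_T[OF A'T that]] rpos by (simp add: pw nv)
    qed
    have "\<not> 1 < r"
    proof
      assume r1: "1 < r"
      then obtain k where "C < r ^ k" using real_arch_pow by blast
      also have "\<dots> \<le> r ^ Suc k" using r1 by (intro power_increasing) auto
      finally show False using upper[of "Suc k"] by simp
    qed
    moreover have "\<not> r < 1"
    proof
      assume r1: "r < 1"
      have "(\<lambda>k. r ^ k * (f \<bullet> v)) \<longlonglongrightarrow> 0 * (f \<bullet> v)"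
        by (intro tendsto_mult LIMSEQ_power_zero tendsto_const) (use r1 rpos in simp)
      moreover have "\<exists>N. \<forall>k\<ge>N. e \<le> r ^ k * (f \<bullet> v)" using lower by blast
      ultimately have "e \<le> 0 * (f \<bullet> v)" by (rule LIMSEQ_le_const)
      with e0 show False by simp
    qed
    ultimately have fixv: "A' *v v = v" using r by simp
    \<comment> \<open>The fixed vector \<open>v\<close> is recovered from \<open>u\<close>: both
      \<open>B *v u\<close> and \<open>v\<close> are fixed by the strictly positive
      \<open>E\<close>, hence proportional, and \<open>B *v u\<close> lies in
      \<open>X\<close>.\<close>
    obtain B E where B: "B \<in> ?T" and E: "strictly_positive_matrix E" "E ** B = B" "\<And>v. A' *v v = v \<Longrightarrow> E *v v = v"
      by (rule strictly_positive_limit[OF pos A'T A'sp], assumption, rule that)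
    have "E *v (B *v u) = B *v u" by (simp add: matrix_vector_mul_assoc E(2))
    then obtain t where t: "B *v u = t *\<^sub>R v"
      by (rule perron_unique[OF E(1) E(3)[OF fixv] vpos])
    have "t \<noteq> 0" using one[OF B] t by auto
    then have v: "v = (1 / t) *\<^sub>R (B *v u)" by (simp add: t)
    have "B *v u \<in> X" by (rule X_inv[OF B uX])
    then have "v \<in> X" unfolding v by (simp add: X_def matrix_vector_mult_scaleR)
    with vs show ?thesis by simp
  qed
  have "closed (pos_sphere :: (real^'n) set)"
  proof -
    have eq: "pos_sphere = sphere 0 1 \<inter> {x :: real^'n. \<forall>i. 0 \<le> x $ i}" by (auto simp: pos_sphere_def)
    have "closed {x :: real^'n. \<forall>i. 0 \<le> x $ i}"
      by (intro closed_Collect_all closed_Collect_le continuous_on_const bounded_linear.continuous_on[OF bounded_linear_vec_nth] continuous_on_id)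
    then show ?thesis unfolding eq by (rule closed_Int[OF closed_sphere])
  qed
  then have V: "V_set (Gamma \<mu>) \<subseteq> X \<inter> pos_sphere"
    unfolding V_set_def using PF X_closed by (intro closure_minimal closed_Int) auto
  \<comment> \<open>Turns the increments \<open>n * q\<close> into integer multiples of
    \<open>2 * pi\<close>; for \<open>q = 0\<close> they vanish and any positive \<open>t\<close>
    works. The phase \<open>\<beta>\<close> is 0.\<close>
  define t where "t = (if q = 0 then 1 else 2 * pi / \<bar>q\<bar>)"
  define \<theta> where "\<theta> x = t * ln (f \<bullet> x)" for x
  have "exp (\<i> * complex_of_real (t * ln (norm (A *v x)) - 0 + \<theta> (proj_act A x) - \<theta> x)) = 1"
    if A: "A \<in> Gamma \<mu>" and x: "x \<in> V_set (Gamma \<mu>)" for A x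
  proof -
    have xX: "x \<in> X" and xs: "x \<in> pos_sphere" using V x by auto
    then have "\<And>i. 0 \<le> x $ i" "x \<noteq> 0" by (auto simp: pos_sphere_def)
    then have fx: "0 < f \<bullet> x" by (rule f_pos)
    obtain n where n: "exp (- (real n * q)) *\<^sub>R A \<in> ?T" using Gamma_T[OF A] by blast
    have "f \<bullet> ((exp (- (real n * q)) *\<^sub>R A) *v x) = f \<bullet> x" using xX n by (simp add: X_def)
    then have fA: "f \<bullet> (A *v x) = exp (real n * q) * (f \<bullet> x)"
      by (simp add: scaleR_matrix_vector_assoc[symmetric] exp_minus field_simps)
    then have fA0: "0 < f \<bullet> (A *v x)" using fx by simp
    then have "A *v x \<noteq> 0" by auto
    then have nA: "0 < norm (A *v x)" by simp
    have "f \<bullet> proj_act A x = (f \<bullet> (A *v x)) / norm (A *v x)" by (simp add: proj_act_def divide_inverse mult.commute)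
    then have ln: "ln (f \<bullet> proj_act A x) = real n * q + ln (f \<bullet> x) - ln (norm (A *v x))"
      using nA fA0 fx by (simp add: ln_div) (simp add: fA ln_mult)
    have "t * ln (norm (A *v x)) - 0 + \<theta> (proj_act A x) - \<theta> x =
        t * (ln (norm (A *v x)) + ln (f \<bullet> proj_act A x) - ln (f \<bullet> x))"
      by (simp add: \<theta>_def right_diff_distrib distrib_left)
    also have "\<dots> = t * (real n * q)" unfolding ln by simp
    finally have eq: "t * ln (norm (A *v x)) - 0 + \<theta> (proj_act A x) - \<theta> x = t * (real n * q)" .
    have "\<exists>k::int. t * (real n * q) = of_int (2 * k) * pi"
    proof (cases "q = 0")
      case False
      then have "t * (real n * q) = of_int (2 * (int n * (if 0 < q then 1 else - 1))) * pi"
        by (simp add: t_def abs_if)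
      then show ?thesis by (rule exI)
    qed (auto simp: t_def intro: exI[of _ 0])
    then show ?thesis unfolding eq exp_eq_1 by simp
  qed
  moreover have "0 < t" by (simp add: t_def)
  ultimately show ?thesis
    unfolding arithmetic_def
    by (intro exI[of _ t] conjI exI[of _ 0] bexI[of _ 0] exI[of _ \<theta>] ballI) auto
qed

text \<open>In dimension one \<open>A\<close> itself has the form \<open>outer u f\<close>, so the
  relation for rank-one elements applies to it; it says that the square of its entry has modulus
  1.\<close>

lemma (in bounded_semigroup) mnorm_eq_1_if_one_dimensional:
  assumes card: "CARD('n) = 1" and A: "A \<in> T"
  shows "mnorm A = 1"
proof -
  obtain i :: 'n where U: "UNIV = {i}" using card by (metis card_1_singleton_iff One_nat_def)
  then have i: "j = i" for j by auto
  define e :: "real^'n" where "e = (\<chi> j. 1)"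
  have "A = outer (A *v e) e"
    using i by (simp add: outer_def e_def matrix_vector_mult_def U vec_eq_iff) (metis i)
  then have "\<bar>e \<bullet> (A *v (A *v e))\<bar> = 1" using abs_inner_outer_eq_1[of "A *v e" e A] A by simp
  then have "\<bar>A $ i $ i * A $ i $ i\<bar> = 1"
    by (simp add: e_def inner_vec_def matrix_vector_mult_def U)
  then have a: "\<bar>A $ i $ i\<bar> = 1" by (simp add: abs_mult abs_if split: if_splits) (auto simp: square_eq_1_iff)
  have "A = (A $ i $ i) *\<^sub>R mat 1" by (simp add: vec_eq_iff mat_def) (metis i)
  then have "mnorm A = \<bar>A $ i $ i\<bar> * 1" by (metis mnorm_scaleR mnorm_mat_1)
  with a show ?thesis by simp
qed

section \<open>The large deviation limit\<close>

context cone_law begin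

text \<open>Absence of fast blocks is an almost sure upper bound by a multiple of
  \<open>exp (n * q)\<close>; the tangent then forces a lower bound of the same order.\<close>

lemma fast_block_or_exact_order:
  assumes tan: "tangent \<mu> s q" and K: "connecting K c p"
  obtains m y where "0 < tail \<mu> m y" "real (K + m) * q < y + ln c"
  | \<eta> C where "bounded_semigroup (nsem \<mu> q) \<eta> C"
proof (cases "\<exists>m y. 0 < tail \<mu> m y \<and> real (K + m) * q < y + ln c")
  case False
  \<comment> \<open>The loss of one connection, with \<open>+ 1\<close> in the exponent for the
    strict inequality; the maximum with 1 provides the condition \<open>1 \<le> C\<close> of
    \<open>mnorm_exact_order\<close>.\<close>
  define C where "C = max 1 (exp (real K * q - ln c + 1))"
  have bd: "AE H in cpow \<mu> n. mnorm H \<le> C * exp (real n * q)" for n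
  proof -
    define y where "y = real (K + n) * q - ln c + 1"
    have "real (K + n) * q < y + ln c" by (simp add: y_def)
    with False have "\<not> 0 < tail \<mu> n y" by blast
    then have "tail \<mu> n y = 0" using tail_nonneg[of n y] by simp
    then have "AE H in cpow \<mu> n. \<not> exp y \<le> mnorm H"
      unfolding tail_def by (subst AE_iff_measurable[OF _ refl]) (auto simp: C.emeasure_eq_measure)
    then show ?thesis
    proof eventually_elim
      case (elim H)
      then have "mnorm H \<le> exp y" by simp
      also have "\<dots> = exp (real K * q - ln c + 1) * exp (real n * q)"
        by (simp add: y_def exp_add[symmetric] algebra_simps)
      also have "\<dots> \<le> C * exp (real n * q)" by (intro mult_right_mono) (auto simp: C_def)
      finally show ?case .
    qed
  qed
  have C: "1 \<le> C" by (simp add: C_def)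
  obtain \<eta> where \<eta>: "0 < \<eta>" "\<And>n. AE H in cpow \<mu> n. \<eta> * exp (real n * q) \<le> mnorm H"
    by (rule mnorm_exact_order[OF tan C bd], rule that)
  show ?thesis by (rule that(2)[OF bounded_semigroup_nsem[OF \<eta>(1) bd \<eta>(2)]])
qed (use that(1) in blast)

text \<open>Uniformity in \<open>l\<close> comes from monotonicity below and from Chebyshev above:
  once \<open>l_seq n < \<eta>\<close>, the tail at \<open>q + \<eta>\<close> bounds all tails at
  \<open>q + l\<close> from below, whereas the exponent of the upper bound exceeds its value at
  \<open>l = 0\<close> by at most \<open>s * l_seq n\<close> per factor.\<close>

lemma tail_rate_if_fast_block:
  assumes tan: "tangent \<mu> s q" and K: "connecting K c p"
    and fast: "0 < tail \<mu> m y" "real (K + m) * q < y + ln c"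
    and l: "l_seq \<longlonglongrightarrow> (0::real)" and \<epsilon>: "0 < \<epsilon>"
  shows "\<forall>\<^sub>F n in sequentially. \<forall>l. \<bar>l\<bar> \<le> l_seq n \<longrightarrow>
    \<bar>1 / real n * ln (tail \<mu> n (real n * (q + l))) - (Lam \<mu> s - s * q)\<bar> < \<epsilon>"
proof -
  have s: "0 < s" "s \<in> I_set \<mu>" using tan by (auto simp: tangent_def)
  define b where "b = Lam \<mu> s - s * q"
  obtain \<eta> where \<eta>: "0 < \<eta>"
    and low: "\<forall>\<^sub>F n in sequentially. exp (real n * (Lam \<mu> s - s * q - \<epsilon> / 2)) \<le> tail \<mu> n (real n * (q + \<eta>))"
    by (rule tail_ge_if_fast_block[OF tan K fast, of "\<epsilon> / 2"]) (use \<epsilon> in auto)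
  obtain D where D: "\<And>n x. tail \<mu> n x \<le> exp (real n * Lam \<mu> s - s * x + D)"
    by (rule tail_le[OF s(2)], rule that)
  have "(\<lambda>n. s * l_seq n + D / real n) \<longlonglongrightarrow> s * 0 + 0"
    by (intro tendsto_add tendsto_mult tendsto_const l lim_const_over_n)
  then have "\<forall>\<^sub>F n in sequentially. s * l_seq n + D / real n < \<epsilon>"
    using \<epsilon> by (intro order_tendstoD(2)) auto
  moreover have "\<forall>\<^sub>F n in sequentially. l_seq n < \<eta>" using l \<eta> by (rule order_tendstoD(2))
  ultimately show ?thesis
    using low eventually_gt_at_top[of 0]
  proof eventually_elim
    case (elim n)
    show ?case
    proof (intro allI impI)
      fix l assume l: "\<bar>l\<bar> \<le> l_seq n"
      let ?t = "tail \<mu> n (real n * (q + l))"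
      have n: "0 < real n" using elim by simp
      have "exp (real n * (b - \<epsilon> / 2)) \<le> tail \<mu> n (real n * (q + \<eta>))" using elim by (simp add: b_def)
      also have "\<dots> \<le> ?t" using l elim by (intro tail_antimono mult_left_mono) auto
      finally have lo: "exp (real n * (b - \<epsilon> / 2)) \<le> ?t" .
      then have t0: "0 < ?t" by (rule less_le_trans[OF exp_gt_zero])
      have "real n * (b - \<epsilon> / 2) \<le> ln ?t" using lo t0 by (simp add: ln_ge_iff)
      then have 1: "b - \<epsilon> / 2 \<le> 1 / real n * ln ?t" using n by (simp add: field_simps)
      have "- l \<le> l_seq n" using l by simp
      then have "s * (- l) \<le> s * l_seq n" using s by (intro mult_left_mono) auto
      then have "- (s * l) + D / real n < \<epsilon>" using elim(1) by simp
      then have "real n * (- (s * l) + D / real n) < real n * \<epsilon>" using n by (intro mult_strict_left_mono)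
      then have *: "- (real n * (s * l)) + D < real n * \<epsilon>" using n by (simp add: algebra_simps)
      have "ln ?t \<le> ln (exp (real n * Lam \<mu> s - s * (real n * (q + l)) + D))"
        using t0 by (intro ln_mono D) auto
      also have "\<dots> = real n * b - real n * (s * l) + D" by (simp add: b_def algebra_simps)
      also have "\<dots> < real n * b + real n * \<epsilon>" using * by simp
      finally have "1 / real n * ln ?t < b + \<epsilon>" using n by (simp add: field_simps)
      with 1 \<epsilon> show "\<bar>1 / real n * ln ?t - (Lam \<mu> s - s * q)\<bar> < \<epsilon>"
        unfolding b_def[symmetric] by (simp add: abs_less_iff)
    qed
  qed
qed

text \<open>Here the probabilities are \<open>0\<close> or \<open>1\<close>, so the convention \<open>ln 0 = 0\<close> is used.\<close>

lemma tail_rate_one_dimensional: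
  assumes tan: "tangent \<mu> s q" and card: "CARD('n) = 1"
    and bs: "bounded_semigroup (nsem \<mu> q) \<eta> C"
  shows "Lam \<mu> s - s * q = 0" and "1 \<le> n \<Longrightarrow> ln (tail \<mu> n x) = 0"
proof -
  interpret bounded_semigroup "nsem \<mu> q" \<eta> C by (rule bs)
  have s: "s \<in> I_set \<mu>" using tan by (simp add: tangent_def)
  have eq: "AE H in cpow \<mu> n. mnorm H = exp (real n * q)" if n: "1 \<le> n" for n
    using AE_measure_support[OF sets_cpow[of \<mu> n]]
  proof eventually_elim
    case (elim H)
    from mnorm_eq_1_if_one_dimensional[OF card nsem_memI[OF n elim]]
    show ?case by (simp add: mnorm_scaleR exp_minus field_simps)
  qed
  have mom: "mom \<mu> s n = ennreal (exp (real n * (s * q)))" if "1 \<le> n" for n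
  proof -
    have "mom \<mu> s n = (\<integral>\<^sup>+H. ennreal (exp (real n * (s * q))) \<partial>cpow \<mu> n)"
      unfolding mom_def by (rule nn_integral_cong_AE, use eq[OF that] in eventually_elim) (simp add: powr_def mult_ac)
    then show ?thesis using C.emeasure_space_1[of n] by simp
  qed
  obtain D where D: "\<And>n. mom \<mu> s n \<le> ennreal (exp (real n * Lam \<mu> s + D))"
      "\<And>n. ennreal (exp (real n * Lam \<mu> s - D)) \<le> mom \<mu> s n"
    by (rule mom_bounds[OF s], rule that)
  have "Lam \<mu> s \<le> s * q"
  proof (rule linear_lower_bound)
    show "\<forall>\<^sub>F n in sequentially. real n * Lam \<mu> s - D \<le> real n * (s * q)"
      using eventually_ge_at_top[of 1] by eventually_elim (use D(2) in \<open>simp add: mom\<close>, metis D(2) ennreal_le_iff exp_ge_zero exp_le_cancel_iff mom One_nat_def)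
  qed
  moreover have "s * q \<le> Lam \<mu> s"
  proof (rule linear_lower_bound)
    show "\<forall>\<^sub>F n in sequentially. real n * (s * q) - D \<le> real n * Lam \<mu> s"
      using eventually_ge_at_top[of 1]
    proof eventually_elim
      case (elim n)
      have "exp (real n * (s * q)) \<le> exp (real n * Lam \<mu> s + D)" using D(1)[of n] by (simp add: mom[OF elim])
      then show ?case by simp
    qed
  qed
  ultimately show "Lam \<mu> s - s * q = 0" by simp
  show "ln (tail \<mu> n x) = 0" if n: "1 \<le> n"
  proof (cases "x \<le> real n * q")
    case True
    have "tail \<mu> n x = measure (cpow \<mu> n) UNIV"
      unfolding tail_def
      by (rule C.finite_measure_eq_AE, use eq[OF n] in eventually_elim) (use True in auto)
    then show ?thesis using C.prob_space[of n] by simp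
  next
    case False
    have "tail \<mu> n x = measure (cpow \<mu> n) {}"
      unfolding tail_def
      by (rule C.finite_measure_eq_AE, use eq[OF n] in eventually_elim) (use False in auto)
    then show ?thesis by simp
  qed
qed

text \<open>\<open>deg\<close> records in one form what the two cases say about a bounded normalised
  semigroup: dimension one in the invertible case, a contradiction in the positive case.\<close>

lemma tail_rate:
  assumes tan: "tangent \<mu> s q" and deg: "\<And>\<eta> C. bounded_semigroup (nsem \<mu> q) \<eta> C \<Longrightarrow> CARD('n) = 1"
    and l: "l_seq \<longlonglongrightarrow> (0::real)" and \<epsilon>: "0 < \<epsilon>"
  shows "\<forall>\<^sub>F n in sequentially. \<forall>l. \<bar>l\<bar> \<le> l_seq n \<longrightarrow>
    \<bar>1 / real n * ln (tail \<mu> n (real n * (q + l))) - (Lam \<mu> s - s * q)\<bar> < \<epsilon>"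
proof -
  obtain K c p where K: "connecting K c p" by (rule connecting_exists)
  show ?thesis
  proof (rule fast_block_or_exact_order[OF tan K])
    fix m y assume "0 < tail \<mu> m y" "real (K + m) * q < y + ln c"
    from tail_rate_if_fast_block[OF tan K this l \<epsilon>] show ?thesis .
  next
    fix \<eta> C assume bs: "bounded_semigroup (nsem \<mu> q) \<eta> C"
    note one = tail_rate_one_dimensional[OF tan deg[OF bs] bs]
    show ?thesis
      using eventually_ge_at_top[of 1] by eventually_elim (simp add: one \<epsilon>)
  qed
qed

end

theorem theorem2p5:
  fixes M :: "'w measure"
    and g :: "nat \<Rightarrow> 'w \<Rightarrow> real^'n^'n"
    and \<mu> :: "(real^'n^'n) measure"
    and s q :: real
    and l_seq :: "nat \<Rightarrow> real"
  assumes "prob_space M"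
    and "prob_space.indep_vars M (\<lambda>_. borel) g {1..}"
    and "\<And>n. n \<ge> 1 \<Longrightarrow> distr M borel (g n) = \<mu>"
    and "(invertible_case \<mu> \<and> moment_condition (sphere 0 1) \<mu>) \<or>
         (positive_case \<mu> \<and> moment_condition pos_sphere \<mu>)"
    and "s \<in> interior (I_set \<mu>)"
    and "(Lambda M g has_real_derivative q) (at s)"
    and "\<And>n. n \<ge> 1 \<Longrightarrow> l_seq n > 0"
    and "l_seq \<longlonglongrightarrow> 0"
  shows "\<forall>\<epsilon>>0. \<forall>\<^sub>F n in sequentially. \<forall>l. \<bar>l\<bar> \<le> l_seq n \<longrightarrow>
           \<bar>1 / real n * ln (measure M (deviation_event M g n (real n * (q + l))))
              - (- Lambda_star \<mu> M g q)\<bar> < \<epsilon>"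
proof -
  interpret M: prob_space M by fact
  have law: "\<forall>n\<ge>1. distr M borel (g n) = \<mu>" using assms(3) by blast
  have "g 1 \<in> borel_measurable M" using assms(2) by (auto simp: M.indep_vars_def)
  then have "prob_space (distr M borel (g 1))" by (rule M.prob_space_distr)
  moreover have \<mu>: "\<mu> = distr M borel (g 1)" using law by simp
  ultimately interpret matrix_law \<mu>
    by (intro matrix_law.intro matrix_law_axioms.intro) auto
  obtain CA where CA: "cone_law \<mu> CA" and deg: "\<And>\<eta> C. bounded_semigroup (nsem \<mu> q) \<eta> C \<Longrightarrow> CARD('n) = 1"
    using assms(4)
  proof (elim disjE conjE)
    assume "invertible_case \<mu>"
    then have inv: "AE A in \<mu>. invertible A" and irr: "strongly_irreducible (Gamma \<mu>)"
      and prox: "\<exists>A\<in>Gamma \<mu>. proximal A" by (auto simp: invertible_case_def)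
    show ?thesis
      by (rule that[OF cone_law_invertible[OF inv irr]]) (use prox degenerate_if_irreducible_proximal[OF _ irr] in blast)
  next
    assume "positive_case \<mu>"
    then have all: "\<forall>A\<in>Gamma \<mu>. allowable A" and sp: "\<exists>A\<in>Gamma \<mu>. strictly_positive_matrix A"
      and na: "\<not> arithmetic \<mu>" by (auto simp: positive_case_def)
    show ?thesis
      by (rule that[OF cone_law_positive[OF all sp]]) (use na arithmetic_if_bounded[OF _ all sp] in blast)
  qed
  interpret cone_law \<mu> CA by (rule CA)
  note tan = tangent_if_derivative[OF assms(1,2) law assms(5,6)]
  note star = Lambda_star_eq[OF assms(1,2) law tan]
  show ?thesis
  proof (intro allI impI)
    fix \<epsilon> :: real assume "0 < \<epsilon>"
    from tail_rate[OF tan deg assms(8) this]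
    show "\<forall>\<^sub>F n in sequentially. \<forall>l. \<bar>l\<bar> \<le> l_seq n \<longrightarrow>
           \<bar>1 / real n * ln (measure M (deviation_event M g n (real n * (q + l))))
              - (- Lambda_star \<mu> M g q)\<bar> < \<epsilon>"
      unfolding measure_deviation_event[OF assms(1,2) law] star by simp
  qed
qed

end
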